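(* For any cartesian double categories $\mathbb{D}$ and $\mathbb{E}$, there is a 2-category $\mathbf{CartLax}_\ell(\mathbb{D},\mathbb{E})$ whose objects are cartesian lax double functors $\mathbb{D}\to\mathbb{E}$, morphisms are cartesian lax natural transformations, and 2-morphisms are modulations.
   Context: Double categories are pseudo: strict in the direction of arrows, weak in the direction of proarrows. A double category $\mathbb{D}$ has underlying categories $\mathbb{D}_0$ (objects and arrows) and $\mathbb{D}_1$ (proarrows, written $m: x \nrightarrow y$, and cells). A cell $\alpha: m \to n$ from $m: x \nrightarrow y$ to $n: w \nrightarrow z$ over $(f,g)$ has source arrow $f: x\to w$ and target arrow $g: y \to z$; it is globular if $f,g$ are identities. Composition in $\mathbb{D}_0,\mathbb{D}_1$ is written $\cdot$ in diagrammatic order; external composition of proarrows and cells is written $\odot$ in diagrammatic order, with external identities $\mathrm{id}_x,\mathrm{id}_f$. Coherence isomorphisms for $\odot$ are suppressed in formulas. A double category $\mathbb{D}$ is cartesian if $\mathbb{D}\to\mathbb{D}\times\mathbb{D}$ (diagonal) and $\mathbb{D}\to\mathbb{1}$ have right adjoints in the 2-category of double categories, pseudo double functors and natural transformations; explicitly, $\mathbb{D}_0,\mathbb{D}_1$ have finite products, preserved by source and target, and external composition and external identity preserve finite products up to the canonical comparison isomorphisms. Lax double functor $F:\mathbb{D}\to\mathbb{E}$: functors $F_0,F_1$ compatible with source and target, with globular laxators $F_{m,n}:Fm\odot Fn\to F(m\odot n)$ and unitors $F_x:\mathrm{id}_{Fx}\to F\mathrm{id}_x$, natural ($(F\alpha\odot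 F\beta)\cdot F_{m',n'}=F_{m,n}\cdot F(\alpha\odot\beta)$, $\mathrm{id}_{Ff}\cdot F_y=F_x\cdot F\mathrm{id}_f$), associative and unital. $F_{x,m}:F\mathrm{id}_x\odot Fm\to Fm$, $F_{m,y}:Fm\odot F\mathrm{id}_y\to Fm$ denote laxators at identity proarrows. Between cartesian double categories, $F$ is cartesian if $F_0$ and $F_1$ preserve finite products. Lax natural transformation $\alpha:F\Rightarrow G$ of lax functors $\mathbb{D}\to\mathbb{E}$: arrows $\alpha_x:Fx\to Gx$; cells $\alpha_m:Fm\to Gm$ over $(\alpha_x,\alpha_y)$ for $m:x\nrightarrow y$; for each arrow $f:x\to y$ a cell $\alpha_f:\mathrm{id}_{Fx}\to G\mathrm{id}_y$ over $(\alpha_x\cdot Gf,\ Ff\cdot\alpha_y)$; such that (1) for each cell $\gamma:m\to n$ over $(f,g)$, $m:x\nrightarrow y$, $n:w\nrightarrow z$: $(\alpha_f\odot(F\gamma\cdot\alpha_n))\cdot G_{w,n}=((\alpha_m\cdot G\gamma)\odot\alpha_g)\cdot G_{n,z}$; (2) $F_{m,n}\cdot\alpha_{m\odot n}=(\alpha_m\odot\alpha_n)\cdot G_{m,n}$ and $F_x\cdot\alpha_{\mathrm{id}_x}=\mathrm{id}_{\alpha_x}\cdot G_x$; (3) for $x\xrightarrow{f}y\xrightarrow{g}z$, $\alpha_{f\cdot g}=((\alpha_f\cdot G\mathrm{id}_g)\odot(\mathrm{id}_{Ff}\cdot\alpha_g))\cdot G_{z,z}$ and $\alpha_{1_x}=\mathrm{id}_{\alpha_x}\cdot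 G_x$. Composition: $(\alpha\beta)_x=\alpha_x\cdot\beta_x$, $(\alpha\beta)_m=\alpha_m\cdot\beta_m$, $(\alpha\beta)_f=((\mathrm{id}_{\alpha_x}\cdot\beta_f)\odot(\alpha_f\cdot\beta_{\mathrm{id}_y}))\cdot H_{y,y}$; the identity on $F$ has $(1_F)_f=\mathrm{id}_{Ff}\cdot F_y$ and identity components. $\alpha$ is cartesian if for each projection $\pi:x_1\times x_2\to x_i$ it is strictly natural: $\alpha_{x_1\times x_2}\cdot G\pi=F\pi\cdot\alpha_{x_i}$, and $\alpha_\pi=\mathrm{id}_{F\pi\cdot\alpha_{x_i}}\cdot G_{x_i}$. Modulation $\mu:\alpha\Rrightarrow\beta$ of lax transformations $\alpha,\beta:F\Rightarrow G$: for each object $x$ of $\mathbb{D}$ a cell $\mu_x:\mathrm{id}_{Fx}\to G\mathrm{id}_x$ over $(\alpha_x,\beta_x)$ such that for each $m:x\nrightarrow y$, $(\mu_x\odot\beta_m)\cdot G_{x,m}=(\alpha_m\odot\mu_y)\cdot G_{m,y}$ (this common cell is denoted $\mu_m$), and for each cell $\gamma:m\to n$ over $(f,g)$, $m:x\nrightarrow y$, $n:w\nrightarrow z$, $(\alpha_f\odot(F\gamma\cdot\mu_n))\cdot G_{w,n}=((\mu_m\cdot G\gamma)\odot\beta_g)\cdot G_{n,z}$. Compositions: $(\mu\cdot\nu)_x=(\mu_x\odot\nu_x)\cdot G_{x,x}$ for $\mu:\alpha\Rrightarrow\beta$, $\nu:\beta\Rrightarrow\gamma$; identities $(1_\alpha)_x=\mathrm{id}_{\alpha_x}\cdot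 G_x$; and, for $\mu$ between transformations $F\Rightarrow G$ and $\nu$ between transformations $G\Rightarrow H$, $(\mu*\nu)_x=\mu_x\cdot\nu_{\mathrm{id}_x}$. *)

theory Defs
  imports Main "HOL-Library.FuncSet"
begin

section \<open>Categories, functors and finite products\<close>

text \<open>All compositions are written in diagrammatic order.\<close>

record ('o, 'a) cat =
  Obj :: "'o set"
  Arr :: "'a set"
  Dom :: "'a \<Rightarrow> 'o"
  Cod :: "'a \<Rightarrow> 'o"
  Idn :: "'o \<Rightarrow> 'a"
  Cmp :: "'a \<Rightarrow> 'a \<Rightarrow> 'a" (infixl ";;\<index>" 70)

definition hom :: "('o, 'a, 'z) cat_scheme \<Rightarrow> 'o \<Rightarrow> 'o \<Rightarrow> 'a set" where
  "hom C x y = {f \<in> Arr C. Dom C f = x \<and> Cod C f = y}"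

locale category =
  fixes C (structure)
  assumes Dom_Obj: "f \<in> Arr C \<Longrightarrow> Dom C f \<in> Obj C"
    and Cod_Obj: "f \<in> Arr C \<Longrightarrow> Cod C f \<in> Obj C"
    and Idn_hom: "x \<in> Obj C \<Longrightarrow> Idn C x \<in> hom C x x"
    and Cmp_hom: "\<lbrakk>f \<in> hom C x y; g \<in> hom C y z\<rbrakk> \<Longrightarrow> f ;; g \<in> hom C x z"
    and Idn_left: "f \<in> hom C x y \<Longrightarrow> Idn C x ;; f = f"
    and Idn_right: "f \<in> hom C x y \<Longrightarrow> f ;; Idn C y = f"
    and Cmp_assoc: "\<lbrakk>f \<in> hom C w x; g \<in> hom C x y; h \<in> hom C y z\<rbrakk>
      \<Longrightarrow> (f ;; g) ;; h = f ;; (g ;; h)"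

definition inverse_arr :: "('o, 'a, 'z) cat_scheme \<Rightarrow> 'a \<Rightarrow> 'a \<Rightarrow> bool" where
  "inverse_arr C f g \<longleftrightarrow> f \<in> Arr C \<and> g \<in> hom C (Cod C f) (Dom C f)
     \<and> f ;;\<^bsub>C\<^esub> g = Idn C (Dom C f) \<and> g ;;\<^bsub>C\<^esub> f = Idn C (Cod C f)"

definition iso :: "('o, 'a, 'z) cat_scheme \<Rightarrow> 'a \<Rightarrow> bool" where
  "iso C f \<longleftrightarrow> (\<exists>g. inverse_arr C f g)"

definition inv_arr :: "('o, 'a, 'z) cat_scheme \<Rightarrow> 'a \<Rightarrow> 'a" where
  "inv_arr C f = (THE g. inverse_arr C f g)"

record ('o, 'a, 'p, 'b) fun_data =
  onO :: "'o \<Rightarrow> 'p"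
  onA :: "'a \<Rightarrow> 'b"

locale cat_functor = dom: category C + cod: category C' for C and C' +
  fixes F
  assumes onO_Obj: "x \<in> Obj C \<Longrightarrow> onO F x \<in> Obj C'"
    and onA_hom: "f \<in> hom C x y \<Longrightarrow> onA F f \<in> hom C' (onO F x) (onO F y)"
    and onA_Idn: "x \<in> Obj C \<Longrightarrow> onA F (Idn C x) = Idn C' (onO F x)"
    and onA_Cmp: "\<lbrakk>f \<in> hom C x y; g \<in> hom C y z\<rbrakk>
      \<Longrightarrow> onA F (f ;;\<^bsub>C\<^esub> g) = onA F f ;;\<^bsub>C'\<^esub> onA F g"

definition is_terminal :: "('o, 'a, 'z) cat_scheme \<Rightarrow> 'o \<Rightarrow> bool" where
  "is_terminal C t \<longleftrightarrow> t \<in> Obj C \<and> (\<forall>x \<in> Obj C. \<exists>!f. f \<in> hom C x t)"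

definition is_product ::
    "('o, 'a, 'z) cat_scheme \<Rightarrow> 'o \<Rightarrow> 'o \<Rightarrow> 'o \<Rightarrow> 'a \<Rightarrow> 'a \<Rightarrow> bool" where
  "is_product C x y p \<pi>\<^sub>1 \<pi>\<^sub>2 \<longleftrightarrow> x \<in> Obj C \<and> y \<in> Obj C \<and> p \<in> Obj C
     \<and> \<pi>\<^sub>1 \<in> hom C p x \<and> \<pi>\<^sub>2 \<in> hom C p y
     \<and> (\<forall>w f g. f \<in> hom C w x \<and> g \<in> hom C w y
          \<longrightarrow> (\<exists>!h. h \<in> hom C w p \<and> h ;;\<^bsub>C\<^esub> \<pi>\<^sub>1 = f \<and> h ;;\<^bsub>C\<^esub> \<pi>\<^sub>2 = g))"

definition preserves_finite_products where
  "preserves_finite_products C C' F \<longleftrightarrow>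
     (\<forall>t. is_terminal C t \<longrightarrow> is_terminal C' (onO F t))
   \<and> (\<forall>x y p \<pi>\<^sub>1 \<pi>\<^sub>2. is_product C x y p \<pi>\<^sub>1 \<pi>\<^sub>2
        \<longrightarrow> is_product C' (onO F x) (onO F y) (onO F p) (onA F \<pi>\<^sub>1) (onA F \<pi>\<^sub>2))"

record ('o, 'a) prod_data =
  trm :: "'o"
  prd :: "'o \<Rightarrow> 'o \<Rightarrow> 'o"
  prj1 :: "'o \<Rightarrow> 'o \<Rightarrow> 'a"
  prj2 :: "'o \<Rightarrow> 'o \<Rightarrow> 'a"

definition chosen_finite_products where
  "chosen_finite_products C P \<longleftrightarrow> is_terminal C (trm P)
   \<and> (\<forall>x \<in> Obj C. \<forall>y \<in> Obj C. is_product C x y (prd P x y) (prj1 P x y) (prj2 P x y))"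

section \<open>Pseudo double categories\<close>

text \<open>
  \<open>D0\<close> has the objects and arrows, \<open>D1\<close> the proarrows and cells. \<open>AS m n p\<close> is the associator
  \<open>(m \<odot> n) \<odot> p \<rightarrow> m \<odot> (n \<odot> p)\<close>; \<open>LU m\<close> and \<open>RU m\<close> are the unitors \<open>id \<odot> m \<rightarrow> m\<close> and
  \<open>m \<odot> id \<rightarrow> m\<close>. External composition is written \<open>\<odot>\<close> for proarrows and \<open>\<Odot>\<close> for cells.
\<close>

record ('o, 'a, 'p, 'c) dbl_cat =
  D0 :: "('o, 'a) cat"
  D1 :: "('p, 'c) cat"
  Src :: "('p, 'c, 'o, 'a) fun_data"
  Tgt :: "('p, 'c, 'o, 'a) fun_data"
  Ext :: "('o, 'a, 'p, 'c) fun_data"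
  pcmp :: "'p \<Rightarrow> 'p \<Rightarrow> 'p" (infixl "\<odot>\<index>" 70)
  ecmp :: "'c \<Rightarrow> 'c \<Rightarrow> 'c" (infixl "\<Odot>\<index>" 70)
  AS :: "'p \<Rightarrow> 'p \<Rightarrow> 'p \<Rightarrow> 'c"
  LU :: "'p \<Rightarrow> 'c"
  RU :: "'p \<Rightarrow> 'c"

abbreviation acmp (infixl "\<bullet>\<index>" 70) where "f \<bullet>\<^bsub>D\<^esub> g \<equiv> Cmp (D0 D) f g"
abbreviation ccmp (infixl "\<cdot>\<index>" 70) where "\<gamma> \<cdot>\<^bsub>D\<^esub> \<delta> \<equiv> Cmp (D1 D) \<gamma> \<delta>"
abbreviation psrc where "psrc D m \<equiv> onO (Src D) m"
abbreviation ptgt where "ptgt D m \<equiv> onO (Tgt D) m"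
abbreviation csrc where "csrc D \<gamma> \<equiv> onA (Src D) \<gamma>"
abbreviation ctgt where "ctgt D \<gamma> \<equiv> onA (Tgt D) \<gamma>"
abbreviation pid where "pid D x \<equiv> onO (Ext D) x"
abbreviation cid where "cid D f \<equiv> onA (Ext D) f"
abbreviation id1 where "id1 D m \<equiv> Idn (D1 D) m"
abbreviation LUi where "LUi D m \<equiv> inv_arr (D1 D) (LU D m)"
abbreviation RUi where "RUi D m \<equiv> inv_arr (D1 D) (RU D m)"

definition proarrow where
  "proarrow D m x y \<longleftrightarrow> m \<in> Obj (D1 D) \<and> psrc D m = x \<and> ptgt D m = y"

definition cells where
  "cells D m n f g = {\<gamma> \<in> hom (D1 D) m n. csrc D \<gamma> = f \<and> ctgt D \<gamma> = g}"

definition globular_iso where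
  "globular_iso D m n \<gamma> \<longleftrightarrow> iso (D1 D) \<gamma>
     \<and> \<gamma> \<in> cells D m n (Idn (D0 D) (psrc D m)) (Idn (D0 D) (ptgt D m))"

locale double_category =
  fixes D (structure)
  assumes Src_functor: "cat_functor (D1 D) (D0 D) (Src D)"
    and Tgt_functor: "cat_functor (D1 D) (D0 D) (Tgt D)"
    and Ext_functor: "cat_functor (D0 D) (D1 D) (Ext D)"
    and pid_proarrow: "x \<in> Obj (D0 D) \<Longrightarrow> proarrow D (pid D x) x x"
    and cid_cell: "f \<in> hom (D0 D) x y \<Longrightarrow> cid D f \<in> cells D (pid D x) (pid D y) f f"
    and pcmp_proarrow: "\<lbrakk>proarrow D m x y; proarrow D n y z\<rbrakk> \<Longrightarrow> proarrow D (m \<odot> n) x z"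
    and ecmp_cell: "\<lbrakk>\<gamma> \<in> cells D m n f g; \<delta> \<in> cells D m' n' g h\<rbrakk>
      \<Longrightarrow> \<gamma> \<Odot> \<delta> \<in> cells D (m \<odot> m') (n \<odot> n') f h"
    and ecmp_Idn: "\<lbrakk>proarrow D m x y; proarrow D n y z\<rbrakk>
      \<Longrightarrow> id1 D m \<Odot> id1 D n = id1 D (m \<odot> n)"
    and interchange: "\<lbrakk>\<gamma> \<in> cells D m n f g; \<gamma>' \<in> cells D n p f' g';
        \<delta> \<in> cells D q r g h; \<delta>' \<in> cells D r s g' h'\<rbrakk>
      \<Longrightarrow> (\<gamma> \<cdot> \<gamma>') \<Odot> (\<delta> \<cdot> \<delta>') = (\<gamma> \<Odot> \<delta>) \<cdot> (\<gamma>' \<Odot> \<delta>')"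
    and AS_iso: "\<lbrakk>proarrow D m w x; proarrow D n x y; proarrow D p y z\<rbrakk>
      \<Longrightarrow> globular_iso D ((m \<odot> n) \<odot> p) (m \<odot> (n \<odot> p)) (AS D m n p)"
    and LU_iso: "proarrow D m x y \<Longrightarrow> globular_iso D (pid D x \<odot> m) m (LU D m)"
    and RU_iso: "proarrow D m x y \<Longrightarrow> globular_iso D (m \<odot> pid D y) m (RU D m)"
    and AS_natural: "\<lbrakk>\<gamma> \<in> cells D m m' f g; \<delta> \<in> cells D n n' g h; \<epsilon> \<in> cells D p p' h k\<rbrakk>
      \<Longrightarrow> ((\<gamma> \<Odot> \<delta>) \<Odot> \<epsilon>) \<cdot> AS D m' n' p' = AS D m n p \<cdot> (\<gamma> \<Odot> (\<delta> \<Odot> \<epsilon>))"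
    and LU_natural: "\<gamma> \<in> cells D m n f g \<Longrightarrow> (cid D f \<Odot> \<gamma>) \<cdot> LU D n = LU D m \<cdot> \<gamma>"
    and RU_natural: "\<gamma> \<in> cells D m n f g \<Longrightarrow> (\<gamma> \<Odot> cid D g) \<cdot> RU D n = RU D m \<cdot> \<gamma>"
    and pentagon: "\<lbrakk>proarrow D m v w; proarrow D n w x; proarrow D p x y; proarrow D q y z\<rbrakk>
      \<Longrightarrow> ((AS D m n p \<Odot> id1 D q) \<cdot> AS D m (n \<odot> p) q) \<cdot> (id1 D m \<Odot> AS D n p q)
          = AS D (m \<odot> n) p q \<cdot> AS D m n (p \<odot> q)"
    and triangle: "\<lbrakk>proarrow D m x y; proarrow D n y z\<rbrakk>
      \<Longrightarrow> AS D m (pid D y) n \<cdot> (id1 D m \<Odot> LU D n) = RU D m \<Odot> id1 D n"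

text \<open>
  The right adjoints of the diagonal and of the map to the terminal double category are given by
  the chosen products \<open>P0\<close>, \<open>P1\<close>. Since these adjoints and their counits live in the 2-category of
  double categories, they commute strictly with source and target. External composition and
  external identity preserve products up to the canonical comparisons: the images of the
  chosen product cones are again product cones.
\<close>

record ('o, 'a, 'p, 'c) cart_dbl_cat = "('o, 'a, 'p, 'c) dbl_cat" +
  P0 :: "('o, 'a) prod_data"
  P1 :: "('p, 'c) prod_data"

definition strictly_preserves_chosen where
  "strictly_preserves_chosen C P P' F \<longleftrightarrow> onO F (trm P) = trm P'
   \<and> (\<forall>m \<in> Obj C. \<forall>n \<in> Obj C.
        onO F (prd P m n) = prd P' (onO F m) (onO F n)
      \<and> onA F (prj1 P m n) = prj1 P' (onO F m) (onO F n)
      \<and> onA F (prj2 P m n) = prj2 P' (onO F m) (onO F n))"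

locale cartesian_double_category = double_category D
  for D :: "('o, 'a, 'p, 'c, 'z) cart_dbl_cat_scheme" (structure) +
  assumes products0: "chosen_finite_products (D0 D) (P0 D)"
    and products1: "chosen_finite_products (D1 D) (P1 D)"
    and Src_products: "strictly_preserves_chosen (D1 D) (P1 D) (P0 D) (Src D)"
    and Tgt_products: "strictly_preserves_chosen (D1 D) (P1 D) (P0 D) (Tgt D)"
    and pcmp_terminal: "is_terminal (D1 D) (trm (P1 D) \<odot> trm (P1 D))"
    and pcmp_product: "\<lbrakk>proarrow D m x y; proarrow D n y z;
        proarrow D m' x' y'; proarrow D n' y' z'\<rbrakk>
      \<Longrightarrow> is_product (D1 D) (m \<odot> n) (m' \<odot> n') (prd (P1 D) m m' \<odot> prd (P1 D) n n')
            (prj1 (P1 D) m m' \<Odot> prj1 (P1 D) n n') (prj2 (P1 D) m m' \<Odot> prj2 (P1 D) n n')"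
    and pid_terminal: "is_terminal (D1 D) (pid D (trm (P0 D)))"
    and pid_product: "\<lbrakk>x \<in> Obj (D0 D); y \<in> Obj (D0 D)\<rbrakk>
      \<Longrightarrow> is_product (D1 D) (pid D x) (pid D y) (pid D (prd (P0 D) x y))
            (cid D (prj1 (P0 D) x y)) (cid D (prj2 (P0 D) x y))"

section \<open>Lax double functors\<close>

text \<open>
  Functions on carriers are required to be \<open>undefined\<close> outside of them, here and below, so that
  equality of the records is equality of the mathematical objects.
\<close>

record ('o, 'a, 'p, 'c, 'o2, 'a2, 'p2, 'c2) lax_fun =
  F0 :: "('o, 'a, 'o2, 'a2) fun_data"
  F1 :: "('p, 'c, 'p2, 'c2) fun_data"
  laxator :: "'p \<Rightarrow> 'p \<Rightarrow> 'c2"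
  unitor :: "'o \<Rightarrow> 'c2"

abbreviation Fo where "Fo F x \<equiv> onO (F0 F) x"
abbreviation Fa where "Fa F f \<equiv> onA (F0 F) f"
abbreviation Fp where "Fp F m \<equiv> onO (F1 F) m"
abbreviation Fc where "Fc F \<gamma> \<equiv> onA (F1 F) \<gamma>"

locale lax_double_functor = dom: double_category D + cod: double_category E
  for D and E (structure) +
  fixes F
  assumes F0_functor: "cat_functor (D0 D) (D0 E) (F0 F)"
    and F1_functor: "cat_functor (D1 D) (D1 E) (F1 F)"
    and Fp_proarrow: "proarrow D m x y \<Longrightarrow> proarrow E (Fp F m) (Fo F x) (Fo F y)"
    and Fc_cell: "\<gamma> \<in> cells D m n f g
      \<Longrightarrow> Fc F \<gamma> \<in> cells E (Fp F m) (Fp F n) (Fa F f) (Fa F g)"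
    and laxator_cell: "\<lbrakk>proarrow D m x y; proarrow D n y z\<rbrakk>
      \<Longrightarrow> laxator F m n \<in> cells E (Fp F m \<odot> Fp F n) (Fp F (m \<odot>\<^bsub>D\<^esub> n))
            (Idn (D0 E) (Fo F x)) (Idn (D0 E) (Fo F z))"
    and unitor_cell: "x \<in> Obj (D0 D)
      \<Longrightarrow> unitor F x \<in> cells E (pid E (Fo F x)) (Fp F (pid D x))
            (Idn (D0 E) (Fo F x)) (Idn (D0 E) (Fo F x))"
    and laxator_natural: "\<lbrakk>\<gamma> \<in> cells D m m' f g; \<delta> \<in> cells D n n' g h\<rbrakk>
      \<Longrightarrow> (Fc F \<gamma> \<Odot> Fc F \<delta>) \<cdot> laxator F m' n' = laxator F m n \<cdot> Fc F (\<gamma> \<Odot>\<^bsub>D\<^esub> \<delta>)"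
    and unitor_natural: "f \<in> hom (D0 D) x y
      \<Longrightarrow> cid E (Fa F f) \<cdot> unitor F y = unitor F x \<cdot> Fc F (cid D f)"
    and laxator_assoc: "\<lbrakk>proarrow D m w x; proarrow D n x y; proarrow D p y z\<rbrakk>
      \<Longrightarrow> ((laxator F m n \<Odot> id1 E (Fp F p)) \<cdot> laxator F (m \<odot>\<^bsub>D\<^esub> n) p) \<cdot> Fc F (AS D m n p)
          = (AS E (Fp F m) (Fp F n) (Fp F p) \<cdot> (id1 E (Fp F m) \<Odot> laxator F n p))
              \<cdot> laxator F m (n \<odot>\<^bsub>D\<^esub> p)"
    and laxator_left_unit: "proarrow D m x y
      \<Longrightarrow> ((unitor F x \<Odot> id1 E (Fp F m)) \<cdot> laxator F (pid D x) m) \<cdot> Fc F (LU D m)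
          = LU E (Fp F m)"
    and laxator_right_unit: "proarrow D m x y
      \<Longrightarrow> ((id1 E (Fp F m) \<Odot> unitor F y) \<cdot> laxator F m (pid D y)) \<cdot> Fc F (RU D m)
          = RU E (Fp F m)"
    and F0_extensional: "onO (F0 F) \<in> extensional (Obj (D0 D))" "onA (F0 F) \<in> extensional (Arr (D0 D))"
    and F1_extensional: "onO (F1 F) \<in> extensional (Obj (D1 D))" "onA (F1 F) \<in> extensional (Arr (D1 D))"
    and laxator_extensional:
      "\<not> (m \<in> Obj (D1 D) \<and> n \<in> Obj (D1 D) \<and> ptgt D m = psrc D n) \<Longrightarrow> laxator F m n = undefined"
    and unitor_extensional: "unitor F \<in> extensional (Obj (D0 D))"

definition cartesian_lax_functor where
  "cartesian_lax_functor D E F \<longleftrightarrow> lax_double_functor D E F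
     \<and> preserves_finite_products (D0 D) (D0 E) (F0 F)
     \<and> preserves_finite_products (D1 D) (D1 E) (F1 F)"

text \<open>
  The laxators \<open>F\<^bsub>x,m\<^esub> : F id\<^sub>x \<odot> F m \<rightarrow> F m\<close> and \<open>F\<^bsub>m,y\<^esub> : F m \<odot> F id\<^sub>y \<rightarrow> F m\<close> at identity
  proarrows, with the unitor of \<open>D\<close> made explicit.
\<close>

definition lax_left where
  "lax_left D E F m = laxator F (pid D (psrc D m)) m \<cdot>\<^bsub>E\<^esub> Fc F (LU D m)"

definition lax_right where
  "lax_right D E F m = laxator F m (pid D (ptgt D m)) \<cdot>\<^bsub>E\<^esub> Fc F (RU D m)"

text \<open>
  \<open>F\<^bsub>x,x\<^esub> : F id\<^sub>x \<odot> F id\<^sub>x \<rightarrow> F id\<^sub>x\<close>; using the right unitor instead gives the same cell, because the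
  two unitors agree at \<open>id\<^sub>x\<close>.
\<close>

definition lax_id where
  "lax_id D E F x = lax_left D E F (pid D x)"

section \<open>Lax natural transformations\<close>

text \<open>A transformation carries its source and target functor.\<close>

record ('o, 'a, 'p, 'c, 'o2, 'a2, 'p2, 'c2) trans =
  tdom :: "('o, 'a, 'p, 'c, 'o2, 'a2, 'p2, 'c2) lax_fun"
  tcod :: "('o, 'a, 'p, 'c, 'o2, 'a2, 'p2, 'c2) lax_fun"
  tO :: "'o \<Rightarrow> 'a2"
  tP :: "'p \<Rightarrow> 'c2"
  tA :: "'a \<Rightarrow> 'c2"

text \<open>
  Two sides of an equation whose domains are \<open>id \<odot> F m\<close> and \<open>F m \<odot> id\<close> are compared as cells out of
  \<open>F m\<close>, by precomposing with the inverse unitors \<open>LUi\<close> and \<open>RUi\<close>. Similarly, a composite out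
  of \<open>id \<odot> id\<close> is turned into a cell out of \<open>id\<close>.
\<close>

locale lax_transformation =
  fixes D and E (structure) and \<alpha> and F and G
  defines "F \<equiv> tdom \<alpha>" and "G \<equiv> tcod \<alpha>"
  assumes tdom_functor: "lax_double_functor D E F"
    and tcod_functor: "lax_double_functor D E G"
    and tO_hom: "x \<in> Obj (D0 D) \<Longrightarrow> tO \<alpha> x \<in> hom (D0 E) (Fo F x) (Fo G x)"
    and tP_cell: "proarrow D m x y
      \<Longrightarrow> tP \<alpha> m \<in> cells E (Fp F m) (Fp G m) (tO \<alpha> x) (tO \<alpha> y)"
    and tA_cell: "f \<in> hom (D0 D) x y
      \<Longrightarrow> tA \<alpha> f \<in> cells E (pid E (Fo F x)) (Fp G (pid D y))
            (tO \<alpha> x \<bullet> Fa G f) (Fa F f \<bullet> tO \<alpha> y)"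
    and trans_natural: "\<lbrakk>proarrow D m x y; proarrow D n w z; \<gamma> \<in> cells D m n f g\<rbrakk>
      \<Longrightarrow> LUi E (Fp F m) \<cdot> ((tA \<alpha> f \<Odot> (Fc F \<gamma> \<cdot> tP \<alpha> n)) \<cdot> lax_left D E G n)
          = RUi E (Fp F m) \<cdot> (((tP \<alpha> m \<cdot> Fc G \<gamma>) \<Odot> tA \<alpha> g) \<cdot> lax_right D E G n)"
    and trans_laxator: "\<lbrakk>proarrow D m x y; proarrow D n y z\<rbrakk>
      \<Longrightarrow> laxator F m n \<cdot> tP \<alpha> (m \<odot>\<^bsub>D\<^esub> n) = (tP \<alpha> m \<Odot> tP \<alpha> n) \<cdot> laxator G m n"
    and trans_unitor: "x \<in> Obj (D0 D)
      \<Longrightarrow> unitor F x \<cdot> tP \<alpha> (pid D x) = cid E (tO \<alpha> x) \<cdot> unitor G x"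
    and trans_Cmp: "\<lbrakk>f \<in> hom (D0 D) x y; g \<in> hom (D0 D) y z\<rbrakk>
      \<Longrightarrow> tA \<alpha> (f \<bullet>\<^bsub>D\<^esub> g)
          = LUi E (pid E (Fo F x)) \<cdot>
              (((tA \<alpha> f \<cdot> Fc G (cid D g)) \<Odot> (cid E (Fa F f) \<cdot> tA \<alpha> g)) \<cdot> lax_id D E G z)"
    and trans_Idn: "x \<in> Obj (D0 D)
      \<Longrightarrow> tA \<alpha> (Idn (D0 D) x) = cid E (tO \<alpha> x) \<cdot> unitor G x"
    and trans_extensional: "tO \<alpha> \<in> extensional (Obj (D0 D))"
      "tP \<alpha> \<in> extensional (Obj (D1 D))" "tA \<alpha> \<in> extensional (Arr (D0 D))"

definition strictly_natural_at where
  "strictly_natural_at D E \<alpha> \<pi> \<longleftrightarrow>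
     (let F = tdom \<alpha>; G = tcod \<alpha>; x = Dom (D0 D) \<pi>; y = Cod (D0 D) \<pi> in
       tO \<alpha> x \<bullet>\<^bsub>E\<^esub> Fa G \<pi> = Fa F \<pi> \<bullet>\<^bsub>E\<^esub> tO \<alpha> y
     \<and> tA \<alpha> \<pi> = cid E (Fa F \<pi> \<bullet>\<^bsub>E\<^esub> tO \<alpha> y) \<cdot>\<^bsub>E\<^esub> unitor G y)"

definition cartesian_lax_transformation where
  "cartesian_lax_transformation D E \<alpha> \<longleftrightarrow> lax_transformation D E \<alpha>
     \<and> cartesian_lax_functor D E (tdom \<alpha>) \<and> cartesian_lax_functor D E (tcod \<alpha>)
     \<and> (\<forall>x \<in> Obj (D0 D). \<forall>y \<in> Obj (D0 D).
          strictly_natural_at D E \<alpha> (prj1 (P0 D) x y)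
        \<and> strictly_natural_at D E \<alpha> (prj2 (P0 D) x y))"

definition trans_id where
  "trans_id D E F = \<lparr>tdom = F, tcod = F,
     tO = (\<lambda>x \<in> Obj (D0 D). Idn (D0 E) (Fo F x)),
     tP = (\<lambda>m \<in> Obj (D1 D). id1 E (Fp F m)),
     tA = (\<lambda>f \<in> Arr (D0 D). cid E (Fa F f) \<cdot>\<^bsub>E\<^esub> unitor F (Cod (D0 D) f))\<rparr>"

definition trans_comp where
  "trans_comp D E \<alpha> \<beta> = (let F = tdom \<alpha>; H = tcod \<beta> in
     \<lparr>tdom = F, tcod = H,
      tO = (\<lambda>x \<in> Obj (D0 D). tO \<alpha> x \<bullet>\<^bsub>E\<^esub> tO \<beta> x),
      tP = (\<lambda>m \<in> Obj (D1 D). tP \<alpha> m \<cdot>\<^bsub>E\<^esub> tP \<beta> m),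
      tA = (\<lambda>f \<in> Arr (D0 D). let x = Dom (D0 D) f; y = Cod (D0 D) f in
              LUi E (pid E (Fo F x)) \<cdot>\<^bsub>E\<^esub>
                (((cid E (tO \<alpha> x) \<cdot>\<^bsub>E\<^esub> tA \<beta> f) \<Odot>\<^bsub>E\<^esub> (tA \<alpha> f \<cdot>\<^bsub>E\<^esub> tP \<beta> (pid D y)))
                   \<cdot>\<^bsub>E\<^esub> lax_id D E H y))\<rparr>)"

section \<open>Modulations\<close>

record ('o, 'a, 'p, 'c, 'o2, 'a2, 'p2, 'c2) modul =
  mdom :: "('o, 'a, 'p, 'c, 'o2, 'a2, 'p2, 'c2) trans"
  mcod :: "('o, 'a, 'p, 'c, 'o2, 'a2, 'p2, 'c2) trans"
  mO :: "'o \<Rightarrow> 'c2"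

text \<open>The cell \<open>\<mu>\<^sub>m : F m \<rightarrow> G m\<close> induced by a modulation \<open>\<mu>\<close> at a proarrow \<open>m\<close>.\<close>

definition mP where
  "mP D E \<mu> m =
     LUi E (Fp (tdom (mcod \<mu>)) m) \<cdot>\<^bsub>E\<^esub>
       ((mO \<mu> (psrc D m) \<Odot>\<^bsub>E\<^esub> tP (mcod \<mu>) m) \<cdot>\<^bsub>E\<^esub> lax_left D E (tcod (mcod \<mu>)) m)"

locale modulation =
  fixes D and E (structure) and \<mu> and \<alpha> and \<beta> and F and G
  defines "\<alpha> \<equiv> mdom \<mu>" and "\<beta> \<equiv> mcod \<mu>" and "F \<equiv> tdom \<alpha>" and "G \<equiv> tcod \<alpha>"
  assumes mdom_trans: "lax_transformation D E \<alpha>"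
    and mcod_trans: "lax_transformation D E \<beta>"
    and parallel: "tdom \<beta> = F" "tcod \<beta> = G"
    and mO_cell: "x \<in> Obj (D0 D)
      \<Longrightarrow> mO \<mu> x \<in> cells E (pid E (Fo F x)) (Fp G (pid D x)) (tO \<alpha> x) (tO \<beta> x)"
    and mod_proarrow: "proarrow D m x y
      \<Longrightarrow> LUi E (Fp F m) \<cdot> ((mO \<mu> x \<Odot> tP \<beta> m) \<cdot> lax_left D E G m)
          = RUi E (Fp F m) \<cdot> ((tP \<alpha> m \<Odot> mO \<mu> y) \<cdot> lax_right D E G m)"
    and mod_natural: "\<lbrakk>proarrow D m x y; proarrow D n w z; \<gamma> \<in> cells D m n f g\<rbrakk>
      \<Longrightarrow> LUi E (Fp F m) \<cdot> ((tA \<alpha> f \<Odot> (Fc F \<gamma> \<cdot> mP D E \<mu> n)) \<cdot> lax_left D E G n)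
          = RUi E (Fp F m) \<cdot> (((mP D E \<mu> m \<cdot> Fc G \<gamma>) \<Odot> tA \<beta> g) \<cdot> lax_right D E G n)"
    and mod_extensional: "mO \<mu> \<in> extensional (Obj (D0 D))"

definition mod_id where
  "mod_id D E \<alpha> = \<lparr>mdom = \<alpha>, mcod = \<alpha>,
     mO = (\<lambda>x \<in> Obj (D0 D). cid E (tO \<alpha> x) \<cdot>\<^bsub>E\<^esub> unitor (tcod \<alpha>) x)\<rparr>"

definition mod_comp where
  "mod_comp D E \<mu> \<nu> = \<lparr>mdom = mdom \<mu>, mcod = mcod \<nu>,
     mO = (\<lambda>x \<in> Obj (D0 D). LUi E (pid E (Fo (tdom (mdom \<mu>)) x)) \<cdot>\<^bsub>E\<^esub>
             ((mO \<mu> x \<Odot>\<^bsub>E\<^esub> mO \<nu> x) \<cdot>\<^bsub>E\<^esub> lax_id D E (tcod (mdom \<mu>)) x))\<rparr>"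

definition mod_hcomp where
  "mod_hcomp D E \<mu> \<nu> =
     \<lparr>mdom = trans_comp D E (mdom \<mu>) (mdom \<nu>), mcod = trans_comp D E (mcod \<mu>) (mcod \<nu>),
      mO = (\<lambda>x \<in> Obj (D0 D). mO \<mu> x \<cdot>\<^bsub>E\<^esub> mP D E \<nu> (pid D x))\<rparr>"

section \<open>2-categories\<close>

text \<open>
  \<open>C1\<close> consists of the objects and morphisms, \<open>C2\<close> of the morphisms and 2-morphisms; \<open>HCmp\<close> is
  horizontal composition of 2-morphisms.
\<close>

record ('o, 'm, 't) two_cat =
  C1 :: "('o, 'm) cat"
  C2 :: "('m, 't) cat"
  HCmp :: "'t \<Rightarrow> 't \<Rightarrow> 't" (infixl "\<star>\<index>" 70)

locale two_category =
  fixes X (structure)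
  assumes C1_category: "category (C1 X)"
    and C2_category: "category (C2 X)"
    and Obj_C2: "Obj (C2 X) = Arr (C1 X)"
    and parallel_morphisms: "s \<in> hom (C2 X) f f'
      \<Longrightarrow> Dom (C1 X) f = Dom (C1 X) f' \<and> Cod (C1 X) f = Cod (C1 X) f'"
    and HCmp_hom: "\<lbrakk>s \<in> hom (C2 X) f f'; t \<in> hom (C2 X) g g'; Cod (C1 X) f = Dom (C1 X) g\<rbrakk>
      \<Longrightarrow> s \<star> t \<in> hom (C2 X) (f ;;\<^bsub>C1 X\<^esub> g) (f' ;;\<^bsub>C1 X\<^esub> g')"
    and HCmp_Idn: "\<lbrakk>f \<in> hom (C1 X) x y; g \<in> hom (C1 X) y z\<rbrakk>
      \<Longrightarrow> Idn (C2 X) f \<star> Idn (C2 X) g = Idn (C2 X) (f ;;\<^bsub>C1 X\<^esub> g)"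
    and HCmp_interchange: "\<lbrakk>s \<in> hom (C2 X) f f'; s' \<in> hom (C2 X) f' f'';
        t \<in> hom (C2 X) g g'; t' \<in> hom (C2 X) g' g''; Cod (C1 X) f = Dom (C1 X) g\<rbrakk>
      \<Longrightarrow> (s ;;\<^bsub>C2 X\<^esub> s') \<star> (t ;;\<^bsub>C2 X\<^esub> t') = (s \<star> t) ;;\<^bsub>C2 X\<^esub> (s' \<star> t')"
    and HCmp_assoc: "\<lbrakk>s \<in> hom (C2 X) f f'; t \<in> hom (C2 X) g g'; u \<in> hom (C2 X) h h';
        Cod (C1 X) f = Dom (C1 X) g; Cod (C1 X) g = Dom (C1 X) h\<rbrakk>
      \<Longrightarrow> (s \<star> t) \<star> u = s \<star> (t \<star> u)"
    and HCmp_unit_left: "\<lbrakk>f \<in> hom (C1 X) x y; s \<in> hom (C2 X) f f'\<rbrakk>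
      \<Longrightarrow> Idn (C2 X) (Idn (C1 X) x) \<star> s = s"
    and HCmp_unit_right: "\<lbrakk>f \<in> hom (C1 X) x y; s \<in> hom (C2 X) f f'\<rbrakk>
      \<Longrightarrow> s \<star> Idn (C2 X) (Idn (C1 X) y) = s"

definition CartLax where
  "CartLax D E =
     \<lparr>C1 = \<lparr>Obj = {F. cartesian_lax_functor D E F},
            Arr = {\<alpha>. cartesian_lax_transformation D E \<alpha>},
            Dom = tdom, Cod = tcod, Idn = trans_id D E, Cmp = trans_comp D E\<rparr>,
      C2 = \<lparr>Obj = {\<alpha>. cartesian_lax_transformation D E \<alpha>},
            Arr = {\<mu>. modulation D E \<mu> \<and> cartesian_lax_transformation D E (mdom \<mu>)
                      \<and> cartesian_lax_transformation D E (mcod \<mu>)},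
            Dom = mdom, Cod = mcod, Idn = mod_id D E, Cmp = mod_comp D E\<rparr>,
      HCmp = mod_hcomp D E\<rparr>"

end

theory Submission
  imports Defs
begin

text \<open>
  Fix a lax functor \<open>G\<close>. The unit cells \<open>a : id \<rightarrow> G id\<close> act on both sides of the cells \<open>b : M \<rightarrow> G n\<close>
  by \<open>a \<rhd> b = (a \<odot> b) \<cdot> G\<^bsub>x,n\<^esub>\<close> and \<open>b \<lhd> a = (b \<odot> a) \<cdot> G\<^bsub>n,y\<^esub>\<close>. By the coherence of \<open>G\<close> these
  are commuting unital associative actions, and they are respected by precomposition, by
  postcomposition with \<open>G \<gamma>\<close>, and by postcomposition with the components of a transformation out of
  \<open>G\<close>. The axioms become \<open>\<alpha>\<^sub>f \<rhd> (F \<gamma> \<cdot> \<alpha>\<^sub>n) = (\<alpha>\<^sub>m \<cdot> G \<gamma>) \<lhd> \<alpha>\<^sub>g\<close> for transformations and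
  \<open>\<mu>\<^sub>x \<rhd> \<beta>\<^sub>m = \<alpha>\<^sub>m \<lhd> \<mu>\<^sub>y\<close> for modulations, and every law of the 2-category follows by moving unit cells
  past each other. Naturality at the cells \<open>id\<^sub>f\<close> supplies the exchanges, and
  \<open>(\<mu> * \<nu>)\<^sub>m = \<mu>\<^sub>m \<cdot> \<nu>\<^sub>m\<close> reduces the horizontal laws to composition of cells.
\<close>

section \<open>Categories\<close>

text \<open>The difficulty is that \<open>D\<close> and \<open>E\<close> are weak while the
  resulting 2-category is strict: associativity and unit laws have to hold as equations. This is
  possible because every product with a unit cell is collapsed at once: an inverse unitor of
  \<open>E\<close> in front returns its domain to a single proarrow, and \<open>G\<close> applied to
  a unitor of \<open>D\<close> returns its codomain to \<open>G n\<close>. Reassociating a collapsed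
  product then produces one associator of \<open>E\<close> at the front and one of \<open>D\<close>
  at the back, and both are absorbed by the same coherence identity: the triangle when both unit
  cells act on one side, and the identity relating the left unitor of \<open>m \<odot> n\<close> to
  that of \<open>m\<close> when they act on different sides. The latter is not an axiom, nor is the
  agreement of the two unitors at an external identity, on which the unambiguous product of unit
  cells rests; both are therefore derived.\<close>

lemma (in category) arr_typing [simp]:
  "f \<in> Arr C \<Longrightarrow> Dom C f \<in> Obj C"
  "f \<in> Arr C \<Longrightarrow> Cod C f \<in> Obj C"
  "x \<in> Obj C \<Longrightarrow> Idn C x \<in> Arr C"
  "x \<in> Obj C \<Longrightarrow> Dom C (Idn C x) = x"
  "x \<in> Obj C \<Longrightarrow> Cod C (Idn C x) = x"
  "\<lbrakk>f \<in> Arr C; g \<in> Arr C; Cod C f = Dom C g\<rbrakk> \<Longrightarrow> f ;; g \<in> Arr C"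
  "\<lbrakk>f \<in> Arr C; g \<in> Arr C; Cod C f = Dom C g\<rbrakk> \<Longrightarrow> Dom C (f ;; g) = Dom C f"
  "\<lbrakk>f \<in> Arr C; g \<in> Arr C; Cod C f = Dom C g\<rbrakk> \<Longrightarrow> Cod C (f ;; g) = Cod C g"
  using Dom_Obj Cod_Obj Idn_hom[of x] Cmp_hom[of f "Dom C f" "Cod C f" g "Cod C g"]
  by (auto simp: hom_def)

text \<open>Associativity as a simplification rule nests all composites to the right. Rules about
  two adjacent factors later come with a variant followed by a further cell, such as
  \<open>ecmp_ccmp_ccmp\<close>, because the plain form does not match inside a nested
  composite.\<close>

lemma (in category) arr_algebra [simp]:
  "\<lbrakk>f \<in> Arr C; Dom C f = x\<rbrakk> \<Longrightarrow> Idn C x ;; f = f"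
  "\<lbrakk>f \<in> Arr C; Cod C f = x\<rbrakk> \<Longrightarrow> f ;; Idn C x = f"
  "\<lbrakk>f \<in> Arr C; g \<in> Arr C; h \<in> Arr C; Cod C f = Dom C g; Cod C g = Dom C h\<rbrakk>
    \<Longrightarrow> (f ;; g) ;; h = f ;; (g ;; h)"
  using Idn_left[of f x "Cod C f"] Idn_right[of f "Dom C f" x]
    Cmp_assoc[of f "Dom C f" "Cod C f" g "Cod C g" h "Cod C h"]
  by (auto simp: hom_def)

lemma (in category) inverse_arr_unique:
  assumes "inverse_arr C f g" "inverse_arr C f h"
  shows "g = h"
proof -
  have "(g ;; f) ;; h = g ;; (f ;; h)"
    using assms by (intro arr_algebra(3)) (auto simp: inverse_arr_def hom_def)
  then show ?thesis using assms by (simp add: inverse_arr_def hom_def)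
qed

text \<open>Inverses are unique, so the description operator in \<open>inv_arr\<close> really picks
  one.\<close>

lemma (in category) iso_inv_arr:
  assumes "iso C f"
  shows "inverse_arr C f (inv_arr C f)"
  using assms unfolding iso_def inv_arr_def by (metis inverse_arr_unique theI)

section \<open>Double categories and their unit coherence\<close>

sublocale double_category \<subseteq> C0: category "D0 D" + C1: category "D1 D"
  using Ext_functor by (auto simp: cat_functor_def)

context double_category
begin

section \<open>Boundaries of proarrows and cells\<close>

lemma src_tgt_typing [simp]:
  "m \<in> Obj (D1 D) \<Longrightarrow> psrc D m \<in> Obj (D0 D)"
  "m \<in> Obj (D1 D) \<Longrightarrow> ptgt D m \<in> Obj (D0 D)"
  "a \<in> Arr (D1 D) \<Longrightarrow> csrc D a \<in> Arr (D0 D)"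
  "a \<in> Arr (D1 D) \<Longrightarrow> ctgt D a \<in> Arr (D0 D)"
  "a \<in> Arr (D1 D) \<Longrightarrow> Dom (D0 D) (csrc D a) = psrc D (Dom (D1 D) a)"
  "a \<in> Arr (D1 D) \<Longrightarrow> Cod (D0 D) (csrc D a) = psrc D (Cod (D1 D) a)"
  "a \<in> Arr (D1 D) \<Longrightarrow> Dom (D0 D) (ctgt D a) = ptgt D (Dom (D1 D) a)"
  "a \<in> Arr (D1 D) \<Longrightarrow> Cod (D0 D) (ctgt D a) = ptgt D (Cod (D1 D) a)"
  using cat_functor.onO_Obj[OF Src_functor] cat_functor.onO_Obj[OF Tgt_functor]
    cat_functor.onA_hom[OF Src_functor, of a] cat_functor.onA_hom[OF Tgt_functor, of a]
  by (auto simp: hom_def)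

lemma src_tgt_functor [simp]:
  "m \<in> Obj (D1 D) \<Longrightarrow> csrc D (id1 D m) = Idn (D0 D) (psrc D m)"
  "m \<in> Obj (D1 D) \<Longrightarrow> ctgt D (id1 D m) = Idn (D0 D) (ptgt D m)"
  "\<lbrakk>a \<in> Arr (D1 D); b \<in> Arr (D1 D); Cod (D1 D) a = Dom (D1 D) b\<rbrakk>
    \<Longrightarrow> csrc D (a \<cdot> b) = csrc D a \<bullet> csrc D b"
  "\<lbrakk>a \<in> Arr (D1 D); b \<in> Arr (D1 D); Cod (D1 D) a = Dom (D1 D) b\<rbrakk>
    \<Longrightarrow> ctgt D (a \<cdot> b) = ctgt D a \<bullet> ctgt D b"
  using cat_functor.onA_Idn[OF Src_functor] cat_functor.onA_Idn[OF Tgt_functor]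
    cat_functor.onA_Cmp[OF Src_functor, of a _ _ b] cat_functor.onA_Cmp[OF Tgt_functor, of a _ _ b]
  by (auto simp: hom_def)

lemma ext_typing [simp]:
  "x \<in> Obj (D0 D) \<Longrightarrow> pid D x \<in> Obj (D1 D)"
  "x \<in> Obj (D0 D) \<Longrightarrow> psrc D (pid D x) = x"
  "x \<in> Obj (D0 D) \<Longrightarrow> ptgt D (pid D x) = x"
  "f \<in> Arr (D0 D) \<Longrightarrow> cid D f \<in> Arr (D1 D)"
  "f \<in> Arr (D0 D) \<Longrightarrow> Dom (D1 D) (cid D f) = pid D (Dom (D0 D) f)"
  "f \<in> Arr (D0 D) \<Longrightarrow> Cod (D1 D) (cid D f) = pid D (Cod (D0 D) f)"
  "f \<in> Arr (D0 D) \<Longrightarrow> csrc D (cid D f) = f"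
  "f \<in> Arr (D0 D) \<Longrightarrow> ctgt D (cid D f) = f"
  using pid_proarrow cid_cell[of f "Dom (D0 D) f" "Cod (D0 D) f"]
  by (auto simp: hom_def cells_def proarrow_def)

lemma cid_Idn [simp]: "x \<in> Obj (D0 D) \<Longrightarrow> cid D (Idn (D0 D) x) = id1 D (pid D x)"
  by (rule cat_functor.onA_Idn[OF Ext_functor])

lemma cid_Cmp:
  "\<lbrakk>f \<in> Arr (D0 D); g \<in> Arr (D0 D); Cod (D0 D) f = Dom (D0 D) g\<rbrakk>
    \<Longrightarrow> cid D (f \<bullet> g) = cid D f \<cdot> cid D g"
  using cat_functor.onA_Cmp[OF Ext_functor, of f _ _ g] by (auto simp: hom_def)

lemma pcmp_typing [simp]:
  assumes "m \<in> Obj (D1 D)" "n \<in> Obj (D1 D)" "ptgt D m = psrc D n"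
  shows "m \<odot> n \<in> Obj (D1 D)" "psrc D (m \<odot> n) = psrc D m" "ptgt D (m \<odot> n) = ptgt D n"
  using pcmp_proarrow[of m "psrc D m" "ptgt D m" n "ptgt D n"] assms
  by (auto simp: proarrow_def)

lemma ecmp_typing [simp]:
  assumes "a \<in> Arr (D1 D)" "b \<in> Arr (D1 D)" "ctgt D a = csrc D b"
  shows "a \<Odot> b \<in> Arr (D1 D)"
    "Dom (D1 D) (a \<Odot> b) = Dom (D1 D) a \<odot> Dom (D1 D) b"
    "Cod (D1 D) (a \<Odot> b) = Cod (D1 D) a \<odot> Cod (D1 D) b"
    "csrc D (a \<Odot> b) = csrc D a" "ctgt D (a \<Odot> b) = ctgt D b"
  using ecmp_cell[of a "Dom (D1 D) a" "Cod (D1 D) a" "csrc D a" "ctgt D a"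
      b "Dom (D1 D) b" "Cod (D1 D) b" "ctgt D b"] assms
  by (auto simp: cells_def hom_def)

text \<open>Taking domain and codomain of the common arrow gives the matching of the proarrows.
  Rewriting does not find this by itself, so the facts are supplied where proarrows are given only
  as boundaries of cells.\<close>

lemma ctgt_eq_csrc_boundary:
  assumes "a \<in> Arr (D1 D)" "b \<in> Arr (D1 D)" "ctgt D a = csrc D b"
  shows "ptgt D (Dom (D1 D) a) = psrc D (Dom (D1 D) b)"
    "ptgt D (Cod (D1 D) a) = psrc D (Cod (D1 D) b)"
  using assms src_tgt_typing(5,6,7,8) by metis+

lemma ecmp_id1 [simp]:
  "\<lbrakk>m \<in> Obj (D1 D); n \<in> Obj (D1 D); ptgt D m = psrc D n\<rbrakk>
    \<Longrightarrow> id1 D m \<Odot> id1 D n = id1 D (m \<odot> n)"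
  by (simp add: ecmp_Idn[of m "psrc D m" "ptgt D m" n "ptgt D n"] proarrow_def)

lemma ecmp_ccmp:
  assumes "a \<in> Arr (D1 D)" "a' \<in> Arr (D1 D)" "Cod (D1 D) a = Dom (D1 D) a'"
    "b \<in> Arr (D1 D)" "b' \<in> Arr (D1 D)" "Cod (D1 D) b = Dom (D1 D) b'"
    "ctgt D a = csrc D b" "ctgt D a' = csrc D b'"
  shows "(a \<Odot> b) \<cdot> (a' \<Odot> b') = (a \<cdot> a') \<Odot> (b \<cdot> b')"
  using assms by (intro interchange[symmetric]) (auto simp: cells_def hom_def)

section \<open>Coherence cells, their inverses and their cancellation\<close>

lemma AS_globular:
  assumes "m \<in> Obj (D1 D)" "n \<in> Obj (D1 D)" "p \<in> Obj (D1 D)"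
    "ptgt D m = psrc D n" "ptgt D n = psrc D p"
  shows "globular_iso D ((m \<odot> n) \<odot> p) (m \<odot> (n \<odot> p)) (AS D m n p)"
  using AS_iso[of m "psrc D m" "psrc D n" n "psrc D p" p "ptgt D p"] assms
  by (simp add: proarrow_def)

lemma globular_iso_typing:
  assumes "globular_iso D m n a"
  shows "a \<in> Arr (D1 D)" "Dom (D1 D) a = m" "Cod (D1 D) a = n"
    "csrc D a = Idn (D0 D) (psrc D m)" "ctgt D a = Idn (D0 D) (ptgt D m)"
    "inv_arr (D1 D) a \<in> Arr (D1 D)"
    "Dom (D1 D) (inv_arr (D1 D) a) = n" "Cod (D1 D) (inv_arr (D1 D) a) = m"
    "a \<cdot> inv_arr (D1 D) a = id1 D m" "inv_arr (D1 D) a \<cdot> a = id1 D n"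
  using assms C1.iso_inv_arr[of a]
  by (auto simp: globular_iso_def cells_def hom_def inverse_arr_def)

lemma globular_iso_boundary:
  assumes "globular_iso D m n a"
  shows "psrc D m = psrc D n" "ptgt D m = ptgt D n" "m \<in> Obj (D1 D)" "n \<in> Obj (D1 D)"
proof -
  note a = globular_iso_typing[OF assms]
  show mn: "m \<in> Obj (D1 D)" "n \<in> Obj (D1 D)"
    using a(1,2,3) C1.arr_typing by metis+
  show "psrc D m = psrc D n" using src_tgt_typing(6)[OF a(1)] mn by (simp add: a(1-5))
  show "ptgt D m = ptgt D n" using src_tgt_typing(8)[OF a(1)] mn by (simp add: a(1-5))
qed

text \<open>Postcomposing the inverse with the globular cell does not change its source and target
  arrows, and the composite is an identity cell.\<close>

lemma globular_iso_inv_boundary: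
  assumes "globular_iso D m n a"
  shows "csrc D (inv_arr (D1 D) a) = Idn (D0 D) (psrc D n)"
    "ctgt D (inv_arr (D1 D) a) = Idn (D0 D) (ptgt D n)"
proof -
  note a = globular_iso_typing[OF assms] globular_iso_boundary[OF assms]
  let ?b = "inv_arr (D1 D) a"
  have "csrc D ?b = csrc D (?b \<cdot> a)" by (simp add: a(1-8) a(11-14) del: a(9,10))
  then show "csrc D ?b = Idn (D0 D) (psrc D n)" by (simp add: a)
  have "ctgt D ?b = ctgt D (?b \<cdot> a)" by (simp add: a(1-8) a(11-14) del: a(9,10))
  then show "ctgt D ?b = Idn (D0 D) (ptgt D n)" by (simp add: a)
qed

lemma LU_globular: "m \<in> Obj (D1 D) \<Longrightarrow> globular_iso D (pid D (psrc D m) \<odot> m) m (LU D m)"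
  by (simp add: LU_iso proarrow_def)

lemma RU_globular: "m \<in> Obj (D1 D) \<Longrightarrow> globular_iso D (m \<odot> pid D (ptgt D m)) m (RU D m)"
  by (simp add: RU_iso proarrow_def)

lemma AS_typing [simp]:
  assumes "m \<in> Obj (D1 D)" "n \<in> Obj (D1 D)" "p \<in> Obj (D1 D)"
    "ptgt D m = psrc D n" "ptgt D n = psrc D p"
  shows "AS D m n p \<in> Arr (D1 D)"
    "Dom (D1 D) (AS D m n p) = (m \<odot> n) \<odot> p" "Cod (D1 D) (AS D m n p) = m \<odot> (n \<odot> p)"
    "csrc D (AS D m n p) = Idn (D0 D) (psrc D m)" "ctgt D (AS D m n p) = Idn (D0 D) (ptgt D p)"
  using globular_iso_typing(1-5)[OF AS_globular[OF assms]] assms by auto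

lemma LU_typing [simp]:
  assumes "m \<in> Obj (D1 D)"
  shows "LU D m \<in> Arr (D1 D)"
    "Dom (D1 D) (LU D m) = pid D (psrc D m) \<odot> m" "Cod (D1 D) (LU D m) = m"
    "csrc D (LU D m) = Idn (D0 D) (psrc D m)" "ctgt D (LU D m) = Idn (D0 D) (ptgt D m)"
    "LUi D m \<in> Arr (D1 D)"
    "Dom (D1 D) (LUi D m) = m" "Cod (D1 D) (LUi D m) = pid D (psrc D m) \<odot> m"
    "csrc D (LUi D m) = Idn (D0 D) (psrc D m)" "ctgt D (LUi D m) = Idn (D0 D) (ptgt D m)"
    "LU D m \<cdot> LUi D m = id1 D (pid D (psrc D m) \<odot> m)" "LUi D m \<cdot> LU D m = id1 D m"
  using globular_iso_typing[OF LU_globular[OF assms]]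
    globular_iso_inv_boundary[OF LU_globular[OF assms]] assms by auto

lemma RU_typing [simp]:
  assumes "m \<in> Obj (D1 D)"
  shows "RU D m \<in> Arr (D1 D)"
    "Dom (D1 D) (RU D m) = m \<odot> pid D (ptgt D m)" "Cod (D1 D) (RU D m) = m"
    "csrc D (RU D m) = Idn (D0 D) (psrc D m)" "ctgt D (RU D m) = Idn (D0 D) (ptgt D m)"
    "RUi D m \<in> Arr (D1 D)"
    "Dom (D1 D) (RUi D m) = m" "Cod (D1 D) (RUi D m) = m \<odot> pid D (ptgt D m)"
    "csrc D (RUi D m) = Idn (D0 D) (psrc D m)" "ctgt D (RUi D m) = Idn (D0 D) (ptgt D m)"
    "RU D m \<cdot> RUi D m = id1 D (m \<odot> pid D (ptgt D m))" "RUi D m \<cdot> RU D m = id1 D m"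
  using globular_iso_typing[OF RU_globular[OF assms]]
    globular_iso_inv_boundary[OF RU_globular[OF assms]] assms by auto

lemma LU_nat:
  "a \<in> Arr (D1 D) \<Longrightarrow> (cid D (csrc D a) \<Odot> a) \<cdot> LU D (Cod (D1 D) a) = LU D (Dom (D1 D) a) \<cdot> a"
  by (rule LU_natural) (auto simp: cells_def hom_def)

lemma RU_nat:
  "a \<in> Arr (D1 D) \<Longrightarrow> (a \<Odot> cid D (ctgt D a)) \<cdot> RU D (Cod (D1 D) a) = RU D (Dom (D1 D) a) \<cdot> a"
  by (rule RU_natural) (auto simp: cells_def hom_def)

lemma AS_nat:
  "\<lbrakk>a \<in> Arr (D1 D); b \<in> Arr (D1 D); c \<in> Arr (D1 D); ctgt D a = csrc D b; ctgt D b = csrc D c\<rbrakk>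
    \<Longrightarrow> ((a \<Odot> b) \<Odot> c) \<cdot> AS D (Cod (D1 D) a) (Cod (D1 D) b) (Cod (D1 D) c)
      = AS D (Dom (D1 D) a) (Dom (D1 D) b) (Dom (D1 D) c) \<cdot> (a \<Odot> (b \<Odot> c))"
  by (rule AS_natural) (auto simp: cells_def hom_def)

lemma AS_triangle:
  "\<lbrakk>m \<in> Obj (D1 D); n \<in> Obj (D1 D); ptgt D m = psrc D n\<rbrakk>
    \<Longrightarrow> AS D m (pid D (psrc D n)) n \<cdot> (id1 D m \<Odot> LU D n) = RU D m \<Odot> id1 D n"
  by (rule triangle) (auto simp: proarrow_def)

lemma AS_cancel:
  assumes "m \<in> Obj (D1 D)" "n \<in> Obj (D1 D)" "p \<in> Obj (D1 D)"
    "ptgt D m = psrc D n" "ptgt D n = psrc D p"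
    and "a \<in> Arr (D1 D)" "b \<in> Arr (D1 D)"
    "Dom (D1 D) a = m \<odot> (n \<odot> p)" "Dom (D1 D) b = m \<odot> (n \<odot> p)"
    and eq: "AS D m n p \<cdot> a = AS D m n p \<cdot> b"
  shows "a = b"
proof -
  note i = globular_iso_typing[OF AS_globular[OF assms(1-5)]]
  let ?j = "inv_arr (D1 D) (AS D m n p)"
  have "(?j \<cdot> AS D m n p) \<cdot> a = (?j \<cdot> AS D m n p) \<cdot> b"
    using assms(6-9) eq i(1-8) by simp
  then show ?thesis using assms by (simp only: i(10)) simp
qed

lemma ecmp_ccmp_ccmp:
  assumes "a \<in> Arr (D1 D)" "a' \<in> Arr (D1 D)" "Cod (D1 D) a = Dom (D1 D) a'"
    "b \<in> Arr (D1 D)" "b' \<in> Arr (D1 D)" "Cod (D1 D) b = Dom (D1 D) b'"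
    "ctgt D a = csrc D b" "ctgt D a' = csrc D b'"
    "c \<in> Arr (D1 D)" "Dom (D1 D) c = Cod (D1 D) a' \<odot> Cod (D1 D) b'"
  shows "(a \<Odot> b) \<cdot> ((a' \<Odot> b') \<cdot> c) = ((a \<cdot> a') \<Odot> (b \<cdot> b')) \<cdot> c"
proof -
  have "(a \<Odot> b) \<cdot> ((a' \<Odot> b') \<cdot> c) = ((a \<Odot> b) \<cdot> (a' \<Odot> b')) \<cdot> c"
    using assms by (intro C1.arr_algebra(3)[symmetric]) auto
  then show ?thesis by (simp only: ecmp_ccmp[OF assms(1-8)])
qed

text \<open>Composing externally with an identity is naturally isomorphic, through
  \<open>LU\<close>, to doing nothing, and hence is faithful.\<close>

lemma LU_cancel:
  assumes "a \<in> Arr (D1 D)" "b \<in> Arr (D1 D)" "Dom (D1 D) a = Dom (D1 D) b" "Cod (D1 D) a = Cod (D1 D) b"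
    and eq: "cid D (csrc D a) \<Odot> a = cid D (csrc D b) \<Odot> b"
  shows "a = b"
proof -
  have "LU D (Dom (D1 D) a) \<cdot> a = LU D (Dom (D1 D) a) \<cdot> b"
    using LU_nat[of a] LU_nat[of b] assms by simp
  then have "(LUi D (Dom (D1 D) a) \<cdot> LU D (Dom (D1 D) a)) \<cdot> a
      = (LUi D (Dom (D1 D) a) \<cdot> LU D (Dom (D1 D) a)) \<cdot> b"
    using assms(1-4) by (simp del: LU_typing(11,12))
  then show ?thesis using assms by simp
qed

lemma RU_cancel:
  assumes "a \<in> Arr (D1 D)" "b \<in> Arr (D1 D)" "Dom (D1 D) a = Dom (D1 D) b" "Cod (D1 D) a = Cod (D1 D) b"
    and eq: "a \<Odot> cid D (ctgt D a) = b \<Odot> cid D (ctgt D b)"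
  shows "a = b"
proof -
  have "RU D (Dom (D1 D) a) \<cdot> a = RU D (Dom (D1 D) a) \<cdot> b"
    using RU_nat[of a] RU_nat[of b] assms by simp
  then have "(RUi D (Dom (D1 D) a) \<cdot> RU D (Dom (D1 D) a)) \<cdot> a
      = (RUi D (Dom (D1 D) a) \<cdot> RU D (Dom (D1 D) a)) \<cdot> b"
    using assms(1-4) by (simp del: RU_typing(11,12))
  then show ?thesis using assms by simp
qed

text \<open>
  Kelly's argument: the pentagon at \<open>id, id, m, n\<close> gives the claim after applying \<open>id \<odot> -\<close>, which is
  faithful.
\<close>

lemma AS_LU:
  assumes m: "m \<in> Obj (D1 D)" and n: "n \<in> Obj (D1 D)" and mn: "ptgt D m = psrc D n"
  shows "AS D (pid D (psrc D m)) m n \<cdot> LU D (m \<odot> n) = LU D m \<Odot> id1 D n"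
proof -
  let ?i = "pid D (psrc D m)" and ?k = "id1 D (pid D (psrc D m))"
  let ?a = "AS D ?i m n \<cdot> LU D (m \<odot> n)" and ?b = "LU D m \<Odot> id1 D n"
  note [simp] = m n mn
  have pent: "((AS D ?i ?i m \<Odot> id1 D n) \<cdot> AS D ?i (?i \<odot> m) n) \<cdot> (?k \<Odot> AS D ?i m n)
      = AS D (?i \<odot> ?i) m n \<cdot> AS D ?i ?i (m \<odot> n)"
    by (rule pentagon[where v = "psrc D m" and w = "psrc D m" and x = "psrc D m"
          and y = "psrc D n" and z = "ptgt D n"]) (simp_all add: proarrow_def)
  have tri: "AS D ?i ?i (m \<odot> n) \<cdot> (?k \<Odot> LU D (m \<odot> n)) = RU D ?i \<Odot> (id1 D m \<Odot> id1 D n)"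
    using AS_triangle[of ?i "m \<odot> n"] by simp
  have nat1: "((RU D ?i \<Odot> id1 D m) \<Odot> id1 D n) \<cdot> AS D ?i m n
      = AS D (?i \<odot> ?i) m n \<cdot> (RU D ?i \<Odot> (id1 D m \<Odot> id1 D n))"
    using AS_nat[of "RU D ?i" "id1 D m" "id1 D n"] by simp
  have tri2: "RU D ?i \<Odot> id1 D m = AS D ?i ?i m \<cdot> (?k \<Odot> LU D m)"
    using AS_triangle[of ?i m] by simp
  have nat2: "((?k \<Odot> LU D m) \<Odot> id1 D n) \<cdot> AS D ?i m n
      = AS D ?i (?i \<odot> m) n \<cdot> (?k \<Odot> ?b)"
    using AS_nat[of ?k "LU D m" "id1 D n"] by simp
  have whisk: "?k \<Odot> ?a = (?k \<Odot> AS D ?i m n) \<cdot> (?k \<Odot> LU D (m \<odot> n))"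
    by (subst ecmp_ccmp) simp_all
  \<comment> \<open>Both \<open>?k \<Odot> ?a\<close> and \<open>?k \<Odot> ?b\<close> are computed
    behind the same two associators. The two triangles trade left unitors for \<open>RU ?i\<close>,
    and naturality of the associator carries that cell from one bracketing to the other.\<close>
  have "((AS D ?i ?i m \<Odot> id1 D n) \<cdot> AS D ?i (?i \<odot> m) n) \<cdot> (?k \<Odot> ?a)
      = (((AS D ?i ?i m \<Odot> id1 D n) \<cdot> AS D ?i (?i \<odot> m) n) \<cdot> (?k \<Odot> AS D ?i m n))
          \<cdot> (?k \<Odot> LU D (m \<odot> n))"
    unfolding whisk by simp
  also have "\<dots> = AS D (?i \<odot> ?i) m n \<cdot> (RU D ?i \<Odot> (id1 D m \<Odot> id1 D n))"
    unfolding pent tri[symmetric] by (simp del: ecmp_id1)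
  also have "\<dots> = ((AS D ?i ?i m \<Odot> id1 D n) \<cdot> ((?k \<Odot> LU D m) \<Odot> id1 D n)) \<cdot> AS D ?i m n"
    unfolding nat1[symmetric] tri2 by (subst ecmp_ccmp) simp_all
  also have "\<dots> = (AS D ?i ?i m \<Odot> id1 D n) \<cdot> (AS D ?i (?i \<odot> m) n \<cdot> (?k \<Odot> ?b))"
    unfolding nat2[symmetric] by simp
  finally have eq: "(AS D ?i ?i m \<Odot> id1 D n) \<cdot> (AS D ?i (?i \<odot> m) n \<cdot> (?k \<Odot> ?a))
      = (AS D ?i ?i m \<Odot> id1 D n) \<cdot> (AS D ?i (?i \<odot> m) n \<cdot> (?k \<Odot> ?b))"
    by simp
  \<comment> \<open>The common prefix is removed in two stages: the whiskered associator by
    whiskering its inverse, the remaining one by \<open>AS_cancel\<close>.\<close>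
  let ?j = "inv_arr (D1 D) (AS D ?i ?i m)"
  have gi: "globular_iso D ((?i \<odot> ?i) \<odot> m) (?i \<odot> (?i \<odot> m)) (AS D ?i ?i m)"
    by (rule AS_globular) simp_all
  note j [simp] = globular_iso_typing(6-10)[OF gi] globular_iso_inv_boundary[OF gi]
  have cancel: "(?j \<Odot> id1 D n) \<cdot> ((AS D ?i ?i m \<Odot> id1 D n) \<cdot> c) = c"
    if "c \<in> Arr (D1 D)" "Dom (D1 D) c = (?i \<odot> (?i \<odot> m)) \<odot> n" for c
    using that by (subst ecmp_ccmp_ccmp) simp_all
  have "AS D ?i (?i \<odot> m) n \<cdot> (?k \<Odot> ?a) = AS D ?i (?i \<odot> m) n \<cdot> (?k \<Odot> ?b)"
    using arg_cong[OF eq, of "\<lambda>c. (?j \<Odot> id1 D n) \<cdot> c"] by (simp add: cancel)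
  then have "?k \<Odot> ?a = ?k \<Odot> ?b" by (rule AS_cancel[rotated -1]) simp_all
  then show ?thesis using LU_cancel[of ?a ?b] by simp
qed

text \<open>Naturality of \<open>LU\<close> at the cell \<open>LU ?i\<close> itself, with the
  invertible \<open>LU ?i\<close> cancelled, gives
  \<open>id \<Odot> LU ?i = LU (?i \<odot> ?i)\<close>. Behind the associator the right side becomes
  \<open>LU ?i \<Odot> id\<close> by \<open>AS_LU\<close> and the left side
  \<open>RU ?i \<Odot> id\<close> by the triangle.\<close>

lemma LU_pid_eq_RU_pid:
  assumes x: "x \<in> Obj (D0 D)"
  shows "LU D (pid D x) = RU D (pid D x)"
proof -
  let ?i = "pid D x"
  note [simp] = x
  have "(id1 D ?i \<Odot> LU D ?i) \<cdot> LU D ?i = LU D (?i \<odot> ?i) \<cdot> LU D ?i"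
    using LU_nat[of "LU D ?i"] by simp
  then have "((id1 D ?i \<Odot> LU D ?i) \<cdot> LU D ?i) \<cdot> LUi D ?i = (LU D (?i \<odot> ?i) \<cdot> LU D ?i) \<cdot> LUi D ?i"
    by simp
  then have "id1 D ?i \<Odot> LU D ?i = LU D (?i \<odot> ?i)" by simp
  then have "LU D ?i \<Odot> id1 D ?i = RU D ?i \<Odot> id1 D ?i"
    using AS_LU[of ?i ?i] AS_triangle[of ?i ?i] by simp
  then show ?thesis using RU_cancel[of "LU D ?i" "RU D ?i"] by simp
qed

text \<open>Turns a coherence identity for unitors into one for their inverses. In use,
  \<open>p\<close> and \<open>q\<close> remove the units from two bracketings of a triple product
  and \<open>s\<close> is the associator between them. A left inverse of \<open>p\<close> and a
  right inverse of \<open>q\<close> suffice.\<close>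

lemma inverse_shift:
  assumes "p \<in> Arr (D1 D)" "q \<in> Arr (D1 D)" "s \<in> Arr (D1 D)" "p' \<in> Arr (D1 D)" "q' \<in> Arr (D1 D)"
    "Cod (D1 D) s = Dom (D1 D) q" "Cod (D1 D) p' = Dom (D1 D) p" "Cod (D1 D) q = Dom (D1 D) q'"
    and p: "p = s \<cdot> q" and p': "p' \<cdot> p = id1 D m" and q': "q \<cdot> q' = id1 D (Cod (D1 D) s)"
    and m: "Dom (D1 D) q' = m"
  shows "p' \<cdot> s = q'"
proof -
  have s: "Dom (D1 D) p = Dom (D1 D) s" using assms(1-8) by (simp add: p)
  have "p' \<cdot> s = p' \<cdot> (s \<cdot> (q \<cdot> q'))" using assms(1-8) s by (simp add: q')
  also have "\<dots> = (p' \<cdot> (s \<cdot> q)) \<cdot> q'" using assms(1-8) s by simp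
  also have "\<dots> = q'" using assms(5) by (simp only: p[symmetric] p') (simp add: m)
  finally show ?thesis .
qed

lemma LUi_nat:
  assumes [simp]: "a \<in> Arr (D1 D)"
  shows "a \<cdot> LUi D (Cod (D1 D) a) = LUi D (Dom (D1 D) a) \<cdot> (cid D (csrc D a) \<Odot> a)"
proof -
  have "LUi D (Dom (D1 D) a) \<cdot> (cid D (csrc D a) \<Odot> a)
      = LUi D (Dom (D1 D) a) \<cdot> (((cid D (csrc D a) \<Odot> a) \<cdot> LU D (Cod (D1 D) a)) \<cdot> LUi D (Cod (D1 D) a))"
    by simp
  also have "\<dots> = (LUi D (Dom (D1 D) a) \<cdot> LU D (Dom (D1 D) a)) \<cdot> (a \<cdot> LUi D (Cod (D1 D) a))"
    unfolding LU_nat[OF assms] by (simp del: LU_typing(11,12))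
  finally show ?thesis by simp
qed

lemma RUi_nat:
  assumes [simp]: "a \<in> Arr (D1 D)"
  shows "a \<cdot> RUi D (Cod (D1 D) a) = RUi D (Dom (D1 D) a) \<cdot> (a \<Odot> cid D (ctgt D a))"
proof -
  have "RUi D (Dom (D1 D) a) \<cdot> (a \<Odot> cid D (ctgt D a))
      = RUi D (Dom (D1 D) a) \<cdot> (((a \<Odot> cid D (ctgt D a)) \<cdot> RU D (Cod (D1 D) a)) \<cdot> RUi D (Cod (D1 D) a))"
    by simp
  also have "\<dots> = (RUi D (Dom (D1 D) a) \<cdot> RU D (Dom (D1 D) a)) \<cdot> (a \<cdot> RUi D (Cod (D1 D) a))"
    unfolding RU_nat[OF assms] by (simp del: RU_typing(11,12))
  finally show ?thesis by simp
qed

lemma cid_ccmp [simp]: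
  "\<lbrakk>f \<in> Arr (D0 D); g \<in> Arr (D0 D); Cod (D0 D) f = Dom (D0 D) g\<rbrakk>
    \<Longrightarrow> cid D f \<cdot> cid D g = cid D (f \<bullet> g)"
  by (simp add: cid_Cmp)

lemma cid_ccmp_ccmp [simp]:
  assumes "f \<in> Arr (D0 D)" "g \<in> Arr (D0 D)" "Cod (D0 D) f = Dom (D0 D) g"
    "a \<in> Arr (D1 D)" "Dom (D1 D) a = pid D (Cod (D0 D) g)"
  shows "cid D f \<cdot> (cid D g \<cdot> a) = cid D (f \<bullet> g) \<cdot> a"
  using C1.arr_algebra(3)[of "cid D f" "cid D g" a] assms by simp

end

section \<open>Unit cells acting on cells into a lax functor\<close>

text \<open>The record extensions are left open so that the results apply directly to records that
  also carry chosen products.\<close>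

locale double_category_pair = D: double_category D + E: double_category E
  for D :: "('o, 'a, 'p, 'c, 'y) dbl_cat_scheme"
    and E :: "('o2, 'a2, 'p2, 'c2, 'z) dbl_cat_scheme" (structure)
begin

section \<open>Boundaries of the data of a lax functor\<close>

lemma F0_typing [simp]:
  assumes "lax_double_functor D E G"
  shows "x \<in> Obj (D0 D) \<Longrightarrow> Fo G x \<in> Obj (D0 E)"
    "f \<in> Arr (D0 D) \<Longrightarrow> Fa G f \<in> Arr (D0 E)"
    "f \<in> Arr (D0 D) \<Longrightarrow> Dom (D0 E) (Fa G f) = Fo G (Dom (D0 D) f)"
    "f \<in> Arr (D0 D) \<Longrightarrow> Cod (D0 E) (Fa G f) = Fo G (Cod (D0 D) f)"
    "x \<in> Obj (D0 D) \<Longrightarrow> Fa G (Idn (D0 D) x) = Idn (D0 E) (Fo G x)"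
    "\<lbrakk>f \<in> Arr (D0 D); g \<in> Arr (D0 D); Cod (D0 D) f = Dom (D0 D) g\<rbrakk>
      \<Longrightarrow> Fa G (f \<bullet>\<^bsub>D\<^esub> g) = Fa G f \<bullet> Fa G g"
proof -
  interpret cat_functor "D0 D" "D0 E" "F0 G" by (rule lax_double_functor.F0_functor[OF assms])
  show "x \<in> Obj (D0 D) \<Longrightarrow> Fo G x \<in> Obj (D0 E)"
    "f \<in> Arr (D0 D) \<Longrightarrow> Fa G f \<in> Arr (D0 E)"
    "f \<in> Arr (D0 D) \<Longrightarrow> Dom (D0 E) (Fa G f) = Fo G (Dom (D0 D) f)"
    "f \<in> Arr (D0 D) \<Longrightarrow> Cod (D0 E) (Fa G f) = Fo G (Cod (D0 D) f)"
    "x \<in> Obj (D0 D) \<Longrightarrow> Fa G (Idn (D0 D) x) = Idn (D0 E) (Fo G x)"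
    "\<lbrakk>f \<in> Arr (D0 D); g \<in> Arr (D0 D); Cod (D0 D) f = Dom (D0 D) g\<rbrakk>
      \<Longrightarrow> Fa G (f \<bullet>\<^bsub>D\<^esub> g) = Fa G f \<bullet> Fa G g"
    using onO_Obj onA_hom[of f "Dom (D0 D) f" "Cod (D0 D) f"] onA_Idn
      onA_Cmp[of f "Dom (D0 D) f" "Cod (D0 D) f" g "Cod (D0 D) g"]
    by (auto simp: hom_def)
qed

lemma F1_typing [simp]:
  assumes "lax_double_functor D E G"
  shows "m \<in> Obj (D1 D) \<Longrightarrow> Fp G m \<in> Obj (D1 E)"
    "m \<in> Obj (D1 D) \<Longrightarrow> psrc E (Fp G m) = Fo G (psrc D m)"
    "m \<in> Obj (D1 D) \<Longrightarrow> ptgt E (Fp G m) = Fo G (ptgt D m)"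
    "a \<in> Arr (D1 D) \<Longrightarrow> Fc G a \<in> Arr (D1 E)"
    "a \<in> Arr (D1 D) \<Longrightarrow> Dom (D1 E) (Fc G a) = Fp G (Dom (D1 D) a)"
    "a \<in> Arr (D1 D) \<Longrightarrow> Cod (D1 E) (Fc G a) = Fp G (Cod (D1 D) a)"
    "a \<in> Arr (D1 D) \<Longrightarrow> csrc E (Fc G a) = Fa G (csrc D a)"
    "a \<in> Arr (D1 D) \<Longrightarrow> ctgt E (Fc G a) = Fa G (ctgt D a)"
    "m \<in> Obj (D1 D) \<Longrightarrow> Fc G (id1 D m) = id1 E (Fp G m)"
  using lax_double_functor.Fp_proarrow[OF assms, of m "psrc D m" "ptgt D m"]
    lax_double_functor.Fc_cell[OF assms, of a "Dom (D1 D) a" "Cod (D1 D) a" "csrc D a" "ctgt D a"]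
    cat_functor.onA_Idn[OF lax_double_functor.F1_functor[OF assms], of m]
  by (auto simp: hom_def cells_def proarrow_def)

lemma Fc_Cmp:
  "\<lbrakk>lax_double_functor D E G; a \<in> Arr (D1 D); b \<in> Arr (D1 D); Cod (D1 D) a = Dom (D1 D) b\<rbrakk>
    \<Longrightarrow> Fc G (a \<cdot>\<^bsub>D\<^esub> b) = Fc G a \<cdot> Fc G b"
  using cat_functor.onA_Cmp[OF lax_double_functor.F1_functor, of D E G a _ _ b]
  by (auto simp: hom_def)

lemma laxator_typing [simp]:
  assumes "lax_double_functor D E G" "m \<in> Obj (D1 D)" "n \<in> Obj (D1 D)" "ptgt D m = psrc D n"
  shows "laxator G m n \<in> Arr (D1 E)"
    "Dom (D1 E) (laxator G m n) = Fp G m \<odot> Fp G n"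
    "Cod (D1 E) (laxator G m n) = Fp G (m \<odot>\<^bsub>D\<^esub> n)"
    "csrc E (laxator G m n) = Idn (D0 E) (Fo G (psrc D m))"
    "ctgt E (laxator G m n) = Idn (D0 E) (Fo G (ptgt D n))"
  using lax_double_functor.laxator_cell[OF assms(1), of m "psrc D m" "ptgt D m" n "ptgt D n"] assms
  by (auto simp: hom_def cells_def proarrow_def)

lemma unitor_typing [simp]:
  assumes "lax_double_functor D E G" "x \<in> Obj (D0 D)"
  shows "unitor G x \<in> Arr (D1 E)"
    "Dom (D1 E) (unitor G x) = pid E (Fo G x)"
    "Cod (D1 E) (unitor G x) = Fp G (pid D x)"
    "csrc E (unitor G x) = Idn (D0 E) (Fo G x)"
    "ctgt E (unitor G x) = Idn (D0 E) (Fo G x)"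
  using lax_double_functor.unitor_cell[OF assms] by (auto simp: hom_def cells_def)

lemma lax_left_typing [simp]:
  assumes "lax_double_functor D E G" "n \<in> Obj (D1 D)"
  shows "lax_left D E G n \<in> Arr (D1 E)"
    "Dom (D1 E) (lax_left D E G n) = Fp G (pid D (psrc D n)) \<odot> Fp G n"
    "Cod (D1 E) (lax_left D E G n) = Fp G n"
    "csrc E (lax_left D E G n) = Idn (D0 E) (Fo G (psrc D n))"
    "ctgt E (lax_left D E G n) = Idn (D0 E) (Fo G (ptgt D n))"
  using assms by (simp_all add: lax_left_def)

lemma lax_right_typing [simp]:
  assumes "lax_double_functor D E G" "n \<in> Obj (D1 D)"
  shows "lax_right D E G n \<in> Arr (D1 E)"
    "Dom (D1 E) (lax_right D E G n) = Fp G n \<odot> Fp G (pid D (ptgt D n))"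
    "Cod (D1 E) (lax_right D E G n) = Fp G n"
    "csrc E (lax_right D E G n) = Idn (D0 E) (Fo G (psrc D n))"
    "ctgt E (lax_right D E G n) = Idn (D0 E) (Fo G (ptgt D n))"
  using assms by (simp_all add: lax_right_def)

end

text \<open>
  A cell \<open>a : id \<rightarrow> G id\<close> acts from the left and from the right on the cells \<open>b : M \<rightarrow> G n\<close>. The
  coherence isomorphisms of \<open>D\<close> and \<open>E\<close> occur only in these two operations. For two cells of the form
  \<open>id \<rightarrow> G id\<^sub>x\<close> both are the same product, because the two unitors agree at an identity proarrow.
\<close>

definition lact where
  "lact D E G n a b = LUi E (Dom (D1 E) b) \<cdot>\<^bsub>E\<^esub> ((a \<Odot>\<^bsub>E\<^esub> b) \<cdot>\<^bsub>E\<^esub> lax_left D E G n)"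

definition ract where
  "ract D E G n b a = RUi E (Dom (D1 E) b) \<cdot>\<^bsub>E\<^esub> ((b \<Odot>\<^bsub>E\<^esub> a) \<cdot>\<^bsub>E\<^esub> lax_right D E G n)"

text \<open>The product before collapsing: it ends at \<open>G (m \<odot> n)\<close> and no unitor
  has been applied. Naturality and associativity of the laxator are stated for it; the actions arise
  by adding a unitor on each end.\<close>

definition lprod where
  "lprod E G m n a b = (a \<Odot>\<^bsub>E\<^esub> b) \<cdot>\<^bsub>E\<^esub> laxator G m n"

context double_category_pair
begin

section \<open>Products of cells through the laxator\<close>

lemma laxator_nat:
  "\<lbrakk>lax_double_functor D E G; a \<in> Arr (D1 D); b \<in> Arr (D1 D); ctgt D a = csrc D b\<rbrakk>
    \<Longrightarrow> (Fc G a \<Odot> Fc G b) \<cdot> laxator G (Cod (D1 D) a) (Cod (D1 D) b)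
      = laxator G (Dom (D1 D) a) (Dom (D1 D) b) \<cdot> Fc G (a \<Odot>\<^bsub>D\<^esub> b)"
  by (rule lax_double_functor.laxator_natural) (auto simp: cells_def hom_def)

lemma lprod_typing [simp]:
  assumes "lax_double_functor D E G" "m \<in> Obj (D1 D)" "n \<in> Obj (D1 D)" "ptgt D m = psrc D n"
    "a \<in> Arr (D1 E)" "b \<in> Arr (D1 E)" "Cod (D1 E) a = Fp G m" "Cod (D1 E) b = Fp G n"
    "ctgt E a = csrc E b"
  shows "lprod E G m n a b \<in> Arr (D1 E)"
    "Dom (D1 E) (lprod E G m n a b) = Dom (D1 E) a \<odot> Dom (D1 E) b"
    "Cod (D1 E) (lprod E G m n a b) = Fp G (m \<odot>\<^bsub>D\<^esub> n)"
    "csrc E (lprod E G m n a b) = csrc E a" "ctgt E (lprod E G m n a b) = ctgt E b"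
  using assms by (simp_all add: lprod_def)

lemma lprod_post:
  assumes G: "lax_double_functor D E G"
    and g: "g \<in> Arr (D1 D)" "h \<in> Arr (D1 D)" "ctgt D g = csrc D h"
    and ab: "a \<in> Arr (D1 E)" "b \<in> Arr (D1 E)" "ctgt E a = csrc E b"
    "Cod (D1 E) a = Fp G (Dom (D1 D) g)" "Cod (D1 E) b = Fp G (Dom (D1 D) h)"
  shows "lprod E G (Dom (D1 D) g) (Dom (D1 D) h) a b \<cdot> Fc G (g \<Odot>\<^bsub>D\<^esub> h)
    = lprod E G (Cod (D1 D) g) (Cod (D1 D) h) (a \<cdot> Fc G g) (b \<cdot> Fc G h)"
proof -
  note [simp] = G g ab D.ctgt_eq_csrc_boundary[OF g]
  have "lprod E G (Dom (D1 D) g) (Dom (D1 D) h) a b \<cdot> Fc G (g \<Odot>\<^bsub>D\<^esub> h)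
      = (a \<Odot> b) \<cdot> (laxator G (Dom (D1 D) g) (Dom (D1 D) h) \<cdot> Fc G (g \<Odot>\<^bsub>D\<^esub> h))"
    by (simp add: lprod_def)
  also have "\<dots> = (a \<Odot> b) \<cdot> ((Fc G g \<Odot> Fc G h) \<cdot> laxator G (Cod (D1 D) g) (Cod (D1 D) h))"
    by (simp add: laxator_nat)
  also have "\<dots> = lprod E G (Cod (D1 D) g) (Cod (D1 D) h) (a \<cdot> Fc G g) (b \<cdot> Fc G h)"
    by (simp add: lprod_def E.ecmp_ccmp_ccmp)
  finally show ?thesis .
qed

lemma lprod_pre:
  assumes "lax_double_functor D E G" "m \<in> Obj (D1 D)" "n \<in> Obj (D1 D)" "ptgt D m = psrc D n"
    "a \<in> Arr (D1 E)" "b \<in> Arr (D1 E)" "Cod (D1 E) a = Fp G m" "Cod (D1 E) b = Fp G n"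
    "ctgt E a = csrc E b"
    "g \<in> Arr (D1 E)" "h \<in> Arr (D1 E)" "ctgt E g = csrc E h"
    "Cod (D1 E) g = Dom (D1 E) a" "Cod (D1 E) h = Dom (D1 E) b"
  shows "lprod E G m n (g \<cdot> a) (h \<cdot> b) = (g \<Odot> h) \<cdot> lprod E G m n a b"
  using assms by (simp add: lprod_def E.ecmp_ccmp_ccmp)

text \<open>The associativity axiom of \<open>G\<close>, combined with naturality of the associator
  of \<open>E\<close>. The associator of \<open>D\<close> thus appears under \<open>G\<close> behind
  one side and that of \<open>E\<close> in front of the other.\<close>

lemma lprod_assoc:
  assumes G: "lax_double_functor D E G"
    and mnp: "m \<in> Obj (D1 D)" "n \<in> Obj (D1 D)" "p \<in> Obj (D1 D)"
    "ptgt D m = psrc D n" "ptgt D n = psrc D p"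
    and abc: "a \<in> Arr (D1 E)" "b \<in> Arr (D1 E)" "c \<in> Arr (D1 E)"
    "ctgt E a = csrc E b" "ctgt E b = csrc E c"
    "Cod (D1 E) a = Fp G m" "Cod (D1 E) b = Fp G n" "Cod (D1 E) c = Fp G p"
  shows "lprod E G (m \<odot>\<^bsub>D\<^esub> n) p (lprod E G m n a b) c \<cdot> Fc G (AS D m n p)
    = AS E (Dom (D1 E) a) (Dom (D1 E) b) (Dom (D1 E) c)
        \<cdot> lprod E G m (n \<odot>\<^bsub>D\<^esub> p) a (lprod E G n p b c)"
proof -
  note [simp] = G mnp abc
  note [simp] = E.ctgt_eq_csrc_boundary(1)[OF abc(1,2,4)] E.ctgt_eq_csrc_boundary(1)[OF abc(2,3,5)]
  let ?k = "id1 E (Fp G p)" and ?k' = "id1 E (Fp G m)"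
  \<comment> \<open>\<open>c\<close> is padded with an identity so that interchange can separate the
    three cells from the laxators.\<close>
  have "lprod E G (m \<odot>\<^bsub>D\<^esub> n) p (lprod E G m n a b) c
      = (((a \<Odot> b) \<cdot> laxator G m n) \<Odot> (c \<cdot> ?k)) \<cdot> laxator G (m \<odot>\<^bsub>D\<^esub> n) p"
    by (simp add: lprod_def)
  also have "\<dots> = ((a \<Odot> b) \<Odot> c) \<cdot> ((laxator G m n \<Odot> ?k) \<cdot> laxator G (m \<odot>\<^bsub>D\<^esub> n) p)"
    by (subst E.ecmp_ccmp_ccmp) simp_all
  finally have "lprod E G (m \<odot>\<^bsub>D\<^esub> n) p (lprod E G m n a b) c \<cdot> Fc G (AS D m n p)
      = ((a \<Odot> b) \<Odot> c) \<cdot> (((laxator G m n \<Odot> ?k) \<cdot> laxator G (m \<odot>\<^bsub>D\<^esub> n) p) \<cdot> Fc G (AS D m n p))"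
    by simp
  also have "\<dots> = ((a \<Odot> b) \<Odot> c)
      \<cdot> ((AS E (Fp G m) (Fp G n) (Fp G p) \<cdot> (?k' \<Odot> laxator G n p)) \<cdot> laxator G m (n \<odot>\<^bsub>D\<^esub> p))"
    by (subst lax_double_functor.laxator_assoc[OF G, of m "psrc D m" "psrc D n" n "psrc D p" p "ptgt D p"])
      (simp_all add: proarrow_def)
  also have "\<dots> = (((a \<Odot> b) \<Odot> c) \<cdot> AS E (Fp G m) (Fp G n) (Fp G p))
      \<cdot> ((?k' \<Odot> laxator G n p) \<cdot> laxator G m (n \<odot>\<^bsub>D\<^esub> p))"
    by simp
  also have "\<dots> = (AS E (Dom (D1 E) a) (Dom (D1 E) b) (Dom (D1 E) c) \<cdot> (a \<Odot> (b \<Odot> c)))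
      \<cdot> ((?k' \<Odot> laxator G n p) \<cdot> laxator G m (n \<odot>\<^bsub>D\<^esub> p))"
    using E.AS_nat[of a b c] by simp
  also have "\<dots> = AS E (Dom (D1 E) a) (Dom (D1 E) b) (Dom (D1 E) c)
      \<cdot> ((a \<Odot> (b \<Odot> c)) \<cdot> ((?k' \<Odot> laxator G n p) \<cdot> laxator G m (n \<odot>\<^bsub>D\<^esub> p)))"
    by simp
  also have "\<dots> = AS E (Dom (D1 E) a) (Dom (D1 E) b) (Dom (D1 E) c)
      \<cdot> lprod E G m (n \<odot>\<^bsub>D\<^esub> p) a (lprod E G n p b c)"
    by (subst E.ecmp_ccmp_ccmp) (simp_all add: lprod_def)
  finally show ?thesis .
qed

section \<open>The two actions and their associativity\<close>

lemma lact_lprod: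
  assumes "lax_double_functor D E G" "n \<in> Obj (D1 D)"
    "a \<in> Arr (D1 E)" "b \<in> Arr (D1 E)" "ctgt E a = csrc E b"
    "Cod (D1 E) a = Fp G (pid D (psrc D n))" "Cod (D1 E) b = Fp G n"
    "Dom (D1 E) a = pid E (psrc E (Dom (D1 E) b))"
  shows "lact D E G n a b
    = LUi E (Dom (D1 E) b) \<cdot> (lprod E G (pid D (psrc D n)) n a b \<cdot> Fc G (LU D n))"
  using assms by (simp add: lact_def lprod_def lax_left_def)

lemma ract_lprod:
  assumes "lax_double_functor D E G" "n \<in> Obj (D1 D)"
    "a \<in> Arr (D1 E)" "b \<in> Arr (D1 E)" "ctgt E b = csrc E a"
    "Cod (D1 E) a = Fp G (pid D (ptgt D n))" "Cod (D1 E) b = Fp G n"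
    "Dom (D1 E) a = pid E (ptgt E (Dom (D1 E) b))"
  shows "ract D E G n b a
    = RUi E (Dom (D1 E) b) \<cdot> (lprod E G n (pid D (ptgt D n)) b a \<cdot> Fc G (RU D n))"
  using assms by (simp add: ract_def lprod_def lax_right_def)

lemma lact_typing [simp]:
  assumes "lax_double_functor D E G" "n \<in> Obj (D1 D)"
    "a \<in> Arr (D1 E)" "b \<in> Arr (D1 E)" "ctgt E a = csrc E b"
    "Cod (D1 E) a = Fp G (pid D (psrc D n))" "Cod (D1 E) b = Fp G n"
    "Dom (D1 E) a = pid E (psrc E (Dom (D1 E) b))"
  shows "lact D E G n a b \<in> Arr (D1 E)" "Dom (D1 E) (lact D E G n a b) = Dom (D1 E) b"
    "Cod (D1 E) (lact D E G n a b) = Fp G n"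
    "csrc E (lact D E G n a b) = csrc E a" "ctgt E (lact D E G n a b) = ctgt E b"
  using assms by (simp_all add: lact_lprod)

lemma ract_typing [simp]:
  assumes "lax_double_functor D E G" "n \<in> Obj (D1 D)"
    "a \<in> Arr (D1 E)" "b \<in> Arr (D1 E)" "ctgt E b = csrc E a"
    "Cod (D1 E) a = Fp G (pid D (ptgt D n))" "Cod (D1 E) b = Fp G n"
    "Dom (D1 E) a = pid E (ptgt E (Dom (D1 E) b))"
  shows "ract D E G n b a \<in> Arr (D1 E)" "Dom (D1 E) (ract D E G n b a) = Dom (D1 E) b"
    "Cod (D1 E) (ract D E G n b a) = Fp G n"
    "csrc E (ract D E G n b a) = csrc E b" "ctgt E (ract D E G n b a) = ctgt E a"
  using assms by (simp_all add: ract_lprod)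

text \<open>The agreement of the unitors enters twice: in \<open>E\<close> for the inverse unitor in
  front, and in \<open>D\<close>, under \<open>G\<close>, for the unitor behind.\<close>

lemma lact_ract_pid:
  assumes "lax_double_functor D E G" "x \<in> Obj (D0 D)"
    "Dom (D1 E) b = pid E X" "Dom (D1 E) a = pid E X" "X \<in> Obj (D0 E)"
  shows "ract D E G (pid D x) a b = lact D E G (pid D x) a b"
  using assms by (simp add: lact_def ract_def lax_left_def lax_right_def E.LU_pid_eq_RU_pid D.LU_pid_eq_RU_pid)

text \<open>The common core of the three associativity laws for the actions. The associator of
  \<open>D\<close> is split off the suffix \<open>v'\<close>, and that of \<open>E\<close> joins the
  prefix \<open>u\<close>. Both are described by equations so that applying the rule leaves one
  coherence identity in \<open>D\<close> and one in \<open>E\<close> as goals.\<close>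

lemma reassociate:
  assumes G: "lax_double_functor D E G"
    and mnp: "m \<in> Obj (D1 D)" "n \<in> Obj (D1 D)" "p \<in> Obj (D1 D)"
    "ptgt D m = psrc D n" "ptgt D n = psrc D p"
    and abc: "a \<in> Arr (D1 E)" "b \<in> Arr (D1 E)" "c \<in> Arr (D1 E)"
    "ctgt E a = csrc E b" "ctgt E b = csrc E c"
    "Cod (D1 E) a = Fp G m" "Cod (D1 E) b = Fp G n" "Cod (D1 E) c = Fp G p"
    and v: "v \<in> Arr (D1 D)" "Dom (D1 D) v = m \<odot>\<^bsub>D\<^esub> (n \<odot>\<^bsub>D\<^esub> p)"
    and u: "u \<in> Arr (D1 E)" "Cod (D1 E) u = (Dom (D1 E) a \<odot> Dom (D1 E) b) \<odot> Dom (D1 E) c"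
    and v': "v' = AS D m n p \<cdot>\<^bsub>D\<^esub> v"
    and u': "u' = u \<cdot> AS E (Dom (D1 E) a) (Dom (D1 E) b) (Dom (D1 E) c)"
  shows "u \<cdot> (lprod E G (m \<odot>\<^bsub>D\<^esub> n) p (lprod E G m n a b) c \<cdot> Fc G v')
    = u' \<cdot> (lprod E G m (n \<odot>\<^bsub>D\<^esub> p) a (lprod E G n p b c) \<cdot> Fc G v)"
proof -
  note [simp] = G mnp abc v u
  note [simp] = E.ctgt_eq_csrc_boundary(1)[OF abc(1,2,4)] E.ctgt_eq_csrc_boundary(1)[OF abc(2,3,5)]
  have "u \<cdot> (lprod E G (m \<odot>\<^bsub>D\<^esub> n) p (lprod E G m n a b) c \<cdot> Fc G v')
    = u \<cdot> ((lprod E G (m \<odot>\<^bsub>D\<^esub> n) p (lprod E G m n a b) c \<cdot> Fc G (AS D m n p)) \<cdot> Fc G v)"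
    unfolding v' by (simp add: Fc_Cmp)
  then show ?thesis unfolding lprod_assoc[OF G mnp abc] u' by simp
qed

text \<open>Interchange collects the two inverse unitors of \<open>E\<close> in front and naturality
  of the laxator collects the two unitors of \<open>D\<close> behind. What remains is an uncollapsed
  triple product, to which \<open>reassociate\<close> applies.\<close>

lemma lact_lact:
  assumes G: "lax_double_functor D E G" and n: "n \<in> Obj (D1 D)" "psrc D n = x"
    and abc: "a \<in> Arr (D1 E)" "b \<in> Arr (D1 E)" "c \<in> Arr (D1 E)"
    "ctgt E a = csrc E b" "ctgt E b = csrc E c"
    "Cod (D1 E) a = Fp G (pid D x)" "Cod (D1 E) b = Fp G (pid D x)"
    "Cod (D1 E) c = Fp G n"
    "Dom (D1 E) a = pid E (psrc E (Dom (D1 E) c))" "Dom (D1 E) b = pid E (psrc E (Dom (D1 E) c))"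
  shows "lact D E G n (lact D E G (pid D x) a b) c = lact D E G n a (lact D E G n b c)"
proof -
  let ?i = "pid D x" and ?M = "Dom (D1 E) c"
  let ?I = "pid E (psrc E ?M)"
  have x: "x \<in> Obj (D0 D)" using n D.src_tgt_typing(1)[OF n(1)] by simp
  note [simp] = G n abc x
  \<comment> \<open>\<open>c\<close> is padded with identities on both ends, as partners for the
    unitors of the first factor when these are pulled out.\<close>
  have "lact D E G n (lact D E G ?i a b) c
      = LUi E ?M \<cdot> (lprod E G ?i n (LUi E ?I \<cdot> (lprod E G ?i ?i a b \<cdot> Fc G (LU D ?i)))
          (id1 E ?M \<cdot> (c \<cdot> Fc G (id1 D n))) \<cdot> Fc G (LU D n))"
    by (simp add: lact_lprod)
  also have "\<dots> = LUi E ?M \<cdot> (((LUi E ?I \<Odot> id1 E ?M) \<cdot>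
      lprod E G ?i n (lprod E G ?i ?i a b \<cdot> Fc G (LU D ?i)) (c \<cdot> Fc G (id1 D n))) \<cdot> Fc G (LU D n))"
    by (subst lprod_pre) simp_all
  also have "lprod E G ?i n (lprod E G ?i ?i a b \<cdot> Fc G (LU D ?i)) (c \<cdot> Fc G (id1 D n))
      = lprod E G (?i \<odot>\<^bsub>D\<^esub> ?i) n (lprod E G ?i ?i a b) c \<cdot> Fc G (LU D ?i \<Odot>\<^bsub>D\<^esub> id1 D n)"
    using lprod_post[of G "LU D ?i" "id1 D n" "lprod E G ?i ?i a b" c] by simp
  finally have "lact D E G n (lact D E G ?i a b) c = (LUi E ?M \<cdot> (LUi E ?I \<Odot> id1 E ?M)) \<cdot>
      (lprod E G (?i \<odot>\<^bsub>D\<^esub> ?i) n (lprod E G ?i ?i a b) c \<cdot> Fc G ((LU D ?i \<Odot>\<^bsub>D\<^esub> id1 D n) \<cdot>\<^bsub>D\<^esub> LU D n))"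
    by (simp add: Fc_Cmp)
  also have "\<dots> = (LUi E ?M \<cdot> (id1 E ?I \<Odot> LUi E ?M)) \<cdot>
      (lprod E G ?i (?i \<odot>\<^bsub>D\<^esub> n) a (lprod E G ?i n b c) \<cdot> Fc G ((id1 D ?i \<Odot>\<^bsub>D\<^esub> LU D n) \<cdot>\<^bsub>D\<^esub> LU D n))"
  proof (rule reassociate)
    \<comment> \<open>The triangle produces \<open>RU ?i\<close>, whereas the product of the two
      unit cells was collapsed with \<open>LU ?i\<close>.\<close>
    have tri: "AS D ?i ?i n \<cdot>\<^bsub>D\<^esub> (id1 D ?i \<Odot>\<^bsub>D\<^esub> LU D n) = LU D ?i \<Odot>\<^bsub>D\<^esub> id1 D n"
      using D.AS_triangle[of ?i n] by (simp add: D.LU_pid_eq_RU_pid)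
    show "(LU D ?i \<Odot>\<^bsub>D\<^esub> id1 D n) \<cdot>\<^bsub>D\<^esub> LU D n = AS D ?i ?i n \<cdot>\<^bsub>D\<^esub> ((id1 D ?i \<Odot>\<^bsub>D\<^esub> LU D n) \<cdot>\<^bsub>D\<^esub> LU D n)"
      unfolding tri[symmetric] by simp
    have tri: "AS E ?I ?I ?M \<cdot> (id1 E ?I \<Odot> LU E ?M) = LU E ?I \<Odot> id1 E ?M"
      using E.AS_triangle[of ?I ?M] by (simp add: E.LU_pid_eq_RU_pid)
    \<comment> \<open>In \<open>E\<close> the same identity is needed for inverse unitors;
      \<open>p\<close> and \<open>q\<close> remove both units from the two bracketings and differ by
      the associator.\<close>
    have "LUi E ?M \<cdot> (LUi E ?I \<Odot> id1 E ?M) \<cdot> AS E ?I ?I ?M = LUi E ?M \<cdot> (id1 E ?I \<Odot> LUi E ?M)"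
    proof (rule E.inverse_shift[where q = "(id1 E ?I \<Odot> LU E ?M) \<cdot> LU E ?M"
          and p = "(LU E ?I \<Odot> id1 E ?M) \<cdot> LU E ?M"])
      show "(LU E ?I \<Odot> id1 E ?M) \<cdot> LU E ?M = AS E ?I ?I ?M \<cdot> ((id1 E ?I \<Odot> LU E ?M) \<cdot> LU E ?M)"
        unfolding tri[symmetric] by simp
      show "LUi E ?M \<cdot> (LUi E ?I \<Odot> id1 E ?M) \<cdot> ((LU E ?I \<Odot> id1 E ?M) \<cdot> LU E ?M) = id1 E ?M"
        by (simp add: E.ecmp_ccmp_ccmp)
      have "LU E ?M \<cdot> (LUi E ?M \<cdot> (id1 E ?I \<Odot> LUi E ?M)) = id1 E ?I \<Odot> LUi E ?M"
        by (simp flip: E.C1.arr_algebra(3))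
      then show "(id1 E ?I \<Odot> LU E ?M) \<cdot> LU E ?M \<cdot> (LUi E ?M \<cdot> (id1 E ?I \<Odot> LUi E ?M))
          = id1 E (Cod (D1 E) (AS E ?I ?I ?M))"
        by (simp add: E.ecmp_ccmp)
    qed simp_all
    then show "LUi E ?M \<cdot> (id1 E ?I \<Odot> LUi E ?M)
      = LUi E ?M \<cdot> (LUi E ?I \<Odot> id1 E ?M) \<cdot> AS E (Dom (D1 E) a) (Dom (D1 E) b) (Dom (D1 E) c)"
      by simp
  qed simp_all
  also have "\<dots> = LUi E ?M \<cdot> (((id1 E ?I \<Odot> LUi E ?M) \<cdot>
      (lprod E G ?i (?i \<odot>\<^bsub>D\<^esub> n) a (lprod E G ?i n b c) \<cdot> Fc G (id1 D ?i \<Odot>\<^bsub>D\<^esub> LU D n))) \<cdot> Fc G (LU D n))"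
    by (simp add: Fc_Cmp)
  also have "lprod E G ?i (?i \<odot>\<^bsub>D\<^esub> n) a (lprod E G ?i n b c) \<cdot> Fc G (id1 D ?i \<Odot>\<^bsub>D\<^esub> LU D n)
      = lprod E G ?i n (a \<cdot> Fc G (id1 D ?i)) (lprod E G ?i n b c \<cdot> Fc G (LU D n))"
    using lprod_post[of G "id1 D ?i" "LU D n" a "lprod E G ?i n b c"] by simp
  also have "(id1 E ?I \<Odot> LUi E ?M) \<cdot> \<dots>
      = lprod E G ?i n (id1 E ?I \<cdot> (a \<cdot> Fc G (id1 D ?i))) (LUi E ?M \<cdot> (lprod E G ?i n b c \<cdot> Fc G (LU D n)))"
    by (subst lprod_pre) simp_all
  also have "LUi E ?M \<cdot> (\<dots> \<cdot> Fc G (LU D n)) = lact D E G n a (lact D E G n b c)"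
    by (simp add: lact_lprod)
  finally show ?thesis .
qed

text \<open>The argument of \<open>lact_lact\<close> on the right. The triangle has
  \<open>LU\<close> at the middle unit, which fits the product of \<open>a\<close> and
  \<open>c\<close> being written with \<open>lact\<close>.\<close>

lemma ract_ract:
  assumes G: "lax_double_functor D E G" and n: "n \<in> Obj (D1 D)" "ptgt D n = x"
    and abc: "b \<in> Arr (D1 E)" "a \<in> Arr (D1 E)" "c \<in> Arr (D1 E)"
    "ctgt E b = csrc E a" "ctgt E a = csrc E c"
    "Cod (D1 E) a = Fp G (pid D x)" "Cod (D1 E) c = Fp G (pid D x)"
    "Cod (D1 E) b = Fp G n"
    "Dom (D1 E) a = pid E (ptgt E (Dom (D1 E) b))" "Dom (D1 E) c = pid E (ptgt E (Dom (D1 E) b))"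
  shows "ract D E G n b (lact D E G (pid D x) a c) = ract D E G n (ract D E G n b a) c"
proof -
  let ?i = "pid D x" and ?M = "Dom (D1 E) b"
  let ?I = "pid E (ptgt E ?M)"
  have x: "x \<in> Obj (D0 D)" using n D.src_tgt_typing(2)[OF n(1)] by simp
  note [simp] = G n abc x
  have "ract D E G n (ract D E G n b a) c
      = RUi E ?M \<cdot> (lprod E G n ?i (RUi E ?M \<cdot> (lprod E G n ?i b a \<cdot> Fc G (RU D n)))
          (id1 E ?I \<cdot> (c \<cdot> Fc G (id1 D ?i))) \<cdot> Fc G (RU D n))"
    by (simp add: ract_lprod)
  also have "\<dots> = RUi E ?M \<cdot> (((RUi E ?M \<Odot> id1 E ?I) \<cdot>
      lprod E G n ?i (lprod E G n ?i b a \<cdot> Fc G (RU D n)) (c \<cdot> Fc G (id1 D ?i))) \<cdot> Fc G (RU D n))"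
    by (subst lprod_pre) simp_all
  also have "lprod E G n ?i (lprod E G n ?i b a \<cdot> Fc G (RU D n)) (c \<cdot> Fc G (id1 D ?i))
      = lprod E G (n \<odot>\<^bsub>D\<^esub> ?i) ?i (lprod E G n ?i b a) c \<cdot> Fc G (RU D n \<Odot>\<^bsub>D\<^esub> id1 D ?i)"
    using lprod_post[of G "RU D n" "id1 D ?i" "lprod E G n ?i b a" c] by simp
  finally have "ract D E G n (ract D E G n b a) c = (RUi E ?M \<cdot> (RUi E ?M \<Odot> id1 E ?I)) \<cdot>
      (lprod E G (n \<odot>\<^bsub>D\<^esub> ?i) ?i (lprod E G n ?i b a) c \<cdot> Fc G ((RU D n \<Odot>\<^bsub>D\<^esub> id1 D ?i) \<cdot>\<^bsub>D\<^esub> RU D n))"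
    by (simp add: Fc_Cmp)
  also have "\<dots> = (RUi E ?M \<cdot> (id1 E ?M \<Odot> LUi E ?I)) \<cdot>
      (lprod E G n (?i \<odot>\<^bsub>D\<^esub> ?i) b (lprod E G ?i ?i a c) \<cdot> Fc G ((id1 D n \<Odot>\<^bsub>D\<^esub> LU D ?i) \<cdot>\<^bsub>D\<^esub> RU D n))"
  proof (rule reassociate)
    have tri: "AS D n ?i ?i \<cdot>\<^bsub>D\<^esub> (id1 D n \<Odot>\<^bsub>D\<^esub> LU D ?i) = RU D n \<Odot>\<^bsub>D\<^esub> id1 D ?i"
      using D.AS_triangle[of n ?i] by simp
    show "(RU D n \<Odot>\<^bsub>D\<^esub> id1 D ?i) \<cdot>\<^bsub>D\<^esub> RU D n = AS D n ?i ?i \<cdot>\<^bsub>D\<^esub> ((id1 D n \<Odot>\<^bsub>D\<^esub> LU D ?i) \<cdot>\<^bsub>D\<^esub> RU D n)"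
      unfolding tri[symmetric] by simp
    have tri: "AS E ?M ?I ?I \<cdot> (id1 E ?M \<Odot> LU E ?I) = RU E ?M \<Odot> id1 E ?I"
      using E.AS_triangle[of ?M ?I] by simp
    have "RUi E ?M \<cdot> (RUi E ?M \<Odot> id1 E ?I) \<cdot> AS E ?M ?I ?I = RUi E ?M \<cdot> (id1 E ?M \<Odot> LUi E ?I)"
    proof (rule E.inverse_shift[where q = "(id1 E ?M \<Odot> LU E ?I) \<cdot> RU E ?M"
          and p = "(RU E ?M \<Odot> id1 E ?I) \<cdot> RU E ?M"])
      show "(RU E ?M \<Odot> id1 E ?I) \<cdot> RU E ?M = AS E ?M ?I ?I \<cdot> ((id1 E ?M \<Odot> LU E ?I) \<cdot> RU E ?M)"
        unfolding tri[symmetric] by simp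
      show "RUi E ?M \<cdot> (RUi E ?M \<Odot> id1 E ?I) \<cdot> ((RU E ?M \<Odot> id1 E ?I) \<cdot> RU E ?M) = id1 E ?M"
        by (simp add: E.ecmp_ccmp_ccmp)
      have "RU E ?M \<cdot> (RUi E ?M \<cdot> (id1 E ?M \<Odot> LUi E ?I)) = id1 E ?M \<Odot> LUi E ?I"
        by (simp flip: E.C1.arr_algebra(3))
      then show "(id1 E ?M \<Odot> LU E ?I) \<cdot> RU E ?M \<cdot> (RUi E ?M \<cdot> (id1 E ?M \<Odot> LUi E ?I))
          = id1 E (Cod (D1 E) (AS E ?M ?I ?I))"
        by (simp add: E.ecmp_ccmp)
    qed simp_all
    then show "RUi E ?M \<cdot> (id1 E ?M \<Odot> LUi E ?I)
      = RUi E ?M \<cdot> (RUi E ?M \<Odot> id1 E ?I) \<cdot> AS E (Dom (D1 E) b) (Dom (D1 E) a) (Dom (D1 E) c)"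
      by simp
  qed simp_all
  also have "\<dots> = RUi E ?M \<cdot> (((id1 E ?M \<Odot> LUi E ?I) \<cdot>
      (lprod E G n (?i \<odot>\<^bsub>D\<^esub> ?i) b (lprod E G ?i ?i a c) \<cdot> Fc G (id1 D n \<Odot>\<^bsub>D\<^esub> LU D ?i))) \<cdot> Fc G (RU D n))"
    by (simp add: Fc_Cmp)
  also have "lprod E G n (?i \<odot>\<^bsub>D\<^esub> ?i) b (lprod E G ?i ?i a c) \<cdot> Fc G (id1 D n \<Odot>\<^bsub>D\<^esub> LU D ?i)
      = lprod E G n ?i (b \<cdot> Fc G (id1 D n)) (lprod E G ?i ?i a c \<cdot> Fc G (LU D ?i))"
    using lprod_post[of G "id1 D n" "LU D ?i" b "lprod E G ?i ?i a c"] by simp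
  also have "(id1 E ?M \<Odot> LUi E ?I) \<cdot> \<dots>
      = lprod E G n ?i (id1 E ?M \<cdot> (b \<cdot> Fc G (id1 D n))) (LUi E ?I \<cdot> (lprod E G ?i ?i a c \<cdot> Fc G (LU D ?i)))"
    by (subst lprod_pre) simp_all
  also have "RUi E ?M \<cdot> (\<dots> \<cdot> Fc G (RU D n)) = ract D E G n b (lact D E G ?i a c)"
    by (simp add: ract_lprod lact_lprod)
  finally show ?thesis by simp
qed

text \<open>The middle factor is now an arbitrary proarrow cell between two units, so the coherence
  identity is \<open>AS_LU\<close> together with naturality of the left unitor at the right
  unitor.\<close>

lemma ract_lact:
  assumes G: "lax_double_functor D E G" and n: "n \<in> Obj (D1 D)"
    and abc: "a \<in> Arr (D1 E)" "b \<in> Arr (D1 E)" "c \<in> Arr (D1 E)"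
    "ctgt E a = csrc E b" "ctgt E b = csrc E c"
    "Cod (D1 E) a = Fp G (pid D (psrc D n))" "Cod (D1 E) c = Fp G (pid D (ptgt D n))"
    "Cod (D1 E) b = Fp G n"
    "Dom (D1 E) a = pid E (psrc E (Dom (D1 E) b))" "Dom (D1 E) c = pid E (ptgt E (Dom (D1 E) b))"
  shows "ract D E G n (lact D E G n a b) c = lact D E G n a (ract D E G n b c)"
proof -
  let ?i = "pid D (psrc D n)" and ?j = "pid D (ptgt D n)" and ?M = "Dom (D1 E) b"
  let ?I = "pid E (psrc E ?M)" and ?J = "pid E (ptgt E ?M)"
  note [simp] = G n abc
  have "ract D E G n (lact D E G n a b) c
      = RUi E ?M \<cdot> (lprod E G n ?j (LUi E ?M \<cdot> (lprod E G ?i n a b \<cdot> Fc G (LU D n)))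
          (id1 E ?J \<cdot> (c \<cdot> Fc G (id1 D ?j))) \<cdot> Fc G (RU D n))"
    by (simp add: ract_lprod lact_lprod)
  also have "\<dots> = RUi E ?M \<cdot> (((LUi E ?M \<Odot> id1 E ?J) \<cdot>
      lprod E G n ?j (lprod E G ?i n a b \<cdot> Fc G (LU D n)) (c \<cdot> Fc G (id1 D ?j))) \<cdot> Fc G (RU D n))"
    by (subst lprod_pre) simp_all
  also have "lprod E G n ?j (lprod E G ?i n a b \<cdot> Fc G (LU D n)) (c \<cdot> Fc G (id1 D ?j))
      = lprod E G (?i \<odot>\<^bsub>D\<^esub> n) ?j (lprod E G ?i n a b) c \<cdot> Fc G (LU D n \<Odot>\<^bsub>D\<^esub> id1 D ?j)"
    using lprod_post[of G "LU D n" "id1 D ?j" "lprod E G ?i n a b" c] by simp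
  finally have "ract D E G n (lact D E G n a b) c = (RUi E ?M \<cdot> (LUi E ?M \<Odot> id1 E ?J)) \<cdot>
      (lprod E G (?i \<odot>\<^bsub>D\<^esub> n) ?j (lprod E G ?i n a b) c \<cdot> Fc G ((LU D n \<Odot>\<^bsub>D\<^esub> id1 D ?j) \<cdot>\<^bsub>D\<^esub> RU D n))"
    by (simp add: Fc_Cmp)
  also have "\<dots> = (LUi E ?M \<cdot> (id1 E ?I \<Odot> RUi E ?M)) \<cdot>
      (lprod E G ?i (n \<odot>\<^bsub>D\<^esub> ?j) a (lprod E G n ?j b c) \<cdot> Fc G ((id1 D ?i \<Odot>\<^bsub>D\<^esub> RU D n) \<cdot>\<^bsub>D\<^esub> LU D n))"
  proof (rule reassociate)
    have tri: "AS D ?i n ?j \<cdot>\<^bsub>D\<^esub> LU D (n \<odot>\<^bsub>D\<^esub> ?j) = LU D n \<Odot>\<^bsub>D\<^esub> id1 D ?j"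
      using D.AS_LU[of n ?j] by simp
    have nat: "(id1 D ?i \<Odot>\<^bsub>D\<^esub> RU D n) \<cdot>\<^bsub>D\<^esub> LU D n = LU D (n \<odot>\<^bsub>D\<^esub> ?j) \<cdot>\<^bsub>D\<^esub> RU D n"
      using D.LU_nat[of "RU D n"] by simp
    show "(LU D n \<Odot>\<^bsub>D\<^esub> id1 D ?j) \<cdot>\<^bsub>D\<^esub> RU D n = AS D ?i n ?j \<cdot>\<^bsub>D\<^esub> ((id1 D ?i \<Odot>\<^bsub>D\<^esub> RU D n) \<cdot>\<^bsub>D\<^esub> LU D n)"
      unfolding tri[symmetric] nat by simp
    have tri: "AS E ?I ?M ?J \<cdot> LU E (?M \<odot> ?J) = LU E ?M \<Odot> id1 E ?J"
      using E.AS_LU[of ?M ?J] by simp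
    have nat: "(id1 E ?I \<Odot> RU E ?M) \<cdot> LU E ?M = LU E (?M \<odot> ?J) \<cdot> RU E ?M"
      using E.LU_nat[of "RU E ?M"] by simp
    have "RUi E ?M \<cdot> (LUi E ?M \<Odot> id1 E ?J) \<cdot> AS E ?I ?M ?J = LUi E ?M \<cdot> (id1 E ?I \<Odot> RUi E ?M)"
    proof (rule E.inverse_shift[where q = "(id1 E ?I \<Odot> RU E ?M) \<cdot> LU E ?M"
          and p = "(LU E ?M \<Odot> id1 E ?J) \<cdot> RU E ?M"])
      show "(LU E ?M \<Odot> id1 E ?J) \<cdot> RU E ?M = AS E ?I ?M ?J \<cdot> ((id1 E ?I \<Odot> RU E ?M) \<cdot> LU E ?M)"
        unfolding tri[symmetric] nat by simp
      show "RUi E ?M \<cdot> (LUi E ?M \<Odot> id1 E ?J) \<cdot> ((LU E ?M \<Odot> id1 E ?J) \<cdot> RU E ?M) = id1 E ?M"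
        by (simp add: E.ecmp_ccmp_ccmp)
      have "LU E ?M \<cdot> (LUi E ?M \<cdot> (id1 E ?I \<Odot> RUi E ?M)) = id1 E ?I \<Odot> RUi E ?M"
        by (simp flip: E.C1.arr_algebra(3))
      then show "(id1 E ?I \<Odot> RU E ?M) \<cdot> LU E ?M \<cdot> (LUi E ?M \<cdot> (id1 E ?I \<Odot> RUi E ?M))
          = id1 E (Cod (D1 E) (AS E ?I ?M ?J))"
        by (simp add: E.ecmp_ccmp)
    qed simp_all
    then show "LUi E ?M \<cdot> (id1 E ?I \<Odot> RUi E ?M)
      = RUi E ?M \<cdot> (LUi E ?M \<Odot> id1 E ?J) \<cdot> AS E (Dom (D1 E) a) (Dom (D1 E) b) (Dom (D1 E) c)"
      by simp
  qed simp_all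
  also have "\<dots> = LUi E ?M \<cdot> (((id1 E ?I \<Odot> RUi E ?M) \<cdot>
      (lprod E G ?i (n \<odot>\<^bsub>D\<^esub> ?j) a (lprod E G n ?j b c) \<cdot> Fc G (id1 D ?i \<Odot>\<^bsub>D\<^esub> RU D n))) \<cdot> Fc G (LU D n))"
    by (simp add: Fc_Cmp)
  also have "lprod E G ?i (n \<odot>\<^bsub>D\<^esub> ?j) a (lprod E G n ?j b c) \<cdot> Fc G (id1 D ?i \<Odot>\<^bsub>D\<^esub> RU D n)
      = lprod E G ?i n (a \<cdot> Fc G (id1 D ?i)) (lprod E G n ?j b c \<cdot> Fc G (RU D n))"
    using lprod_post[of G "id1 D ?i" "RU D n" a "lprod E G n ?j b c"] by simp
  also have "(id1 E ?I \<Odot> RUi E ?M) \<cdot> \<dots>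
      = lprod E G ?i n (id1 E ?I \<cdot> (a \<cdot> Fc G (id1 D ?i))) (RUi E ?M \<cdot> (lprod E G n ?j b c \<cdot> Fc G (RU D n)))"
    by (subst lprod_pre) simp_all
  also have "LUi E ?M \<cdot> (\<dots> \<cdot> Fc G (LU D n)) = lact D E G n a (ract D E G n b c)"
    by (simp add: ract_lprod lact_lprod)
  finally show ?thesis .
qed

text \<open>Naturality of the inverse left unitor at \<open>g\<close>: the unit cell lies over the
  source side of \<open>b\<close>, so it is precomposed with the external identity on the source
  arrow of \<open>g\<close>.\<close>

lemma lact_pre:
  assumes G: "lax_double_functor D E G" "n \<in> Obj (D1 D)"
    and abg: "a \<in> Arr (D1 E)" "b \<in> Arr (D1 E)" "ctgt E a = csrc E b"
    "Cod (D1 E) a = Fp G (pid D (psrc D n))" "Cod (D1 E) b = Fp G n"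
    "Dom (D1 E) a = pid E (psrc E (Dom (D1 E) b))"
    "g \<in> Arr (D1 E)" "Cod (D1 E) g = Dom (D1 E) b"
  shows "g \<cdot> lact D E G n a b = lact D E G n (cid E (csrc E g) \<cdot> a) (g \<cdot> b)"
proof -
  note [simp] = G abg
  have g: "g \<cdot> LUi E (Dom (D1 E) b) = LUi E (Dom (D1 E) g) \<cdot> (cid E (csrc E g) \<Odot> g)"
    using E.LUi_nat[of g] by simp
  have "g \<cdot> lact D E G n a b = (g \<cdot> LUi E (Dom (D1 E) b)) \<cdot> ((a \<Odot> b) \<cdot> lax_left D E G n)"
    by (simp add: lact_def)
  then show ?thesis unfolding g by (simp add: lact_def E.ecmp_ccmp_ccmp)
qed

lemma ract_pre:
  assumes G: "lax_double_functor D E G" "n \<in> Obj (D1 D)"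
    and abg: "a \<in> Arr (D1 E)" "b \<in> Arr (D1 E)" "ctgt E b = csrc E a"
    "Cod (D1 E) a = Fp G (pid D (ptgt D n))" "Cod (D1 E) b = Fp G n"
    "Dom (D1 E) a = pid E (ptgt E (Dom (D1 E) b))"
    "g \<in> Arr (D1 E)" "Cod (D1 E) g = Dom (D1 E) b"
  shows "g \<cdot> ract D E G n b a = ract D E G n (g \<cdot> b) (cid E (ctgt E g) \<cdot> a)"
proof -
  note [simp] = G abg
  have g: "g \<cdot> RUi E (Dom (D1 E) b) = RUi E (Dom (D1 E) g) \<cdot> (g \<Odot> cid E (ctgt E g))"
    using E.RUi_nat[of g] by simp
  have "g \<cdot> ract D E G n b a = (g \<cdot> RUi E (Dom (D1 E) b)) \<cdot> ((b \<Odot> a) \<cdot> lax_right D E G n)"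
    by (simp add: ract_def)
  then show ?thesis unfolding g by (simp add: ract_def E.ecmp_ccmp_ccmp)
qed

text \<open>Naturality of the left unitor of \<open>D\<close> at \<open>g\<close>, transported by
  \<open>G\<close>, followed by naturality of the laxator.\<close>

lemma lact_post:
  assumes G: "lax_double_functor D E G" "g \<in> Arr (D1 D)"
    and abg: "a \<in> Arr (D1 E)" "b \<in> Arr (D1 E)" "ctgt E a = csrc E b"
    "Dom (D1 D) g = n" "Cod (D1 E) a = Fp G (pid D (psrc D n))" "Cod (D1 E) b = Fp G n"
    "Dom (D1 E) a = pid E (psrc E (Dom (D1 E) b))"
  shows "lact D E G n a b \<cdot> Fc G g
    = lact D E G (Cod (D1 D) g) (a \<cdot> Fc G (cid D (csrc D g))) (b \<cdot> Fc G g)"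
proof -
  note [simp] = G abg
  have n [simp]: "n \<in> Obj (D1 D)" using D.C1.arr_typing(1)[OF G(2)] by simp
  have "lact D E G n a b \<cdot> Fc G g
      = LUi E (Dom (D1 E) b) \<cdot> (lprod E G (pid D (psrc D n)) n a b \<cdot> (Fc G (LU D n) \<cdot> Fc G g))"
    by (simp add: lact_lprod)
  also have "Fc G (LU D n) \<cdot> Fc G g = Fc G (cid D (csrc D g) \<Odot>\<^bsub>D\<^esub> g) \<cdot> Fc G (LU D (Cod (D1 D) g))"
    using D.LU_nat[of g] by (simp flip: Fc_Cmp)
  also have "LUi E (Dom (D1 E) b) \<cdot> (lprod E G (pid D (psrc D n)) n a b \<cdot> \<dots>)
      = LUi E (Dom (D1 E) b) \<cdot> ((lprod E G (pid D (psrc D n)) n a b \<cdot> Fc G (cid D (csrc D g) \<Odot>\<^bsub>D\<^esub> g))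
          \<cdot> Fc G (LU D (Cod (D1 D) g)))"
    by simp
  also have "lprod E G (pid D (psrc D n)) n a b \<cdot> Fc G (cid D (csrc D g) \<Odot>\<^bsub>D\<^esub> g)
      = lprod E G (pid D (psrc D (Cod (D1 D) g))) (Cod (D1 D) g) (a \<cdot> Fc G (cid D (csrc D g))) (b \<cdot> Fc G g)"
    using lprod_post[of G "cid D (csrc D g)" g a b] by simp
  also have "LUi E (Dom (D1 E) b) \<cdot> (\<dots> \<cdot> Fc G (LU D (Cod (D1 D) g)))
      = lact D E G (Cod (D1 D) g) (a \<cdot> Fc G (cid D (csrc D g))) (b \<cdot> Fc G g)"
    by (simp add: lact_lprod)
  finally show ?thesis .
qed

text \<open>The left unit axiom of \<open>G\<close>. Cells of the form
  \<open>cid f \<cdot> unitor G x\<close> are the components of transformations at identity arrows,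
  of strictly natural transformations, and of identity modulations, so all of these act
  trivially.\<close>

lemma lact_unit:
  assumes G: "lax_double_functor D E G" "n \<in> Obj (D1 D)"
    and b: "b \<in> Arr (D1 E)" "Cod (D1 E) b = Fp G n"
  shows "lact D E G n (cid E (csrc E b) \<cdot> unitor G (psrc D n)) b = b"
proof -
  note [simp] = G b
  have unit: "(unitor G (psrc D n) \<Odot> id1 E (Fp G n)) \<cdot> (laxator G (pid D (psrc D n)) n \<cdot> Fc G (LU D n))
      = LU E (Fp G n)"
    using lax_double_functor.laxator_left_unit[OF G(1), of n "psrc D n" "ptgt D n"]
    by (simp add: proarrow_def)
  have "lact D E G n (cid E (csrc E b) \<cdot> unitor G (psrc D n)) (b \<cdot> id1 E (Fp G n))
      = LUi E (Dom (D1 E) b) \<cdot> ((cid E (csrc E b) \<Odot> b) \<cdot> ((unitor G (psrc D n) \<Odot> id1 E (Fp G n))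
          \<cdot> (laxator G (pid D (psrc D n)) n \<cdot> Fc G (LU D n))))"
    by (simp add: lact_lprod lprod_def E.ecmp_ccmp_ccmp)
  also have "\<dots> = LUi E (Dom (D1 E) b) \<cdot> (LU E (Dom (D1 E) b) \<cdot> b)"
    unfolding unit using E.LU_nat[of b] by simp
  also have "\<dots> = b"
    by (simp flip: E.C1.arr_algebra(3))
  finally show ?thesis by simp
qed

lemma ract_unit:
  assumes G: "lax_double_functor D E G" "n \<in> Obj (D1 D)"
    and b: "b \<in> Arr (D1 E)" "Cod (D1 E) b = Fp G n"
  shows "ract D E G n b (cid E (ctgt E b) \<cdot> unitor G (ptgt D n)) = b"
proof -
  note [simp] = G b
  have unit: "(id1 E (Fp G n) \<Odot> unitor G (ptgt D n)) \<cdot> (laxator G n (pid D (ptgt D n)) \<cdot> Fc G (RU D n))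
      = RU E (Fp G n)"
    using lax_double_functor.laxator_right_unit[OF G(1), of n "psrc D n" "ptgt D n"]
    by (simp add: proarrow_def)
  have "ract D E G n (b \<cdot> id1 E (Fp G n)) (cid E (ctgt E b) \<cdot> unitor G (ptgt D n))
      = RUi E (Dom (D1 E) b) \<cdot> ((b \<Odot> cid E (ctgt E b)) \<cdot> ((id1 E (Fp G n) \<Odot> unitor G (ptgt D n))
          \<cdot> (laxator G n (pid D (ptgt D n)) \<cdot> Fc G (RU D n))))"
    by (simp add: ract_lprod lprod_def E.ecmp_ccmp_ccmp)
  also have "\<dots> = RUi E (Dom (D1 E) b) \<cdot> (RU E (Dom (D1 E) b) \<cdot> b)"
    unfolding unit using E.RU_nat[of b] by simp
  also have "\<dots> = b"
    by (simp flip: E.C1.arr_algebra(3))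
  finally show ?thesis by simp
qed

text \<open>\<open>f\<close> and \<open>x\<close> are independent variables tied by equations, so
  that the rule also fires when the source arrow of \<open>b\<close> is not literally
  displayed.\<close>

lemma lact_unit_cid [simp]:
  "\<lbrakk>lax_double_functor D E G; n \<in> Obj (D1 D); b \<in> Arr (D1 E); Cod (D1 E) b = Fp G n;
    csrc E b = f; psrc D n = x\<rbrakk> \<Longrightarrow> lact D E G n (cid E f \<cdot> unitor G x) b = b"
  using lact_unit by auto

lemma ract_unit_cid [simp]:
  "\<lbrakk>lax_double_functor D E G; n \<in> Obj (D1 D); b \<in> Arr (D1 E); Cod (D1 E) b = Fp G n;
    ctgt E b = f; ptgt D n = x\<rbrakk> \<Longrightarrow> ract D E G n b (cid E f \<cdot> unitor G x) = b"
  using ract_unit by auto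

text \<open>For two unit cells the left product is also the right one, so the right unit law
  applies.\<close>

lemma lact_unit_right [simp]:
  assumes "lax_double_functor D E G" "x \<in> Obj (D0 D)" "a \<in> Arr (D1 E)"
    "Cod (D1 E) a = Fp G (pid D x)" "Dom (D1 E) a = pid E X" "X \<in> Obj (D0 E)" "ctgt E a = f"
  shows "lact D E G (pid D x) a (cid E f \<cdot> unitor G x) = a"
proof -
  have f: "f \<in> Arr (D0 E)" "Dom (D0 E) f = X" "Cod (D0 E) f = Fo G x"
    using assms E.src_tgt_typing(4,7,8)[of a] by auto
  then have "lact D E G (pid D x) a (cid E f \<cdot> unitor G x) = ract D E G (pid D x) a (cid E f \<cdot> unitor G x)"
    using assms by (intro lact_ract_pid[symmetric, where X = X]) auto
  then show ?thesis using assms f by simp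
qed

section \<open>Lax transformations\<close>

lemma trans_functor [simp]:
  "lax_transformation D E \<alpha> \<Longrightarrow> lax_double_functor D E (tdom \<alpha>)"
  "lax_transformation D E \<alpha> \<Longrightarrow> lax_double_functor D E (tcod \<alpha>)"
  by (rule lax_transformation.tdom_functor lax_transformation.tcod_functor; assumption)+

lemma trans_typing [simp]:
  assumes "lax_transformation D E \<alpha>"
  shows
    "x \<in> Obj (D0 D) \<Longrightarrow> tO \<alpha> x \<in> Arr (D0 E)"
    "x \<in> Obj (D0 D) \<Longrightarrow> Dom (D0 E) (tO \<alpha> x) = Fo (tdom \<alpha>) x"
    "x \<in> Obj (D0 D) \<Longrightarrow> Cod (D0 E) (tO \<alpha> x) = Fo (tcod \<alpha>) x"
    "m \<in> Obj (D1 D) \<Longrightarrow> tP \<alpha> m \<in> Arr (D1 E)"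
    "m \<in> Obj (D1 D) \<Longrightarrow> Dom (D1 E) (tP \<alpha> m) = Fp (tdom \<alpha>) m"
    "m \<in> Obj (D1 D) \<Longrightarrow> Cod (D1 E) (tP \<alpha> m) = Fp (tcod \<alpha>) m"
    "m \<in> Obj (D1 D) \<Longrightarrow> csrc E (tP \<alpha> m) = tO \<alpha> (psrc D m)"
    "m \<in> Obj (D1 D) \<Longrightarrow> ctgt E (tP \<alpha> m) = tO \<alpha> (ptgt D m)"
    "f \<in> Arr (D0 D) \<Longrightarrow> tA \<alpha> f \<in> Arr (D1 E)"
    "f \<in> Arr (D0 D) \<Longrightarrow> Dom (D1 E) (tA \<alpha> f) = pid E (Fo (tdom \<alpha>) (Dom (D0 D) f))"
    "f \<in> Arr (D0 D) \<Longrightarrow> Cod (D1 E) (tA \<alpha> f) = Fp (tcod \<alpha>) (pid D (Cod (D0 D) f))"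
    "f \<in> Arr (D0 D) \<Longrightarrow> csrc E (tA \<alpha> f) = tO \<alpha> (Dom (D0 D) f) \<bullet> Fa (tcod \<alpha>) f"
    "f \<in> Arr (D0 D) \<Longrightarrow> ctgt E (tA \<alpha> f) = Fa (tdom \<alpha>) f \<bullet> tO \<alpha> (Cod (D0 D) f)"
  using lax_transformation.tO_hom[OF assms, of x]
    lax_transformation.tP_cell[OF assms, of m "psrc D m" "ptgt D m"]
    lax_transformation.tA_cell[OF assms, of f "Dom (D0 D) f" "Cod (D0 D) f"]
  by (auto simp: hom_def cells_def proarrow_def)

lemma trans_nat:
  assumes "lax_transformation D E \<alpha>" "g \<in> Arr (D1 D)"
  shows "lact D E (tcod \<alpha>) (Cod (D1 D) g) (tA \<alpha> (csrc D g)) (Fc (tdom \<alpha>) g \<cdot> tP \<alpha> (Cod (D1 D) g))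
    = ract D E (tcod \<alpha>) (Cod (D1 D) g) (tP \<alpha> (Dom (D1 D) g) \<cdot> Fc (tcod \<alpha>) g) (tA \<alpha> (ctgt D g))"
  using lax_transformation.trans_natural[OF assms(1), of "Dom (D1 D) g" "psrc D (Dom (D1 D) g)"
      "ptgt D (Dom (D1 D) g)" "Cod (D1 D) g" "psrc D (Cod (D1 D) g)" "ptgt D (Cod (D1 D) g)" g] assms
  by (simp add: lact_def ract_def proarrow_def cells_def hom_def)

lemma trans_pcmp:
  assumes "lax_transformation D E \<alpha>" "m \<in> Obj (D1 D)" "n \<in> Obj (D1 D)" "ptgt D m = psrc D n"
  shows "laxator (tdom \<alpha>) m n \<cdot> tP \<alpha> (m \<odot>\<^bsub>D\<^esub> n) = (tP \<alpha> m \<Odot> tP \<alpha> n) \<cdot> laxator (tcod \<alpha>) m n"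
  using lax_transformation.trans_laxator[OF assms(1), of m "psrc D m" "ptgt D m" n "ptgt D n"] assms
  by (simp add: proarrow_def)

lemma trans_pid [simp]:
  "\<lbrakk>lax_transformation D E \<alpha>; x \<in> Obj (D0 D); tdom \<alpha> = F\<rbrakk>
    \<Longrightarrow> unitor F x \<cdot> tP \<alpha> (pid D x) = cid E (tO \<alpha> x) \<cdot> unitor (tcod \<alpha>) x"
  using lax_transformation.trans_unitor[of D E \<alpha> x] by simp

lemma trans_Idn [simp]:
  "\<lbrakk>lax_transformation D E \<alpha>; x \<in> Obj (D0 D)\<rbrakk>
    \<Longrightarrow> tA \<alpha> (Idn (D0 D) x) = cid E (tO \<alpha> x) \<cdot> unitor (tcod \<alpha>) x"
  by (rule lax_transformation.trans_Idn)

lemma trans_Cmp: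
  assumes "lax_transformation D E \<alpha>" "f \<in> Arr (D0 D)" "g \<in> Arr (D0 D)" "Cod (D0 D) f = Dom (D0 D) g"
  shows "tA \<alpha> (f \<bullet>\<^bsub>D\<^esub> g) = lact D E (tcod \<alpha>) (pid D (Cod (D0 D) g))
      (tA \<alpha> f \<cdot> Fc (tcod \<alpha>) (cid D g)) (cid E (Fa (tdom \<alpha>) f) \<cdot> tA \<alpha> g)"
  using lax_transformation.trans_Cmp[OF assms(1), of f "Dom (D0 D) f" "Cod (D0 D) f" g "Cod (D0 D) g"] assms
  by (simp add: lact_def lax_id_def hom_def)

text \<open>At identity arrows the components of \<open>\<alpha>\<close> are units for the actions,
  so both disappear from the naturality axiom and strict naturality is left. It is applied to the
  unitors of \<open>D\<close>.\<close>

lemma trans_globular: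
  assumes "lax_transformation D E \<alpha>" "g \<in> Arr (D1 D)" "csrc D g = Idn (D0 D) x" "ctgt D g = Idn (D0 D) y"
    "x \<in> Obj (D0 D)" "y \<in> Obj (D0 D)"
  shows "Fc (tdom \<alpha>) g \<cdot> tP \<alpha> (Cod (D1 D) g) = tP \<alpha> (Dom (D1 D) g) \<cdot> Fc (tcod \<alpha>) g"
proof -
  note [simp] = assms
  have xy: "psrc D (Dom (D1 D) g) = x" "psrc D (Cod (D1 D) g) = x"
    "ptgt D (Dom (D1 D) g) = y" "ptgt D (Cod (D1 D) g) = y"
    using D.src_tgt_typing(5-8)[OF assms(2)] by auto
  show ?thesis using trans_nat[OF assms(1,2)] by (simp add: xy)
qed

text \<open>Strict naturality at the unitor of \<open>D\<close> moves the component of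
  \<open>\<beta>\<close> in front of it, and the laxator axiom then splits that component into an
  external product.\<close>

lemma lact_trans:
  assumes T: "lax_transformation D E \<beta>" "tdom \<beta> = G" and n: "n \<in> Obj (D1 D)"
    and ab: "a \<in> Arr (D1 E)" "b \<in> Arr (D1 E)" "ctgt E a = csrc E b"
    "Cod (D1 E) a = Fp G (pid D (psrc D n))" "Cod (D1 E) b = Fp G n"
    "Dom (D1 E) a = pid E (psrc E (Dom (D1 E) b))"
  shows "lact D E G n a b \<cdot> tP \<beta> n = lact D E (tcod \<beta>) n (a \<cdot> tP \<beta> (pid D (psrc D n))) (b \<cdot> tP \<beta> n)"
proof -
  let ?i = "pid D (psrc D n)" and ?H = "tcod \<beta>"
  note [simp] = T n ab
  have [simp]: "lax_double_functor D E G" using trans_functor[OF T(1)] by simp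
  have glob: "Fc G (LU D n) \<cdot> tP \<beta> n = tP \<beta> (?i \<odot>\<^bsub>D\<^esub> n) \<cdot> Fc ?H (LU D n)"
    using trans_globular[OF T(1), of "LU D n" "psrc D n" "ptgt D n"] by simp
  have lax: "laxator G ?i n \<cdot> tP \<beta> (?i \<odot>\<^bsub>D\<^esub> n) = (tP \<beta> ?i \<Odot> tP \<beta> n) \<cdot> laxator ?H ?i n"
    using trans_pcmp[OF T(1), of ?i n] by simp
  have "lact D E G n a b \<cdot> tP \<beta> n
      = LUi E (Dom (D1 E) b) \<cdot> ((a \<Odot> b) \<cdot> (laxator G ?i n \<cdot> (Fc G (LU D n) \<cdot> tP \<beta> n)))"
    by (simp add: lact_lprod lprod_def)
  also have "\<dots> = LUi E (Dom (D1 E) b) \<cdot> ((a \<Odot> b) \<cdot> ((laxator G ?i n \<cdot> tP \<beta> (?i \<odot>\<^bsub>D\<^esub> n)) \<cdot> Fc ?H (LU D n)))"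
    unfolding glob by simp
  also have "\<dots> = lact D E ?H n (a \<cdot> tP \<beta> ?i) (b \<cdot> tP \<beta> n)"
    unfolding lax by (simp add: lact_lprod lprod_def E.ecmp_ccmp_ccmp)
  finally show ?thesis .
qed

lemma ract_trans:
  assumes T: "lax_transformation D E \<beta>" "tdom \<beta> = G" and n: "n \<in> Obj (D1 D)"
    and ab: "a \<in> Arr (D1 E)" "b \<in> Arr (D1 E)" "ctgt E b = csrc E a"
    "Cod (D1 E) a = Fp G (pid D (ptgt D n))" "Cod (D1 E) b = Fp G n"
    "Dom (D1 E) a = pid E (ptgt E (Dom (D1 E) b))"
  shows "ract D E G n b a \<cdot> tP \<beta> n = ract D E (tcod \<beta>) n (b \<cdot> tP \<beta> n) (a \<cdot> tP \<beta> (pid D (ptgt D n)))"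
proof -
  let ?i = "pid D (ptgt D n)" and ?H = "tcod \<beta>"
  note [simp] = T n ab
  have [simp]: "lax_double_functor D E G" using trans_functor[OF T(1)] by simp
  have glob: "Fc G (RU D n) \<cdot> tP \<beta> n = tP \<beta> (n \<odot>\<^bsub>D\<^esub> ?i) \<cdot> Fc ?H (RU D n)"
    using trans_globular[OF T(1), of "RU D n" "psrc D n" "ptgt D n"] by simp
  have lax: "laxator G n ?i \<cdot> tP \<beta> (n \<odot>\<^bsub>D\<^esub> ?i) = (tP \<beta> n \<Odot> tP \<beta> ?i) \<cdot> laxator ?H n ?i"
    using trans_pcmp[OF T(1), of n ?i] by simp
  have "ract D E G n b a \<cdot> tP \<beta> n
      = RUi E (Dom (D1 E) b) \<cdot> ((b \<Odot> a) \<cdot> (laxator G n ?i \<cdot> (Fc G (RU D n) \<cdot> tP \<beta> n)))"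
    by (simp add: ract_lprod lprod_def)
  also have "\<dots> = RUi E (Dom (D1 E) b) \<cdot> ((b \<Odot> a) \<cdot> ((laxator G n ?i \<cdot> tP \<beta> (n \<odot>\<^bsub>D\<^esub> ?i)) \<cdot> Fc ?H (RU D n)))"
    unfolding glob by simp
  also have "\<dots> = ract D E ?H n (b \<cdot> tP \<beta> n) (a \<cdot> tP \<beta> ?i)"
    unfolding lax by (simp add: ract_lprod lprod_def E.ecmp_ccmp_ccmp)
  finally show ?thesis .
qed

section \<open>Identities and composites of transformations\<close>

lemma lax_transformationI:
  assumes FG: "lax_double_functor D E (tdom \<alpha>)" "lax_double_functor D E (tcod \<alpha>)"
    and O: "\<And>x. x \<in> Obj (D0 D) \<Longrightarrow> tO \<alpha> x \<in> Arr (D0 E)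
      \<and> Dom (D0 E) (tO \<alpha> x) = Fo (tdom \<alpha>) x \<and> Cod (D0 E) (tO \<alpha> x) = Fo (tcod \<alpha>) x"
    and P: "\<And>m. m \<in> Obj (D1 D) \<Longrightarrow> tP \<alpha> m \<in> Arr (D1 E)
      \<and> Dom (D1 E) (tP \<alpha> m) = Fp (tdom \<alpha>) m \<and> Cod (D1 E) (tP \<alpha> m) = Fp (tcod \<alpha>) m
      \<and> csrc E (tP \<alpha> m) = tO \<alpha> (psrc D m) \<and> ctgt E (tP \<alpha> m) = tO \<alpha> (ptgt D m)"
    and A: "\<And>f. f \<in> Arr (D0 D) \<Longrightarrow> tA \<alpha> f \<in> Arr (D1 E)
      \<and> Dom (D1 E) (tA \<alpha> f) = pid E (Fo (tdom \<alpha>) (Dom (D0 D) f))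
      \<and> Cod (D1 E) (tA \<alpha> f) = Fp (tcod \<alpha>) (pid D (Cod (D0 D) f))
      \<and> csrc E (tA \<alpha> f) = tO \<alpha> (Dom (D0 D) f) \<bullet> Fa (tcod \<alpha>) f
      \<and> ctgt E (tA \<alpha> f) = Fa (tdom \<alpha>) f \<bullet> tO \<alpha> (Cod (D0 D) f)"
    and nat: "\<And>g. g \<in> Arr (D1 D) \<Longrightarrow>
      lact D E (tcod \<alpha>) (Cod (D1 D) g) (tA \<alpha> (csrc D g)) (Fc (tdom \<alpha>) g \<cdot> tP \<alpha> (Cod (D1 D) g))
      = ract D E (tcod \<alpha>) (Cod (D1 D) g) (tP \<alpha> (Dom (D1 D) g) \<cdot> Fc (tcod \<alpha>) g) (tA \<alpha> (ctgt D g))"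
    and lax: "\<And>m n. \<lbrakk>m \<in> Obj (D1 D); n \<in> Obj (D1 D); ptgt D m = psrc D n\<rbrakk> \<Longrightarrow>
      laxator (tdom \<alpha>) m n \<cdot> tP \<alpha> (m \<odot>\<^bsub>D\<^esub> n) = (tP \<alpha> m \<Odot> tP \<alpha> n) \<cdot> laxator (tcod \<alpha>) m n"
    and unit: "\<And>x. x \<in> Obj (D0 D) \<Longrightarrow>
      unitor (tdom \<alpha>) x \<cdot> tP \<alpha> (pid D x) = cid E (tO \<alpha> x) \<cdot> unitor (tcod \<alpha>) x"
    and Cmp: "\<And>f g. \<lbrakk>f \<in> Arr (D0 D); g \<in> Arr (D0 D); Cod (D0 D) f = Dom (D0 D) g\<rbrakk> \<Longrightarrow>
      tA \<alpha> (f \<bullet>\<^bsub>D\<^esub> g) = lact D E (tcod \<alpha>) (pid D (Cod (D0 D) g))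
        (tA \<alpha> f \<cdot> Fc (tcod \<alpha>) (cid D g)) (cid E (Fa (tdom \<alpha>) f) \<cdot> tA \<alpha> g)"
    and Idn: "\<And>x. x \<in> Obj (D0 D) \<Longrightarrow> tA \<alpha> (Idn (D0 D) x) = cid E (tO \<alpha> x) \<cdot> unitor (tcod \<alpha>) x"
    and ext: "tO \<alpha> \<in> extensional (Obj (D0 D))" "tP \<alpha> \<in> extensional (Obj (D1 D))"
      "tA \<alpha> \<in> extensional (Arr (D0 D))"
  shows "lax_transformation D E \<alpha>"
proof -
  note [simp] = FG O P A
  show ?thesis
  proof (rule lax_transformation.intro)
    fix m x y n w z g f h
    assume mn: "proarrow D m x y" "proarrow D n w z" and g: "g \<in> cells D m n f h"
    then show "LUi E (Fp (tdom \<alpha>) m) \<cdot> (tA \<alpha> f \<Odot> (Fc (tdom \<alpha>) g \<cdot> tP \<alpha> n) \<cdot> lax_left D E (tcod \<alpha>) n) =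
        RUi E (Fp (tdom \<alpha>) m) \<cdot> ((tP \<alpha> m \<cdot> Fc (tcod \<alpha>) g) \<Odot> tA \<alpha> h \<cdot> lax_right D E (tcod \<alpha>) n)"
      using nat[of g] by (auto simp: lact_def ract_def cells_def hom_def proarrow_def)
  next
    fix f x y g z assume "f \<in> hom (D0 D) x y" "g \<in> hom (D0 D) y z"
    then show "tA \<alpha> (f \<bullet>\<^bsub>D\<^esub> g) = LUi E (pid E (Fo (tdom \<alpha>) x)) \<cdot>
        ((tA \<alpha> f \<cdot> Fc (tcod \<alpha>) (cid D g)) \<Odot> (cid E (Fa (tdom \<alpha>) f) \<cdot> tA \<alpha> g) \<cdot> lax_id D E (tcod \<alpha>) z)"
      using Cmp[of f g] by (auto simp: hom_def lact_def lax_id_def)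
  qed (use ext lax unit Idn in \<open>auto simp: hom_def cells_def proarrow_def\<close>)
qed

lemma trans_comp_simps [simp]:
  "tdom (trans_comp D E \<alpha> \<beta>) = tdom \<alpha>"
  "tcod (trans_comp D E \<alpha> \<beta>) = tcod \<beta>"
  "x \<in> Obj (D0 D) \<Longrightarrow> tO (trans_comp D E \<alpha> \<beta>) x = tO \<alpha> x \<bullet> tO \<beta> x"
  "m \<in> Obj (D1 D) \<Longrightarrow> tP (trans_comp D E \<alpha> \<beta>) m = tP \<alpha> m \<cdot> tP \<beta> m"
  by (simp_all add: trans_comp_def Let_def)

lemma trans_comp_tA [simp]:
  "\<lbrakk>lax_transformation D E \<alpha>; lax_transformation D E \<beta>; tcod \<alpha> = tdom \<beta>; f \<in> Arr (D0 D)\<rbrakk>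
    \<Longrightarrow> tA (trans_comp D E \<alpha> \<beta>) f = lact D E (tcod \<beta>) (pid D (Cod (D0 D) f))
      (cid E (tO \<alpha> (Dom (D0 D) f)) \<cdot> tA \<beta> f) (tA \<alpha> f \<cdot> tP \<beta> (pid D (Cod (D0 D) f)))"
  by (simp add: trans_comp_def Let_def lact_def lax_id_def)

lemma trans_id_simps [simp]:
  "tdom (trans_id D E F) = F"
  "tcod (trans_id D E F) = F"
  "x \<in> Obj (D0 D) \<Longrightarrow> tO (trans_id D E F) x = Idn (D0 E) (Fo F x)"
  "m \<in> Obj (D1 D) \<Longrightarrow> tP (trans_id D E F) m = id1 E (Fp F m)"
  "f \<in> Arr (D0 D) \<Longrightarrow> tA (trans_id D E F) f = cid E (Fa F f) \<cdot> unitor F (Cod (D0 D) f)"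
  by (simp_all add: trans_id_def)

lemma trans_comp_extensional:
  "tO (trans_comp D E \<alpha> \<beta>) \<in> extensional (Obj (D0 D))"
  "tP (trans_comp D E \<alpha> \<beta>) \<in> extensional (Obj (D1 D))"
  "tA (trans_comp D E \<alpha> \<beta>) \<in> extensional (Arr (D0 D))"
  by (simp_all add: trans_comp_def Let_def)

lemma unitor_nat:
  "\<lbrakk>lax_double_functor D E G; f \<in> Arr (D0 D)\<rbrakk>
    \<Longrightarrow> unitor G (Dom (D0 D) f) \<cdot> Fc G (cid D f) = cid E (Fa G f) \<cdot> unitor G (Cod (D0 D) f)"
  by (rule lax_double_functor.unitor_natural[symmetric]) (auto simp: hom_def)

lemma trans_id_lax:
  assumes F: "lax_double_functor D E F"
  shows "lax_transformation D E (trans_id D E F)"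
proof (rule lax_transformationI)
  fix f g assume fg: "f \<in> Arr (D0 D)" "g \<in> Arr (D0 D)" "Cod (D0 D) f = Dom (D0 D) g"
  then show "tA (trans_id D E F) (f \<bullet>\<^bsub>D\<^esub> g)
      = lact D E (tcod (trans_id D E F)) (pid D (Cod (D0 D) g))
          (tA (trans_id D E F) f \<cdot> Fc (tcod (trans_id D E F)) (cid D g))
          (cid E (Fa (tdom (trans_id D E F)) f) \<cdot> tA (trans_id D E F) g)"
    \<comment> \<open>The second factor is a unit for the product; in the first, naturality of the
      unitor moves \<open>cid g\<close> in front of it.\<close>
    using F unitor_nat[OF F fg(2)] by simp
qed (use F in \<open>simp_all add: trans_id_def\<close>)

lemma trans_comp_lax:
  assumes ab: "lax_transformation D E \<alpha>" "lax_transformation D E \<beta>" "tcod \<alpha> = tdom \<beta>"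
  shows "lax_transformation D E (trans_comp D E \<alpha> \<beta>)"
proof -
  note [simp] = ab
  define F G H where [simp]: "F = tdom \<alpha>" "G = tdom \<beta>" "H = tcod \<beta>"
  show ?thesis
  proof (rule lax_transformationI)
    fix g assume g [simp]: "g \<in> Arr (D1 D)"
    define f h m n where [simp]: "f = csrc D g" "h = ctgt D g" "m = Dom (D1 D) g" "n = Cod (D1 D) g"
    define x y w z where [simp]: "x = psrc D m" "y = ptgt D m" "w = psrc D n" "z = ptgt D n"
    \<comment> \<open>Naturality of \<alpha>, carried from \<open>G\<close> to \<open>H\<close> by
      the component of \<beta> at \<open>n\<close>.\<close>
    have 1: "lact D E H n (tA \<alpha> f \<cdot> tP \<beta> (pid D w)) (Fc F g \<cdot> (tP \<alpha> n \<cdot> tP \<beta> n))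
        = ract D E H n (tP \<alpha> m \<cdot> (Fc G g \<cdot> tP \<beta> n)) (tA \<alpha> h \<cdot> tP \<beta> (pid D z))"
      using arg_cong[OF trans_nat[OF ab(1) g], of "\<lambda>c. c \<cdot> tP \<beta> n"]
      by (simp add: lact_trans ract_trans)
    \<comment> \<open>Naturality of \<beta>, precomposed with the component of \<alpha> at
      \<open>m\<close>.\<close>
    have 2: "lact D E H n (cid E (tO \<alpha> x) \<cdot> tA \<beta> f) (tP \<alpha> m \<cdot> (Fc G g \<cdot> tP \<beta> n))
        = ract D E H n (tP \<alpha> m \<cdot> (tP \<beta> m \<cdot> Fc H g)) (cid E (tO \<alpha> y) \<cdot> tA \<beta> h)"
      using arg_cong[OF trans_nat[OF ab(2) g], of "\<lambda>c. tP \<alpha> m \<cdot> c"]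
      by (simp add: lact_pre ract_pre)
    show "lact D E (tcod (trans_comp D E \<alpha> \<beta>)) (Cod (D1 D) g) (tA (trans_comp D E \<alpha> \<beta>) (csrc D g))
          (Fc (tdom (trans_comp D E \<alpha> \<beta>)) g \<cdot> tP (trans_comp D E \<alpha> \<beta>) (Cod (D1 D) g))
        = ract D E (tcod (trans_comp D E \<alpha> \<beta>)) (Cod (D1 D) g)
          (tP (trans_comp D E \<alpha> \<beta>) (Dom (D1 D) g) \<cdot> Fc (tcod (trans_comp D E \<alpha> \<beta>)) g)
          (tA (trans_comp D E \<alpha> \<beta>) (ctgt D g))"
      \<comment> \<open>The first equation moves the cell of \<alpha> to the right and the second
        then moves that of \<beta>; commuting the two actions in between makes them fit
        together.\<close>
      using 1 2 by (simp add: lact_lact ract_ract flip: ract_lact)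
  next
    fix m n assume mn: "m \<in> Obj (D1 D)" "n \<in> Obj (D1 D)" "ptgt D m = psrc D n"
    have "laxator F m n \<cdot> (tP \<alpha> (m \<odot>\<^bsub>D\<^esub> n) \<cdot> tP \<beta> (m \<odot>\<^bsub>D\<^esub> n))
        = (laxator F m n \<cdot> tP \<alpha> (m \<odot>\<^bsub>D\<^esub> n)) \<cdot> tP \<beta> (m \<odot>\<^bsub>D\<^esub> n)"
      using mn by simp
    also have "\<dots> = (tP \<alpha> m \<Odot> tP \<alpha> n) \<cdot> (laxator G m n \<cdot> tP \<beta> (m \<odot>\<^bsub>D\<^esub> n))"
      using mn trans_pcmp[OF ab(1) mn] by simp
    also have "\<dots> = (tP \<alpha> m \<Odot> tP \<alpha> n) \<cdot> ((tP \<beta> m \<Odot> tP \<beta> n) \<cdot> laxator H m n)"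
      using mn trans_pcmp[OF ab(2) mn] by simp
    finally show "laxator (tdom (trans_comp D E \<alpha> \<beta>)) m n \<cdot> tP (trans_comp D E \<alpha> \<beta>) (m \<odot>\<^bsub>D\<^esub> n)
        = (tP (trans_comp D E \<alpha> \<beta>) m \<Odot> tP (trans_comp D E \<alpha> \<beta>) n)
          \<cdot> laxator (tcod (trans_comp D E \<alpha> \<beta>)) m n"
      using mn by (simp add: E.ecmp_ccmp_ccmp)
  next
    fix x assume x: "x \<in> Obj (D0 D)"
    have "unitor F x \<cdot> (tP \<alpha> (pid D x) \<cdot> tP \<beta> (pid D x)) = (unitor F x \<cdot> tP \<alpha> (pid D x)) \<cdot> tP \<beta> (pid D x)"
      using x by (simp del: trans_pid)
    also have "\<dots> = cid E (tO \<alpha> x \<bullet> tO \<beta> x) \<cdot> unitor H x"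
      using x by simp
    finally show "unitor (tdom (trans_comp D E \<alpha> \<beta>)) x \<cdot> tP (trans_comp D E \<alpha> \<beta>) (pid D x)
        = cid E (tO (trans_comp D E \<alpha> \<beta>) x) \<cdot> unitor (tcod (trans_comp D E \<alpha> \<beta>)) x"
      using x by simp
  next
    fix f g assume fg: "f \<in> Arr (D0 D)" "g \<in> Arr (D0 D)" "Cod (D0 D) f = Dom (D0 D) g"
    note [simp] = fg
    let ?x = "Dom (D0 D) f" and ?y = "Dom (D0 D) g" and ?z = "Cod (D0 D) g"
    let ?i = "pid D (Dom (D0 D) g)" and ?k = "pid D (Cod (D0 D) g)"
    \<comment> \<open>Naturality of \<beta> at the cell \<open>cid g\<close>, precomposed with
      \<open>tA \<alpha> f\<close>. Expanded at \<open>f\<close> followed by \<open>g\<close>, both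
      sides of the composition axiom are fourfold products with outer factors from
      \<open>tA \<beta> f\<close> and \<open>tA \<alpha> g\<close>; they differ by this exchange of
      the middle pair.\<close>
    have swap: "lact D E H ?k (cid E (tO \<alpha> ?x \<bullet> Fa G f) \<cdot> tA \<beta> g) (tA \<alpha> f \<cdot> (Fc G (cid D g) \<cdot> tP \<beta> ?k))
        = lact D E H ?k (tA \<alpha> f \<cdot> (tP \<beta> ?i \<cdot> Fc H (cid D g))) (cid E (Fa F f \<bullet> tO \<alpha> ?y) \<cdot> tA \<beta> g)"
      using arg_cong[OF trans_nat[OF ab(2), of "cid D g"], of "\<lambda>c. tA \<alpha> f \<cdot> c"]
      by (simp add: lact_pre ract_pre lact_ract_pid)
    have 1: "tA \<beta> (f \<bullet>\<^bsub>D\<^esub> g) = lact D E H ?k (tA \<beta> f \<cdot> Fc H (cid D g)) (cid E (Fa G f) \<cdot> tA \<beta> g)"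
      using trans_Cmp[OF ab(2) fg] by simp
    have 2: "tA \<alpha> (f \<bullet>\<^bsub>D\<^esub> g) = lact D E G ?k (tA \<alpha> f \<cdot> Fc G (cid D g)) (cid E (Fa F f) \<cdot> tA \<alpha> g)"
      using trans_Cmp[OF ab(1) fg] by simp
    show "tA (trans_comp D E \<alpha> \<beta>) (f \<bullet>\<^bsub>D\<^esub> g) = lact D E (tcod (trans_comp D E \<alpha> \<beta>)) ?k
        (tA (trans_comp D E \<alpha> \<beta>) f \<cdot> Fc (tcod (trans_comp D E \<alpha> \<beta>)) (cid D g))
        (cid E (Fa (tdom (trans_comp D E \<alpha> \<beta>)) f) \<cdot> tA (trans_comp D E \<alpha> \<beta>) g)"
      using 1 2 arg_cong[OF swap, of "\<lambda>c. lact D E H ?k c (cid E (Fa F f) \<cdot> (tA \<alpha> g \<cdot> tP \<beta> ?k))"]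
      by (simp add: lact_pre lact_post lact_trans lact_lact)
  qed (use ab trans_comp_extensional in simp_all)
qed

text \<open>Extensionality of the component functions turns agreement on the carriers into equality
  of records.\<close>

lemma trans_eqI:
  fixes \<alpha> \<beta> :: "('o, 'a, 'p, 'c, 'o2, 'a2, 'p2, 'c2) trans"
  assumes "lax_transformation D E \<alpha>" "lax_transformation D E \<beta>"
    "tdom \<alpha> = tdom \<beta>" "tcod \<alpha> = tcod \<beta>"
    "\<And>x. x \<in> Obj (D0 D) \<Longrightarrow> tO \<alpha> x = tO \<beta> x"
    "\<And>m. m \<in> Obj (D1 D) \<Longrightarrow> tP \<alpha> m = tP \<beta> m"
    "\<And>f. f \<in> Arr (D0 D) \<Longrightarrow> tA \<alpha> f = tA \<beta> f"
  shows "\<alpha> = \<beta>"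
proof (rule trans.equality)
  show "tO \<alpha> = tO \<beta>" "tP \<alpha> = tP \<beta>" "tA \<alpha> = tA \<beta>"
    using assms by (auto intro!: extensionalityI lax_transformation.trans_extensional)
qed (use assms in auto)

text \<open>At an arrow, both sides are the threefold product of the cells of \<gamma>, \<beta> and
  \<alpha>, in this order.\<close>

lemma trans_comp_assoc:
  assumes "lax_transformation D E \<alpha>" "lax_transformation D E \<beta>" "lax_transformation D E \<gamma>"
    "tcod \<alpha> = tdom \<beta>" "tcod \<beta> = tdom \<gamma>"
  shows "trans_comp D E (trans_comp D E \<alpha> \<beta>) \<gamma> = trans_comp D E \<alpha> (trans_comp D E \<beta> \<gamma>)"
  by (rule trans_eqI; simp add: assms trans_comp_lax lact_pre lact_trans lact_lact)

lemma trans_comp_id_left: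
  assumes "lax_transformation D E \<alpha>" "tdom \<alpha> = F"
  shows "trans_comp D E (trans_id D E F) \<alpha> = \<alpha>"
proof -
  have [simp]: "lax_double_functor D E F" using trans_functor(1)[OF assms(1)] assms(2) by simp
  show ?thesis by (rule trans_eqI; simp add: assms trans_comp_lax trans_id_lax)
qed

lemma trans_comp_id_right:
  assumes "lax_transformation D E \<alpha>" "tcod \<alpha> = G"
  shows "trans_comp D E \<alpha> (trans_id D E G) = \<alpha>"
proof -
  have [simp]: "lax_double_functor D E G" using trans_functor(2)[OF assms(1)] assms(2) by simp
  show ?thesis by (rule trans_eqI; simp add: assms trans_comp_lax trans_id_lax)
qed

text \<open>Strict naturality makes both arrow components units, and a product of units is again a
  unit. Applied at projections, this keeps composites cartesian.\<close>

lemma strictly_natural_at_comp: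
  assumes ab: "lax_transformation D E \<alpha>" "lax_transformation D E \<beta>" "tcod \<alpha> = tdom \<beta>"
    and f: "f \<in> Arr (D0 D)"
    and st: "strictly_natural_at D E \<alpha> f" "strictly_natural_at D E \<beta> f"
  shows "strictly_natural_at D E (trans_comp D E \<alpha> \<beta>) f"
proof -
  let ?x = "Dom (D0 D) f" and ?y = "Cod (D0 D) f"
  note [simp] = ab f
  have 1: "tO \<alpha> ?x \<bullet> Fa (tdom \<beta>) f = Fa (tdom \<alpha>) f \<bullet> tO \<alpha> ?y"
    "tO \<beta> ?x \<bullet> Fa (tcod \<beta>) f = Fa (tdom \<beta>) f \<bullet> tO \<beta> ?y"
    "tA \<alpha> f = cid E (Fa (tdom \<alpha>) f \<bullet> tO \<alpha> ?y) \<cdot> unitor (tcod \<alpha>) ?y"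
    "tA \<beta> f = cid E (Fa (tdom \<beta>) f \<bullet> tO \<beta> ?y) \<cdot> unitor (tcod \<beta>) ?y"
    using st by (simp_all add: strictly_natural_at_def Let_def)
  have "tO \<alpha> ?x \<bullet> (Fa (tdom \<beta>) f \<bullet> tO \<beta> ?y) = (tO \<alpha> ?x \<bullet> Fa (tdom \<beta>) f) \<bullet> tO \<beta> ?y" by simp
  also have "\<dots> = Fa (tdom \<alpha>) f \<bullet> (tO \<alpha> ?y \<bullet> tO \<beta> ?y)" unfolding 1(1) by simp
  finally have 2: "tO \<alpha> ?x \<bullet> (Fa (tdom \<beta>) f \<bullet> tO \<beta> ?y) = Fa (tdom \<alpha>) f \<bullet> (tO \<alpha> ?y \<bullet> tO \<beta> ?y)" .
  show ?thesis by (simp add: strictly_natural_at_def Let_def 1 2)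
qed

lemma strictly_natural_at_id:
  assumes "lax_double_functor D E F" "f \<in> Arr (D0 D)"
  shows "strictly_natural_at D E (trans_id D E F) f"
  using assms by (simp add: strictly_natural_at_def Let_def)

section \<open>Modulations\<close>

lemma mod_trans [simp]:
  assumes "modulation D E \<mu>"
  shows "lax_transformation D E (mdom \<mu>)" "lax_transformation D E (mcod \<mu>)"
    "tdom (mcod \<mu>) = tdom (mdom \<mu>)" "tcod (mcod \<mu>) = tcod (mdom \<mu>)"
  using modulation.mdom_trans[OF assms] modulation.mcod_trans[OF assms]
    modulation.parallel[OF assms] by auto

lemma mO_typing [simp]:
  assumes "modulation D E \<mu>" "x \<in> Obj (D0 D)"
  shows "mO \<mu> x \<in> Arr (D1 E)"
    "Dom (D1 E) (mO \<mu> x) = pid E (Fo (tdom (mdom \<mu>)) x)"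
    "Cod (D1 E) (mO \<mu> x) = Fp (tcod (mdom \<mu>)) (pid D x)"
    "csrc E (mO \<mu> x) = tO (mdom \<mu>) x" "ctgt E (mO \<mu> x) = tO (mcod \<mu>) x"
  using modulation.mO_cell[OF assms] by (auto simp: hom_def cells_def)

lemma mP_eq_lact:
  assumes "modulation D E \<mu>" "m \<in> Obj (D1 D)"
  shows "mP D E \<mu> m = lact D E (tcod (mdom \<mu>)) m (mO \<mu> (psrc D m)) (tP (mcod \<mu>) m)"
  using assms by (simp add: mP_def lact_def)

lemma mP_eq_ract:
  assumes "modulation D E \<mu>" "m \<in> Obj (D1 D)"
  shows "mP D E \<mu> m = ract D E (tcod (mdom \<mu>)) m (tP (mdom \<mu>) m) (mO \<mu> (ptgt D m))"
  using assms modulation.mod_proarrow[OF assms(1), of m "psrc D m" "ptgt D m"]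
  by (simp add: mP_def ract_def proarrow_def)

lemma mP_typing [simp]:
  assumes "modulation D E \<mu>" "m \<in> Obj (D1 D)"
  shows "mP D E \<mu> m \<in> Arr (D1 E)"
    "Dom (D1 E) (mP D E \<mu> m) = Fp (tdom (mdom \<mu>)) m"
    "Cod (D1 E) (mP D E \<mu> m) = Fp (tcod (mdom \<mu>)) m"
    "csrc E (mP D E \<mu> m) = tO (mdom \<mu>) (psrc D m)" "ctgt E (mP D E \<mu> m) = tO (mcod \<mu>) (ptgt D m)"
  using assms by (simp_all add: mP_eq_lact)

lemma mod_nat:
  assumes "modulation D E \<mu>" "g \<in> Arr (D1 D)"
  shows "lact D E (tcod (mdom \<mu>)) (Cod (D1 D) g) (tA (mdom \<mu>) (csrc D g))
      (Fc (tdom (mdom \<mu>)) g \<cdot> mP D E \<mu> (Cod (D1 D) g))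
    = ract D E (tcod (mdom \<mu>)) (Cod (D1 D) g)
      (mP D E \<mu> (Dom (D1 D) g) \<cdot> Fc (tcod (mdom \<mu>)) g) (tA (mcod \<mu>) (ctgt D g))"
  using modulation.mod_natural[OF assms(1), of "Dom (D1 D) g" "psrc D (Dom (D1 D) g)"
      "ptgt D (Dom (D1 D) g)" "Cod (D1 D) g" "psrc D (Cod (D1 D) g)" "ptgt D (Cod (D1 D) g)" g] assms
  by (simp add: lact_def ract_def proarrow_def cells_def hom_def)

text \<open>Recovers the component at \<open>x\<close> from the induced cell at
  \<open>pid x\<close>: precomposition turns the factor \<open>tP (mcod \<mu>) (pid x)\<close> into
  a unit.\<close>

lemma unitor_mP [simp]:
  assumes "modulation D E \<mu>" "x \<in> Obj (D0 D)" "tdom (mdom \<mu>) = F"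
  shows "unitor F x \<cdot> mP D E \<mu> (pid D x) = mO \<mu> x"
proof -
  have "lax_double_functor D E F" using trans_functor(1)[OF mod_trans(1)[OF assms(1)]] assms(3) by simp
  then show ?thesis using assms by (simp add: mP_eq_lact lact_pre)
qed

lemma unitor_mP_ccmp [simp]:
  assumes "modulation D E \<mu>" "x \<in> Obj (D0 D)" "tdom (mdom \<mu>) = F"
    "a \<in> Arr (D1 E)" "Dom (D1 E) a = Fp (tcod (mdom \<mu>)) (pid D x)"
  shows "unitor F x \<cdot> (mP D E \<mu> (pid D x) \<cdot> a) = mO \<mu> x \<cdot> a"
proof -
  have "lax_double_functor D E F" using trans_functor(1)[OF mod_trans(1)[OF assms(1)]] assms(3) by simp
  then show ?thesis
    using E.C1.arr_algebra(3)[of "unitor F x" "mP D E \<mu> (pid D x)" a] assms by simp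
qed

text \<open>Naturality of \<open>\<mu>\<close> at the cell \<open>id\<^sub>f\<close>, precomposed with the unitor of the source functor.\<close>

lemma mod_swap:
  assumes m: "modulation D E \<mu>" and f: "f \<in> Arr (D0 D)"
  shows "lact D E (tcod (mdom \<mu>)) (pid D (Cod (D0 D) f)) (tA (mdom \<mu>) f)
      (cid E (Fa (tdom (mdom \<mu>)) f) \<cdot> mO \<mu> (Cod (D0 D) f))
    = lact D E (tcod (mdom \<mu>)) (pid D (Cod (D0 D) f))
      (mO \<mu> (Dom (D0 D) f) \<cdot> Fc (tcod (mdom \<mu>)) (cid D f)) (tA (mcod \<mu>) f)"
proof -
  note [simp] = m f
  let ?F = "tdom (mdom \<mu>)" and ?x = "Dom (D0 D) f" and ?y = "Cod (D0 D) f"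
  have "unitor ?F ?x \<cdot> (Fc ?F (cid D f) \<cdot> mP D E \<mu> (pid D ?y))
      = (unitor ?F ?x \<cdot> Fc ?F (cid D f)) \<cdot> mP D E \<mu> (pid D ?y)"
    by simp
  also have "\<dots> = cid E (Fa ?F f) \<cdot> mO \<mu> ?y"
    by (subst unitor_nat) simp_all
  finally have 1: "unitor ?F ?x \<cdot> (Fc ?F (cid D f) \<cdot> mP D E \<mu> (pid D ?y)) = cid E (Fa ?F f) \<cdot> mO \<mu> ?y" .
  show ?thesis
    using arg_cong[OF mod_nat[OF m, of "cid D f"], of "\<lambda>c. unitor ?F ?x \<cdot> c"]
    by (simp add: lact_pre ract_pre lact_ract_pid 1)
qed

text \<open>\<open>M\<close> is a candidate for the induced cell, given in whatever form suits the
  example; the two sides of the proarrow axiom are each compared with it.\<close>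

lemma modulationI:
  assumes T: "lax_transformation D E (mdom \<mu>)" "lax_transformation D E (mcod \<mu>)"
    "tdom (mcod \<mu>) = tdom (mdom \<mu>)" "tcod (mcod \<mu>) = tcod (mdom \<mu>)"
    and O: "\<And>x. x \<in> Obj (D0 D) \<Longrightarrow> mO \<mu> x \<in> Arr (D1 E)
      \<and> Dom (D1 E) (mO \<mu> x) = pid E (Fo (tdom (mdom \<mu>)) x)
      \<and> Cod (D1 E) (mO \<mu> x) = Fp (tcod (mdom \<mu>)) (pid D x)
      \<and> csrc E (mO \<mu> x) = tO (mdom \<mu>) x \<and> ctgt E (mO \<mu> x) = tO (mcod \<mu>) x"
    and left: "\<And>m. m \<in> Obj (D1 D) \<Longrightarrow>
      lact D E (tcod (mdom \<mu>)) m (mO \<mu> (psrc D m)) (tP (mcod \<mu>) m) = M m"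
    and right: "\<And>m. m \<in> Obj (D1 D) \<Longrightarrow>
      ract D E (tcod (mdom \<mu>)) m (tP (mdom \<mu>) m) (mO \<mu> (ptgt D m)) = M m"
    and nat: "\<And>g. g \<in> Arr (D1 D) \<Longrightarrow>
      lact D E (tcod (mdom \<mu>)) (Cod (D1 D) g) (tA (mdom \<mu>) (csrc D g))
        (Fc (tdom (mdom \<mu>)) g \<cdot> M (Cod (D1 D) g))
      = ract D E (tcod (mdom \<mu>)) (Cod (D1 D) g)
        (M (Dom (D1 D) g) \<cdot> Fc (tcod (mdom \<mu>)) g) (tA (mcod \<mu>) (ctgt D g))"
    and ext: "mO \<mu> \<in> extensional (Obj (D0 D))"
  shows "modulation D E \<mu>"
proof -
  note [simp] = T O
  have M: "mP D E \<mu> m = M m" if "m \<in> Obj (D1 D)" for m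
    using left[OF that] that by (simp add: mP_def lact_def)
  have M_typing: "M m \<in> Arr (D1 E)" "Dom (D1 E) (M m) = Fp (tdom (mdom \<mu>)) m"
    "Cod (D1 E) (M m) = Fp (tcod (mdom \<mu>)) m" if "m \<in> Obj (D1 D)" for m
    using that by (simp_all flip: left)
  show ?thesis
  proof (rule modulation.intro)
    fix m x y assume "proarrow D m x y"
    then show "LUi E (Fp (tdom (mdom \<mu>)) m) \<cdot> (mO \<mu> x \<Odot> tP (mcod \<mu>) m \<cdot> lax_left D E (tcod (mdom \<mu>)) m)
        = RUi E (Fp (tdom (mdom \<mu>)) m) \<cdot> (tP (mdom \<mu>) m \<Odot> mO \<mu> y \<cdot> lax_right D E (tcod (mdom \<mu>)) m)"
      using left[of m] right[of m] by (auto simp: lact_def ract_def proarrow_def)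
  next
    fix m x y n w z g f h
    assume mn: "proarrow D m x y" "proarrow D n w z" and g: "g \<in> cells D m n f h"
    then show "LUi E (Fp (tdom (mdom \<mu>)) m) \<cdot>
          (tA (mdom \<mu>) f \<Odot> (Fc (tdom (mdom \<mu>)) g \<cdot> mP D E \<mu> n) \<cdot> lax_left D E (tcod (mdom \<mu>)) n) =
        RUi E (Fp (tdom (mdom \<mu>)) m) \<cdot>
          ((mP D E \<mu> m \<cdot> Fc (tcod (mdom \<mu>)) g) \<Odot> tA (mcod \<mu>) h \<cdot> lax_right D E (tcod (mdom \<mu>)) n)"
      using nat[of g] M_typing by (auto simp: M lact_def ract_def cells_def hom_def proarrow_def)
  qed (use ext in \<open>auto simp: hom_def cells_def proarrow_def\<close>)
qed

section \<open>Vertical and horizontal composites of modulations\<close>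

lemma mod_id_simps [simp]:
  "mdom (mod_id D E \<alpha>) = \<alpha>" "mcod (mod_id D E \<alpha>) = \<alpha>"
  "x \<in> Obj (D0 D) \<Longrightarrow> mO (mod_id D E \<alpha>) x = cid E (tO \<alpha> x) \<cdot> unitor (tcod \<alpha>) x"
  by (simp_all add: mod_id_def)

lemma mod_comp_simps [simp]:
  "mdom (mod_comp D E \<mu> \<nu>) = mdom \<mu>" "mcod (mod_comp D E \<mu> \<nu>) = mcod \<nu>"
  by (simp_all add: mod_comp_def)

lemma mod_comp_mO [simp]:
  "\<lbrakk>modulation D E \<nu>; mdom \<nu> = mcod \<mu>; modulation D E \<mu>; x \<in> Obj (D0 D)\<rbrakk>
    \<Longrightarrow> mO (mod_comp D E \<mu> \<nu>) x = lact D E (tcod (mdom \<mu>)) (pid D x) (mO \<mu> x) (mO \<nu> x)"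
  by (simp add: mod_comp_def lact_def lax_id_def)

lemma mod_hcomp_simps [simp]:
  "mdom (mod_hcomp D E \<mu> \<nu>) = trans_comp D E (mdom \<mu>) (mdom \<nu>)"
  "mcod (mod_hcomp D E \<mu> \<nu>) = trans_comp D E (mcod \<mu>) (mcod \<nu>)"
  "x \<in> Obj (D0 D) \<Longrightarrow> mO (mod_hcomp D E \<mu> \<nu>) x = mO \<mu> x \<cdot> mP D E \<nu> (pid D x)"
  by (simp_all add: mod_hcomp_def)

lemma mod_id_modulation:
  assumes "lax_transformation D E \<alpha>"
  shows "modulation D E (mod_id D E \<alpha>)"
  by (rule modulationI[where M = "tP \<alpha>"]) (use assms trans_nat[OF assms] in \<open>simp_all add: mod_id_def\<close>)

lemma mP_mod_id [simp]:
  assumes "lax_transformation D E \<alpha>" "m \<in> Obj (D1 D)"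
  shows "mP D E (mod_id D E \<alpha>) m = tP \<alpha> m"
  using assms by (simp add: mP_eq_lact mod_id_modulation)

lemma mod_comp_modulation:
  assumes mn: "modulation D E \<mu>" "modulation D E \<nu>" "mdom \<nu> = mcod \<mu>"
  shows "modulation D E (mod_comp D E \<mu> \<nu>)"
proof -
  define F G where [simp]: "F = tdom (mdom \<mu>)" "G = tcod (mdom \<mu>)"
  note [simp] = mn
  show ?thesis
  proof (rule modulationI[where M = "\<lambda>m. lact D E G m (mO \<mu> (psrc D m)) (mP D E \<nu> m)"])
    fix m assume [simp]: "m \<in> Obj (D1 D)"
    show "lact D E (tcod (mdom (mod_comp D E \<mu> \<nu>))) m (mO (mod_comp D E \<mu> \<nu>) (psrc D m))
        (tP (mcod (mod_comp D E \<mu> \<nu>)) m) = lact D E G m (mO \<mu> (psrc D m)) (mP D E \<nu> m)"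
      by (simp add: mP_eq_lact lact_lact)
    \<comment> \<open>The right form is converted to the left one by applying the proarrow axiom
      first for \<mu>, then for \<nu>, with the commutation of the actions between them.\<close>
    have "ract D E G m (tP (mdom \<mu>) m) (lact D E G (pid D (ptgt D m)) (mO \<mu> (ptgt D m)) (mO \<nu> (ptgt D m)))
        = ract D E G m (mP D E \<mu> m) (mO \<nu> (ptgt D m))"
      by (simp add: mP_eq_ract ract_ract)
    also have "\<dots> = lact D E G m (mO \<mu> (psrc D m)) (ract D E G m (tP (mcod \<mu>) m) (mO \<nu> (ptgt D m)))"
      by (simp add: mP_eq_lact ract_lact)
    also have "\<dots> = lact D E G m (mO \<mu> (psrc D m)) (mP D E \<nu> m)"
      by (simp add: mP_eq_ract)
    finally show "ract D E (tcod (mdom (mod_comp D E \<mu> \<nu>))) m (tP (mdom (mod_comp D E \<mu> \<nu>)) m)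
        (mO (mod_comp D E \<mu> \<nu>) (ptgt D m)) = lact D E G m (mO \<mu> (psrc D m)) (mP D E \<nu> m)"
      by simp
  next
    fix g assume [simp]: "g \<in> Arr (D1 D)"
    define f h m n where [simp]: "f = csrc D g" "h = ctgt D g" "m = Dom (D1 D) g" "n = Cod (D1 D) g"
    define x w where [simp]: "x = psrc D m" "w = psrc D n"
    have swap: "lact D E G (pid D w) (tA (mdom \<mu>) f) (cid E (Fa F f) \<cdot> mO \<mu> w)
        = lact D E G (pid D w) (mO \<mu> x \<cdot> Fc G (cid D f)) (tA (mcod \<mu>) f)"
      using mod_swap[of \<mu> f] by simp
    have nat: "lact D E G n (tA (mcod \<mu>) f) (Fc F g \<cdot> mP D E \<nu> n)
        = ract D E G n (mP D E \<nu> m \<cdot> Fc G g) (tA (mcod \<nu>) h)"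
      using mod_nat[of \<nu> g] by simp
    have "lact D E G n (tA (mdom \<mu>) f) (Fc F g \<cdot> lact D E G n (mO \<mu> w) (mP D E \<nu> n))
        = lact D E G n (lact D E G (pid D w) (tA (mdom \<mu>) f) (cid E (Fa F f) \<cdot> mO \<mu> w)) (Fc F g \<cdot> mP D E \<nu> n)"
      by (simp add: lact_pre lact_lact)
    \<comment> \<open>After the exchange the arrow component belongs to the middle transformation,
      which is where naturality of \<nu> starts.\<close>
    also have "\<dots> = lact D E G n (mO \<mu> x \<cdot> Fc G (cid D f)) (lact D E G n (tA (mcod \<mu>) f) (Fc F g \<cdot> mP D E \<nu> n))"
      unfolding swap by (simp add: lact_lact)
    also have "\<dots> = ract D E G n (lact D E G m (mO \<mu> x) (mP D E \<nu> m) \<cdot> Fc G g) (tA (mcod \<nu>) h)"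
      unfolding nat by (simp add: lact_post ract_lact)
    finally show "lact D E (tcod (mdom (mod_comp D E \<mu> \<nu>))) (Cod (D1 D) g)
        (tA (mdom (mod_comp D E \<mu> \<nu>)) (csrc D g))
        (Fc (tdom (mdom (mod_comp D E \<mu> \<nu>))) g
          \<cdot> lact D E G (Cod (D1 D) g) (mO \<mu> (psrc D (Cod (D1 D) g))) (mP D E \<nu> (Cod (D1 D) g)))
      = ract D E (tcod (mdom (mod_comp D E \<mu> \<nu>))) (Cod (D1 D) g)
        (lact D E G (Dom (D1 D) g) (mO \<mu> (psrc D (Dom (D1 D) g))) (mP D E \<nu> (Dom (D1 D) g))
          \<cdot> Fc (tcod (mdom (mod_comp D E \<mu> \<nu>))) g)
        (tA (mcod (mod_comp D E \<mu> \<nu>)) (ctgt D g))"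
      by simp
  next
    show "mO (mod_comp D E \<mu> \<nu>) \<in> extensional (Obj (D0 D))" by (simp add: mod_comp_def)
  qed simp_all
qed

lemma mP_mod_comp:
  assumes "modulation D E \<mu>" "modulation D E \<nu>" "mdom \<nu> = mcod \<mu>" "m \<in> Obj (D1 D)"
  shows "mP D E (mod_comp D E \<mu> \<nu>) m = lact D E (tcod (mdom \<mu>)) m (mO \<mu> (psrc D m)) (mP D E \<nu> m)"
  using assms by (simp add: mP_eq_lact mod_comp_modulation lact_lact)

text \<open>Writing \<open>mP \<nu>\<close> in its left form, at \<open>pid\<close> on one side and
  at \<open>m\<close> on the other, makes both sides successive left actions of the same
  cells.\<close>

lemma mod_hcomp_lact:
  assumes "modulation D E \<mu>" "modulation D E \<nu>" "tcod (mdom \<mu>) = tdom (mdom \<nu>)" "m \<in> Obj (D1 D)"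
  shows "lact D E (tcod (mdom \<nu>)) m (mO \<mu> (psrc D m) \<cdot> mP D E \<nu> (pid D (psrc D m)))
      (tP (mcod \<mu>) m \<cdot> tP (mcod \<nu>) m) = mP D E \<mu> m \<cdot> mP D E \<nu> m"
  using assms by (simp add: mP_eq_lact lact_pre lact_trans lact_lact)

text \<open>The same computation with the right form of \<open>mP \<nu>\<close>. Both forms yield
  the same composite, as the proarrow axiom requires.\<close>

lemma mod_hcomp_ract:
  assumes "modulation D E \<mu>" "modulation D E \<nu>" "tcod (mdom \<mu>) = tdom (mdom \<nu>)" "m \<in> Obj (D1 D)"
  shows "ract D E (tcod (mdom \<nu>)) m (tP (mdom \<mu>) m \<cdot> tP (mdom \<nu>) m)
      (mO \<mu> (ptgt D m) \<cdot> mP D E \<nu> (pid D (ptgt D m))) = mP D E \<mu> m \<cdot> mP D E \<nu> m"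
  using assms by (simp add: mP_eq_ract ract_pre ract_trans ract_ract lact_ract_pid)

lemma mod_hcomp_modulation:
  assumes mn: "modulation D E \<mu>" "modulation D E \<nu>" "tcod (mdom \<mu>) = tdom (mdom \<nu>)"
  shows "modulation D E (mod_hcomp D E \<mu> \<nu>)"
proof -
  define \<alpha> \<beta> \<alpha>' \<beta>' where t [simp]: "\<alpha> = mdom \<mu>" "\<beta> = mcod \<mu>" "\<alpha>' = mdom \<nu>" "\<beta>' = mcod \<nu>"
  define F G H where [simp]: "F = tdom (mdom \<mu>)" "G = tdom (mdom \<nu>)" "H = tcod (mdom \<nu>)"
  note [simp] = mn trans_comp_lax
  show ?thesis
  proof (rule modulationI[where M = "\<lambda>m. mP D E \<mu> m \<cdot> mP D E \<nu> m"])
    fix m assume [simp]: "m \<in> Obj (D1 D)"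
    show "lact D E (tcod (mdom (mod_hcomp D E \<mu> \<nu>))) m (mO (mod_hcomp D E \<mu> \<nu>) (psrc D m))
        (tP (mcod (mod_hcomp D E \<mu> \<nu>)) m) = mP D E \<mu> m \<cdot> mP D E \<nu> m"
      by (simp add: mod_hcomp_lact)
    show "ract D E (tcod (mdom (mod_hcomp D E \<mu> \<nu>))) m (tP (mdom (mod_hcomp D E \<mu> \<nu>)) m)
        (mO (mod_hcomp D E \<mu> \<nu>) (ptgt D m)) = mP D E \<mu> m \<cdot> mP D E \<nu> m"
      by (simp add: mod_hcomp_ract)
  next
    fix g assume [simp]: "g \<in> Arr (D1 D)"
    define f h m n where [simp]: "f = csrc D g" "h = ctgt D g" "m = Dom (D1 D) g" "n = Cod (D1 D) g"
    define x y w z where [simp]: "x = psrc D m" "y = ptgt D m" "w = psrc D n" "z = ptgt D n"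
    \<comment> \<open>Naturality of \<mu>, carried to \<open>H\<close> by the source transformation
      of \<nu>; the cell of \<nu> is split off on the right before this is used.\<close>
    have nat: "lact D E H n (tA \<alpha> f \<cdot> tP \<alpha>' (pid D w)) (Fc F g \<cdot> (mP D E \<mu> n \<cdot> tP \<alpha>' n))
        = ract D E H n (mP D E \<mu> m \<cdot> (Fc G g \<cdot> tP \<alpha>' n)) (tA \<beta> h \<cdot> tP \<alpha>' (pid D z))"
      using arg_cong[OF mod_nat[of \<mu> g], of "\<lambda>c. c \<cdot> tP \<alpha>' n"]
      by (simp add: lact_trans ract_trans)
    \<comment> \<open>The proarrow axiom of \<nu> at \<open>pid z\<close>, precomposed with
      \<open>tA \<beta> h\<close>. It moves \<open>mO \<nu> z\<close> past that cell and replaces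
      \<open>\<alpha>'\<close> by \<open>\<beta>'\<close>.\<close>
    have swap: "lact D E H (pid D z) (tA \<beta> h \<cdot> tP \<alpha>' (pid D z)) (cid E (Fa F h \<bullet> tO \<beta> z) \<cdot> mO \<nu> z)
        = lact D E H (pid D z) (cid E (tO \<beta> y \<bullet> Fa G h) \<cdot> mO \<nu> z) (tA \<beta> h \<cdot> tP \<beta>' (pid D z))"
      using arg_cong[OF trans[OF sym[OF mP_eq_ract[of \<nu> "pid D z"]] mP_eq_lact[of \<nu> "pid D z"]],
          of "\<lambda>c. tA \<beta> h \<cdot> c"]
      by (simp add: lact_pre ract_pre lact_ract_pid)
    have "lact D E H n (tA \<alpha> f \<cdot> tP \<alpha>' (pid D w)) (Fc F g \<cdot> (mP D E \<mu> n \<cdot> mP D E \<nu> n))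
        = ract D E H n (lact D E H n (tA \<alpha> f \<cdot> tP \<alpha>' (pid D w)) (Fc F g \<cdot> (mP D E \<mu> n \<cdot> tP \<alpha>' n)))
            (cid E (Fa F h \<bullet> tO \<beta> z) \<cdot> mO \<nu> z)"
      by (simp add: mP_eq_ract[of \<nu>] ract_pre ract_lact)
    also have "\<dots> = ract D E H n (mP D E \<mu> m \<cdot> (Fc G g \<cdot> tP \<alpha>' n))
        (lact D E H (pid D z) (tA \<beta> h \<cdot> tP \<alpha>' (pid D z)) (cid E (Fa F h \<bullet> tO \<beta> z) \<cdot> mO \<nu> z))"
      unfolding nat by (simp add: ract_ract)
    also have "\<dots> = ract D E H n (ract D E H n (mP D E \<mu> m \<cdot> (Fc G g \<cdot> tP \<alpha>' n))
        (cid E (tO \<beta> y \<bullet> Fa G h) \<cdot> mO \<nu> z)) (tA \<beta> h \<cdot> tP \<beta>' (pid D z))"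
      unfolding swap by (simp add: ract_ract)
    also have "\<dots> = ract D E H n (mP D E \<mu> m \<cdot> (Fc G g \<cdot> mP D E \<nu> n)) (tA \<beta> h \<cdot> tP \<beta>' (pid D z))"
      by (simp add: mP_eq_ract[of \<nu>] ract_pre)
    finally show "lact D E (tcod (mdom (mod_hcomp D E \<mu> \<nu>))) (Cod (D1 D) g)
        (tA (mdom (mod_hcomp D E \<mu> \<nu>)) (csrc D g))
        (Fc (tdom (mdom (mod_hcomp D E \<mu> \<nu>))) g \<cdot> (mP D E \<mu> (Cod (D1 D) g) \<cdot> mP D E \<nu> (Cod (D1 D) g)))
      = ract D E (tcod (mdom (mod_hcomp D E \<mu> \<nu>))) (Cod (D1 D) g)
        ((mP D E \<mu> (Dom (D1 D) g) \<cdot> mP D E \<nu> (Dom (D1 D) g)) \<cdot> Fc (tcod (mdom (mod_hcomp D E \<mu> \<nu>))) g)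
        (tA (mcod (mod_hcomp D E \<mu> \<nu>)) (ctgt D g))"
      \<comment> \<open>The remaining factor \<open>tA \<alpha>' f\<close> on the left is moved to
        the right by naturality of \<nu>, precomposed with the induced cell of \<mu>.\<close>
      using arg_cong[OF mod_nat[of \<nu> g], of "\<lambda>c. mP D E \<mu> m \<cdot> c"]
      by (simp add: lact_pre ract_pre lact_lact ract_ract flip: ract_lact)
  next
    show "mO (mod_hcomp D E \<mu> \<nu>) \<in> extensional (Obj (D0 D))" by (simp add: mod_hcomp_def)
  qed simp_all
qed

lemma mP_mod_hcomp:
  assumes "modulation D E \<mu>" "modulation D E \<nu>" "tcod (mdom \<mu>) = tdom (mdom \<nu>)" "m \<in> Obj (D1 D)"
  shows "mP D E (mod_hcomp D E \<mu> \<nu>) m = mP D E \<mu> m \<cdot> mP D E \<nu> m"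
  using assms by (simp add: mP_eq_lact[OF mod_hcomp_modulation] mod_hcomp_lact)

section \<open>Equational laws for modulations\<close>

lemma mod_eqI:
  fixes \<mu> \<nu> :: "('o, 'a, 'p, 'c, 'o2, 'a2, 'p2, 'c2) modul"
  assumes "modulation D E \<mu>" "modulation D E \<nu>" "mdom \<mu> = mdom \<nu>" "mcod \<mu> = mcod \<nu>"
    "\<And>x. x \<in> Obj (D0 D) \<Longrightarrow> mO \<mu> x = mO \<nu> x"
  shows "\<mu> = \<nu>"
proof (rule modul.equality)
  show "mO \<mu> = mO \<nu>"
    using assms by (auto intro!: extensionalityI modulation.mod_extensional)
qed (use assms in auto)

lemma mod_comp_assoc:
  assumes "modulation D E \<mu>" "modulation D E \<nu>" "modulation D E \<rho>"
    "mdom \<nu> = mcod \<mu>" "mdom \<rho> = mcod \<nu>"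
  shows "mod_comp D E (mod_comp D E \<mu> \<nu>) \<rho> = mod_comp D E \<mu> (mod_comp D E \<nu> \<rho>)"
  by (rule mod_eqI; simp add: assms mod_comp_modulation lact_lact)

lemma mod_comp_id_left:
  assumes "modulation D E \<mu>" "mdom \<mu> = \<alpha>"
  shows "mod_comp D E (mod_id D E \<alpha>) \<mu> = \<mu>"
proof -
  have [simp]: "lax_transformation D E \<alpha>" using mod_trans(1)[OF assms(1)] assms(2) by simp
  show ?thesis by (rule mod_eqI; simp add: assms mod_comp_modulation mod_id_modulation)
qed

lemma mod_comp_id_right:
  assumes "modulation D E \<mu>" "mcod \<mu> = \<beta>"
  shows "mod_comp D E \<mu> (mod_id D E \<beta>) = \<mu>"
proof -
  have [simp]: "lax_transformation D E \<beta>" "tcod \<beta> = tcod (mdom \<mu>)"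
    using mod_trans[OF assms(1)] assms(2) by simp_all
  show ?thesis by (rule mod_eqI; simp add: assms mod_comp_modulation mod_id_modulation)
qed

lemma mod_hcomp_id:
  assumes "lax_transformation D E \<alpha>" "lax_transformation D E \<beta>" "tcod \<alpha> = tdom \<beta>"
  shows "mod_hcomp D E (mod_id D E \<alpha>) (mod_id D E \<beta>) = mod_id D E (trans_comp D E \<alpha> \<beta>)"
  by (rule mod_eqI; simp add: assms mod_hcomp_modulation mod_id_modulation trans_comp_lax)

lemma mod_interchange:
  assumes mods: "modulation D E \<mu>" "modulation D E \<mu>'" "modulation D E \<nu>" "modulation D E \<nu>'"
    and eqs: "mdom \<mu>' = mcod \<mu>" "mdom \<nu>' = mcod \<nu>" "tcod (mdom \<mu>) = tdom (mdom \<nu>)"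
  shows "mod_hcomp D E (mod_comp D E \<mu> \<mu>') (mod_comp D E \<nu> \<nu>')
    = mod_comp D E (mod_hcomp D E \<mu> \<nu>) (mod_hcomp D E \<mu>' \<nu>')"
proof (rule mod_eqI)
  note [simp] = mods eqs mod_comp_modulation mod_hcomp_modulation
  fix x assume [simp]: "x \<in> Obj (D0 D)"
  show "mO (mod_hcomp D E (mod_comp D E \<mu> \<mu>') (mod_comp D E \<nu> \<nu>')) x
      = mO (mod_comp D E (mod_hcomp D E \<mu> \<nu>) (mod_hcomp D E \<mu>' \<nu>')) x"
    \<comment> \<open>Expanding \<nu> on the left and \<open>\<nu>'\<close> on the right leaves
      their common transformation \<open>mcod \<nu>\<close> behind \<mu> and \<open>\<mu>'\<close>
      alike, so both sides become the same fourfold product.\<close>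
    by (simp add: mP_mod_comp mP_eq_lact[of \<nu>] mP_eq_ract[of \<nu>'] lact_pre ract_pre lact_trans
        lact_lact lact_ract_pid)
qed (simp_all add: mods eqs mod_comp_modulation mod_hcomp_modulation)

text \<open>Since \<open>mP_mod_hcomp\<close> makes induced cells compose by plain composition, this
  reduces to associativity in \<open>D1 E\<close>.\<close>

lemma mod_hcomp_assoc:
  assumes "modulation D E \<mu>" "modulation D E \<nu>" "modulation D E \<rho>"
    "tcod (mdom \<mu>) = tdom (mdom \<nu>)" "tcod (mdom \<nu>) = tdom (mdom \<rho>)"
  shows "mod_hcomp D E (mod_hcomp D E \<mu> \<nu>) \<rho> = mod_hcomp D E \<mu> (mod_hcomp D E \<nu> \<rho>)"
  by (rule mod_eqI; simp add: assms mod_hcomp_modulation mP_mod_hcomp trans_comp_assoc)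

text \<open>The component at \<open>x\<close> is the unitor of \<open>F\<close> followed by the
  induced cell of \<mu> at \<open>pid x\<close>, which \<open>unitor_mP\<close> evaluates.\<close>

lemma mod_hcomp_id_left:
  assumes "modulation D E \<mu>" "tdom (mdom \<mu>) = F"
  shows "mod_hcomp D E (mod_id D E (trans_id D E F)) \<mu> = \<mu>"
proof -
  have [simp]: "lax_double_functor D E F"
    using trans_functor(1)[OF mod_trans(1)[OF assms(1)]] assms(2) by simp
  show ?thesis
    by (rule mod_eqI; simp add: assms mod_hcomp_modulation mod_id_modulation trans_id_lax trans_comp_id_left)
qed

lemma mod_hcomp_id_right:
  assumes "modulation D E \<mu>" "tcod (mdom \<mu>) = G"
  shows "mod_hcomp D E \<mu> (mod_id D E (trans_id D E G)) = \<mu>"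
proof -
  have [simp]: "lax_double_functor D E G"
    using trans_functor(2)[OF mod_trans(1)[OF assms(1)]] assms(2) by simp
  show ?thesis
    by (rule mod_eqI; simp add: assms mod_hcomp_modulation mod_id_modulation trans_id_lax trans_comp_id_right)
qed

end

section \<open>Assembly of the 2-category\<close>

lemma (in cartesian_double_category) prj_Arr:
  assumes "x \<in> Obj (D0 D)" "y \<in> Obj (D0 D)"
  shows "prj1 (P0 D) x y \<in> Arr (D0 D)" "prj2 (P0 D) x y \<in> Arr (D0 D)"
  using products0 assms by (auto simp: chosen_finite_products_def is_product_def hom_def)

theorem theorem8p16:
  fixes D :: "('o, 'a, 'p, 'c) cart_dbl_cat"
    and E :: "('o2, 'a2, 'p2, 'c2) cart_dbl_cat"
  assumes "cartesian_double_category D" and "cartesian_double_category E"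
  shows "two_category (CartLax D E)"
proof -
  interpret D: cartesian_double_category D by fact
  interpret E: cartesian_double_category E by fact
  interpret double_category_pair D E by unfold_locales
  \<comment> \<open>Cartesianness is strict naturality at each chosen projection, so it passes to
    composites one projection at a time.\<close>
  have comp: "cartesian_lax_transformation D E (trans_comp D E \<alpha> \<beta>)"
    if "cartesian_lax_transformation D E \<alpha>" "cartesian_lax_transformation D E \<beta>" "tcod \<alpha> = tdom \<beta>"
    for \<alpha> \<beta> :: "('o, 'a, 'p, 'c, 'o2, 'a2, 'p2, 'c2) trans"
    using that unfolding cartesian_lax_transformation_def
    by (simp add: trans_comp_lax strictly_natural_at_comp D.prj_Arr)
  have ident: "cartesian_lax_transformation D E (trans_id D E F)" if "cartesian_lax_functor D E F"
    for F :: "('o, 'a, 'p, 'c, 'o2, 'a2, 'p2, 'c2) lax_fun"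
    using that unfolding cartesian_lax_transformation_def
    by (simp add: cartesian_lax_functor_def trans_id_lax strictly_natural_at_id D.prj_Arr)
  have cart [simp]: "lax_transformation D E \<alpha>" "cartesian_lax_functor D E (tdom \<alpha>)"
    "cartesian_lax_functor D E (tcod \<alpha>)"
    if "cartesian_lax_transformation D E \<alpha>"
    for \<alpha> :: "('o, 'a, 'p, 'c, 'o2, 'a2, 'p2, 'c2) trans"
    using that by (simp_all add: cartesian_lax_transformation_def)
  let ?X = "CartLax D E"
  show ?thesis
  proof (rule two_category.intro)
    show "category (C1 ?X)"
      by (rule category.intro)
        (auto simp: CartLax_def hom_def comp ident trans_comp_assoc trans_comp_id_left trans_comp_id_right)
    show "category (C2 ?X)"
      by (rule category.intro)
        (auto simp: CartLax_def hom_def mod_comp_modulation mod_id_modulation mod_comp_assoc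
          mod_comp_id_left mod_comp_id_right)
  qed (auto simp: CartLax_def hom_def comp mod_hcomp_modulation mod_hcomp_id mod_interchange
      mod_hcomp_assoc mod_hcomp_id_left mod_hcomp_id_right)
qed

end
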